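(* For every $\epsilon>0$, there are $\sigma,\delta>0$ such that Dominating Set on an $n$-vertex graph with a $(\sigma,\delta)$-hub of size $p$ given in the input cannot be solved in time $(2-\epsilon)^p\cdot n^{\mathcal{O}(1)}$, unless both the SETH and the SCC fail.
   Context: For a graph $G$, a set $Q\subseteq V(G)$ is a $(\sigma,\delta)$-hub of $G$ if every connected component of $G-Q$ has at most $\sigma$ vertices and each such component is adjacent to at most $\delta$ vertices of $Q$. Dominating Set: given a graph $G$, find a minimum-size set $X\subseteq V(G)$ such that every vertex is in $X$ or has a neighbor in $X$. SETH: there is no $\epsilon>0$ such that for every $k$, every $n$-variable $k$-SAT instance can be solved in time $(2-\epsilon)^n n^{\mathcal{O}(1)}$. $\le d$-Set Cover: given universe $U$, family $\mathcal{F}$ of subsets of $U$ of size at most $d$ with $\bigcup\mathcal{F}=U$, and integer $t$, decide whether at most $t$ sets of $\mathcal{F}$ cover $U$. SCC: for all $\epsilon>0$ there is $d\ge1$ such that no algorithm solves every $\le d$-Set Cover instance in time $(2-\epsilon)^{|U|}|U|^{\mathcal{O}(1)}$. *)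

theory Defs
  imports Complex_Main "HOL-Library.Log_Nat"
begin

section \<open>Random access machines with logarithmic cost\<close>

text \<open>
  The model is the usual RAM: a program accesses finitely many registers and an unbounded
  memory, both holding natural numbers. Jumps are replaced by structured control flow,
  which changes running times by a constant factor only. Every instruction
  is charged the bit lengths of the numbers (addresses included) it handles, so that unbounded
  numbers do not yield unrealistic speed-ups. Subtraction is truncated.
\<close>

type_synonym reg = nat

datatype prog =
    Skip
  | SetConst reg nat
  | Add reg reg reg
  | Sub reg reg reg
  | Load reg reg
  | Store reg reg
  | Seq prog prog
  | IfNZ reg prog prog
  | WhileNZ reg prog

type_synonym state = "(reg \<Rightarrow> nat) \<times> (nat \<Rightarrow> nat)"

abbreviation bits :: "nat \<Rightarrow> nat" where
  "bits x \<equiv> floorlog 2 x"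

text \<open>\<open>exec P s t s'\<close>: started in \<open>s\<close>, the program \<open>P\<close> halts in \<open>s'\<close> at total cost \<open>t\<close>.\<close>

inductive exec :: "prog \<Rightarrow> state \<Rightarrow> nat \<Rightarrow> state \<Rightarrow> bool" where
  Skip: "exec Skip s 1 s"
| SetConst: "exec (SetConst r c) (R, M) (1 + bits c) (R(r := c), M)"
| Add: "exec (Add r a b) (R, M) (1 + bits (R a) + bits (R b)) (R(r := R a + R b), M)"
| Sub: "exec (Sub r a b) (R, M) (1 + bits (R a) + bits (R b)) (R(r := R a - R b), M)"
| Load: "exec (Load r a) (R, M) (1 + bits (R a) + bits (M (R a))) (R(r := M (R a)), M)"
| Store: "exec (Store a r) (R, M) (1 + bits (R a) + bits (R r)) (R, M(R a := R r))"
| Seq: "exec P s t s' \<Longrightarrow> exec Q s' t' s'' \<Longrightarrow> exec (Seq P Q) s (t + t') s''"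
| IfTrue: "R r \<noteq> 0 \<Longrightarrow> exec P (R, M) t s' \<Longrightarrow> exec (IfNZ r P Q) (R, M) (1 + bits (R r) + t) s'"
| IfFalse: "R r = 0 \<Longrightarrow> exec Q (R, M) t s' \<Longrightarrow> exec (IfNZ r P Q) (R, M) (1 + bits (R r) + t) s'"
| WhileTrue: "R r \<noteq> 0 \<Longrightarrow> exec P (R, M) t s' \<Longrightarrow> exec (WhileNZ r P) s' t' s'' \<Longrightarrow>
    exec (WhileNZ r P) (R, M) (1 + bits (R r) + t + t') s''"
| WhileFalse: "R r = 0 \<Longrightarrow> exec (WhileNZ r P) (R, M) (1 + bits (R r)) (R, M)"

inductive_cases SkipE: "exec Skip s t s'"
  and SetConstE: "exec (SetConst r c) s t s'"
  and AddE: "exec (Add r a b) s t s'"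
  and SubE: "exec (Sub r a b) s t s'"
  and LoadE: "exec (Load r a) s t s'"
  and StoreE: "exec (Store a r) s t s'"
  and SeqE: "exec (Seq P Q) s t s'"
  and IfNZE: "exec (IfNZ r P Q) s t s'"
  and WhileNZE: "exec (WhileNZ r P) s t s'"

lemma exec_deterministic:
  "exec P s t s' \<Longrightarrow> exec P s u s'' \<Longrightarrow> t = u \<and> s' = s''"
proof (induction arbitrary: u s'' rule: exec.induct)
  case (Skip s) then show ?case by (elim SkipE) simp
next
  case SetConst then show ?case by (elim SetConstE) simp
next
  case Add then show ?case by (elim AddE) simp
next
  case Sub then show ?case by (elim SubE) simp
next
  case Load then show ?case by (elim LoadE) simp
next
  case Store then show ?case by (elim StoreE) simp
next
  case Seq
  from Seq.prems show ?case by (rule SeqE) (use Seq.IH in metis)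
next
  case IfTrue
  from IfTrue.prems show ?case by (rule IfNZE) (use IfTrue.hyps in \<open>auto dest: IfTrue.IH\<close>)
next
  case IfFalse
  from IfFalse.prems show ?case by (rule IfNZE) (use IfFalse.hyps in \<open>auto dest: IfFalse.IH\<close>)
next
  case (WhileTrue R r P M t s' t' s2)
  from WhileTrue.prems show ?case
  proof (rule WhileNZE)
    fix R' M' t1 s1 t2
    assume "(R, M) = (R', M')" and "u = Suc (bits (R' r) + t1 + t2)"
      and "exec P (R', M') t1 s1" and "exec (WhileNZ r P) s1 t2 s''"
    then show ?case using WhileTrue.IH(1)[of t1 s1] WhileTrue.IH(2)[of t2 s''] by auto
  qed (use WhileTrue.hyps in auto)
next
  case WhileFalse
  from WhileFalse.prems show ?case
    by (rule WhileNZE) (use WhileFalse.hyps in auto)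
qed

lemma exec_cost_pos: "exec P s t s' \<Longrightarrow> t > 0"
  by (induction rule: exec.induct) auto

text \<open>
  Input and output are lists of numbers: register \<open>0\<close> holds the length of the list and the memory
  cells from address \<open>0\<close> on hold its entries. All other registers and cells are initially \<open>0\<close>.
\<close>

definition init_state :: "nat list \<Rightarrow> state" where
  "init_state xs = ((\<lambda>r. if r = 0 then length xs else 0),
                    (\<lambda>a. if a < length xs then xs ! a else 0))"

definition result :: "state \<Rightarrow> nat list" where
  "result s = map (snd s) [0..<fst s 0]"

definition solves_within ::
  "prog \<Rightarrow> ('i \<Rightarrow> bool) \<Rightarrow> ('i \<Rightarrow> nat list) \<Rightarrow> ('i \<Rightarrow> nat list \<Rightarrow> bool) \<Rightarrow> ('i \<Rightarrow> real) \<Rightarrow> bool" where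
  "solves_within P valid enc correct T \<longleftrightarrow>
     (\<forall>i. valid i \<longrightarrow>
        (\<exists>t s. exec P (init_state (enc i)) t s \<and> real t \<le> T i \<and> correct i (result s)))"

text \<open>
  Running time \<open>b ^ k * n ^ O(1)\<close>, where \<open>k\<close> and \<open>n\<close> are parameters of the instance. The summand \<open>2\<close>
  makes the powers with constant exponent absorb constant factors and the cases \<open>n \<le> 1\<close>.
\<close>

definition solvable_in_time ::
  "('i \<Rightarrow> bool) \<Rightarrow> ('i \<Rightarrow> nat list) \<Rightarrow> ('i \<Rightarrow> nat list \<Rightarrow> bool) \<Rightarrow>
     real \<Rightarrow> ('i \<Rightarrow> nat) \<Rightarrow> ('i \<Rightarrow> nat) \<Rightarrow> bool" where
  "solvable_in_time valid enc correct b k n \<longleftrightarrow>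
     (\<exists>P c. solves_within P valid enc correct (\<lambda>i. b ^ k i * (real (n i) + 2) ^ c))"

definition decides :: "bool \<Rightarrow> nat list \<Rightarrow> bool" where
  "decides A ys \<longleftrightarrow> ys = [if A then 1 else 0]"

definition enc_list :: "('a \<Rightarrow> nat list) \<Rightarrow> 'a list \<Rightarrow> nat list" where
  "enc_list f xs = length xs # concat (map f xs)"


section \<open>Satisfiability and the SETH\<close>

datatype literal = Pos nat | Neg nat

fun var :: "literal \<Rightarrow> nat" where
  "var (Pos x) = x"
| "var (Neg x) = x"

fun lit_true :: "(nat \<Rightarrow> bool) \<Rightarrow> literal \<Rightarrow> bool" where
  "lit_true \<alpha> (Pos x) = \<alpha> x"
| "lit_true \<alpha> (Neg x) = (\<not> \<alpha> x)"

definition satisfiable :: "literal set set \<Rightarrow> bool" where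
  "satisfiable \<Phi> \<longleftrightarrow> (\<exists>\<alpha>. \<forall>C\<in>\<Phi>. \<exists>l\<in>C. lit_true \<alpha> l)"

text \<open>
  A CNF formula is a set of clauses and a clause is a set of literals. An instance \<open>(n, cs)\<close> has the
  variables \<open>{..<n}\<close> and lists the clauses, and the literals of each clause, without repetition.
  For fixed \<open>k\<close> its length is therefore polynomial in \<open>n\<close>.
\<close>

type_synonym sat_instance = "nat \<times> literal list list"

fun sat_formula :: "sat_instance \<Rightarrow> literal set set" where
  "sat_formula (n, cs) = set ` set cs"

fun ksat_instance :: "nat \<Rightarrow> sat_instance \<Rightarrow> bool" where
  "ksat_instance k (n, cs) \<longleftrightarrow>
     distinct (map set cs) \<and>
     (\<forall>C\<in>set cs. distinct C \<and> length C \<le> k \<and> var ` set C \<subseteq> {..<n})"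

fun enc_literal :: "literal \<Rightarrow> nat list" where
  "enc_literal (Pos x) = [2 * x]"
| "enc_literal (Neg x) = [2 * x + 1]"

fun enc_sat :: "sat_instance \<Rightarrow> nat list" where
  "enc_sat (n, cs) = n # enc_list (enc_list enc_literal) cs"

definition ksat_solvable :: "nat \<Rightarrow> real \<Rightarrow> bool" where
  "ksat_solvable k b \<longleftrightarrow>
     solvable_in_time (ksat_instance k) enc_sat (\<lambda>i. decides (satisfiable (sat_formula i))) b fst fst"

definition SETH :: bool where
  "SETH \<longleftrightarrow> \<not> (\<exists>\<epsilon>::real. \<epsilon> > 0 \<and> (\<forall>k. ksat_solvable k (2 - \<epsilon>)))"


section \<open>Set cover and the SCC\<close>

definition has_cover :: "'a set \<Rightarrow> 'a set set \<Rightarrow> nat \<Rightarrow> bool" where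
  "has_cover U F t \<longleftrightarrow> (\<exists>C\<subseteq>F. finite C \<and> card C \<le> t \<and> \<Union>C = U)"

text \<open>
  An instance \<open>(u, fs, t)\<close> has the universe \<open>{..<u}\<close> and lists the sets of the family, and the
  elements of each set, without repetition. The condition \<open>t \<le> |F|\<close> excludes only trivial
  instances; it is needed because merely inspecting an unbounded \<open>t\<close> is not possible
  in time depending on \<open>|U|\<close> alone.
\<close>

type_synonym sc_instance = "nat \<times> nat list list \<times> nat"

fun sc_instance :: "nat \<Rightarrow> sc_instance \<Rightarrow> bool" where
  "sc_instance d (u, fs, t) \<longleftrightarrow>
     distinct (map set fs) \<and>
     (\<forall>S\<in>set fs. distinct S \<and> length S \<le> d) \<and>
     \<Union>(set ` set fs) = {..<u} \<and>
     t \<le> length fs"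

fun sc_yes :: "sc_instance \<Rightarrow> bool" where
  "sc_yes (u, fs, t) \<longleftrightarrow> has_cover {..<u} (set ` set fs) t"

fun enc_sc :: "sc_instance \<Rightarrow> nat list" where
  "enc_sc (u, fs, t) = u # t # enc_list (enc_list (\<lambda>x. [x])) fs"

definition set_cover_solvable :: "nat \<Rightarrow> real \<Rightarrow> bool" where
  "set_cover_solvable d b \<longleftrightarrow>
     solvable_in_time (sc_instance d) enc_sc (\<lambda>i. decides (sc_yes i)) b fst fst"

definition SCC :: bool where
  "SCC \<longleftrightarrow> (\<forall>\<epsilon>::real. \<epsilon> > 0 \<longrightarrow> (\<exists>d\<ge>1. \<not> set_cover_solvable d (2 - \<epsilon>)))"


section \<open>Hubs and dominating sets\<close>

definition simple_graph :: "'a set \<Rightarrow> 'a set set \<Rightarrow> bool" where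
  "simple_graph V E \<longleftrightarrow> finite V \<and> (\<forall>e\<in>E. e \<subseteq> V \<and> card e = 2)"

text \<open>The vertex sets of the connected components of the subgraph induced by \<open>W\<close>.\<close>

definition components_on :: "'a set \<Rightarrow> 'a set set \<Rightarrow> 'a set set" where
  "components_on W E = (\<lambda>v. {(x, y). x \<in> W \<and> y \<in> W \<and> {x, y} \<in> E}\<^sup>* `` {v}) ` W"

definition is_hub :: "nat \<Rightarrow> nat \<Rightarrow> 'a set \<Rightarrow> 'a set set \<Rightarrow> 'a set \<Rightarrow> bool" where
  "is_hub \<sigma> \<delta> V E Q \<longleftrightarrow> Q \<subseteq> V \<and>
     (\<forall>C\<in>components_on (V - Q) E. card C \<le> \<sigma> \<and> card {q\<in>Q. \<exists>v\<in>C. {q, v} \<in> E} \<le> \<delta>)"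

definition dominating_set :: "'a set \<Rightarrow> 'a set set \<Rightarrow> 'a set \<Rightarrow> bool" where
  "dominating_set V E X \<longleftrightarrow> X \<subseteq> V \<and> (\<forall>v\<in>V. v \<in> X \<or> (\<exists>x\<in>X. {v, x} \<in> E))"

definition min_dominating_set :: "'a set \<Rightarrow> 'a set set \<Rightarrow> 'a set \<Rightarrow> bool" where
  "min_dominating_set V E X \<longleftrightarrow>
     dominating_set V E X \<and> (\<forall>Y. dominating_set V E Y \<longrightarrow> card X \<le> card Y)"

text \<open>
  An instance \<open>(n, es, qs)\<close> has the vertices \<open>{..<n}\<close> and lists the edges and the
  hub vertices without repetition.
\<close>

type_synonym ds_instance = "nat \<times> (nat \<times> nat) list \<times> nat list"

fun edge :: "nat \<times> nat \<Rightarrow> nat set" where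
  "edge (u, v) = {u, v}"

fun hub_instance :: "nat \<Rightarrow> nat \<Rightarrow> ds_instance \<Rightarrow> bool" where
  "hub_instance \<sigma> \<delta> (n, es, qs) \<longleftrightarrow>
     distinct (map edge es) \<and> simple_graph {..<n} (edge ` set es) \<and>
     distinct qs \<and> is_hub \<sigma> \<delta> {..<n} (edge ` set es) (set qs)"

fun ds_solution :: "ds_instance \<Rightarrow> nat list \<Rightarrow> bool" where
  "ds_solution (n, es, qs) xs \<longleftrightarrow>
     distinct xs \<and> min_dominating_set {..<n} (edge ` set es) (set xs)"

fun enc_ds :: "ds_instance \<Rightarrow> nat list" where
  "enc_ds (n, es, qs) = n # enc_list (\<lambda>(u, v). [u, v]) es @ enc_list (\<lambda>q. [q]) qs"

fun num_vertices :: "ds_instance \<Rightarrow> nat" where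
  "num_vertices (n, es, qs) = n"

fun hub_size :: "ds_instance \<Rightarrow> nat" where
  "hub_size (n, es, qs) = card (set qs)"

definition dominating_set_hub_solvable :: "nat \<Rightarrow> nat \<Rightarrow> real \<Rightarrow> bool" where
  "dominating_set_hub_solvable \<sigma> \<delta> b \<longleftrightarrow>
     solvable_in_time (hub_instance \<sigma> \<delta>) enc_ds ds_solution b hub_size num_vertices"

end

theory Submission
  imports Defs "HOL-Library.FuncSet"
begin

text \<open>
  Both Set Cover and \<open>k\<close>-SAT reduce to Dominating Set on graphs in which the vertices outside of the
  hub are independent, so that \<open>\<sigma> = 1\<close> suffices.

  For Set Cover the hub consists of the elements of the universe and one vertex \<open>z\<close>. There is a vertex
  for each set, adjacent to its elements and to \<open>z\<close>, and a pendant vertex at \<open>z\<close>. Selecting \<open>z\<close> is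
  free, and a selected element can be exchanged for a set containing it.

  For \<open>k\<close>-SAT, the variables are split into blocks of \<open>\<beta>\<close> variables, and the assignments of a block are
  encoded by the \<open>H\<close>-subsets of \<open>2 * H\<close> hub vertices. As \<open>2 * H choose H\<close> is close to \<open>4 ^ H\<close>, the
  hub has only \<open>(1 + o(1)) * n\<close> vertices. A vertex outside of the hub demands that a set of hub vertices
  be hit. Hitting all \<open>(H + 1)\<close>-subsets of each block forces at least \<open>H\<close> selected vertices per block,
  hence exactly \<open>H\<close> within the budget. A combination of block assignments that falsifies a clause is
  excluded by demanding that the complement of its encoding be hit. Here \<open>z\<close> dominates the blocks.

  The instances are computed by programs of a small language whose values and
  running times are polynomially bounded by construction.
\<close>

section \<open>Polynomially bounded functions\<close>

text \<open>A solver with base below 2 per hub vertex yields a base below 2 per variable only if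
  almost one variable is encoded per hub vertex. Two vertices per variable, one for each literal,
  would give nothing for bases from the square root of 2 on. Moreover, demands to be dominated are
  monotone: they can require that something is selected, never that something is not. Selections of
  a common size \<open>H\<close> resolve both difficulties. Being an antichain, they can be told
  apart by monotone demands, and at the middle size there are enough of them that a block of
  \<open>2 * H\<close> vertices loses only logarithmically many bits.

  Refuting \<open>SETH\<close> takes a single base below 2 that serves all \<open>k\<close>. Hence
  \<open>H\<close> and \<open>\<beta>\<close> depend on the base of the solver only, while
  \<open>k\<close> enters the number of constraints and the degree bound \<open>\<delta>\<close>.
  The codes are merely shown to exist; as their parameters are constants, they become tables inside
  the program.

  Vertices outside of the hub may be selected themselves. Such a vertex is exchanged for a hub
  vertex that it demands, and where it demands none, the budget is already exhausted by the
  blocks.\<close>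

definition poly_bounded :: "(nat \<Rightarrow> nat) \<Rightarrow> bool" where
  "poly_bounded f \<longleftrightarrow> (\<exists>c. \<forall>B. f B \<le> (B + 2) ^ c)"

lemma poly_bounded_mono:
  assumes "poly_bounded g" and "\<And>B. f B \<le> g B"
  shows "poly_bounded f"
  using assms unfolding poly_bounded_def by (meson order_trans)

lemma poly_bounded_const [intro]: "poly_bounded (\<lambda>_. c)"
  unfolding poly_bounded_def
proof (intro exI allI)
  fix B :: nat
  have "c \<le> 2 ^ c" by (simp add: less_imp_le)
  also have "\<dots> \<le> (B + 2) ^ c" by (simp add: power_mono)
  finally show "c \<le> (B + 2) ^ c" .
qed

lemma poly_bounded_id [intro]: "poly_bounded (\<lambda>B. B)"
  unfolding poly_bounded_def by (rule exI[of _ 1]) simp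

lemma poly_bounded_add [intro]:
  assumes "poly_bounded f" and "poly_bounded g"
  shows "poly_bounded (\<lambda>B. f B + g B)"
proof -
  obtain a b where a: "\<And>B. f B \<le> (B + 2) ^ a" and b: "\<And>B. g B \<le> (B + 2) ^ b"
    using assms unfolding poly_bounded_def by blast
  have "f B + g B \<le> (B + 2) ^ (a + b + 1)" for B
  proof -
    have "f B + g B \<le> (B + 2) ^ (a + b) + (B + 2) ^ (a + b)"
      by (rule add_mono; rule order_trans[OF a] order_trans[OF b]; simp add: power_increasing)
    also have "\<dots> \<le> (B + 2) ^ (a + b + 1)" by (simp add: algebra_simps)
    finally show ?thesis .
  qed
  then show ?thesis unfolding poly_bounded_def by blast
qed

lemma poly_bounded_mult [intro]:
  assumes "poly_bounded f" and "poly_bounded g"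
  shows "poly_bounded (\<lambda>B. f B * g B)"
proof -
  obtain a b where a: "\<And>B. f B \<le> (B + 2) ^ a" and b: "\<And>B. g B \<le> (B + 2) ^ b"
    using assms unfolding poly_bounded_def by blast
  have "f B * g B \<le> (B + 2) ^ (a + b)" for B
    unfolding power_add by (rule mult_mono[OF a b]) auto
  then show ?thesis unfolding poly_bounded_def by blast
qed

lemma poly_bounded_Suc [intro]: "poly_bounded f \<Longrightarrow> poly_bounded (\<lambda>B. Suc (f B))"
  using poly_bounded_add[of f "\<lambda>_. 1"] by auto

lemma poly_bounded_power [intro]: "poly_bounded f \<Longrightarrow> poly_bounded (\<lambda>B. f B ^ k)"
  by (induction k) auto

lemma poly_bounded_comp:
  assumes "poly_bounded f" and "poly_bounded g"
  shows "poly_bounded (\<lambda>B. f (g B))"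
proof -
  obtain a where a: "\<And>B. f B \<le> (B + 2) ^ a"
    using assms unfolding poly_bounded_def by blast
  have "poly_bounded (\<lambda>B. (g B + 2) ^ a)" 
    by (intro poly_bounded_power poly_bounded_add poly_bounded_const assms(2))
  then show ?thesis by (rule poly_bounded_mono) (rule a)
qed

section \<open>Weakest preconditions for the random access machine\<close>

text \<open>The postcondition also sees the exact cost. As \<open>exec\<close> is deterministic, the
  existential form pins down the outcome, so the rules below are equations and the simplifier can
  execute straight-line programs.\<close>

definition wp :: "prog \<Rightarrow> (nat \<Rightarrow> nat) \<Rightarrow> (nat \<Rightarrow> nat) \<Rightarrow>
    (nat \<Rightarrow> (nat \<Rightarrow> nat) \<Rightarrow> (nat \<Rightarrow> nat) \<Rightarrow> bool) \<Rightarrow> bool" where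
  "wp P R M Q \<longleftrightarrow> (\<exists>t R' M'. exec P (R, M) t (R', M') \<and> Q t R' M')"

lemma wp_mono:
  assumes "wp P R M Q" and "\<And>t R' M'. Q t R' M' \<Longrightarrow> Q' t R' M'"
  shows "wp P R M Q'"
  using assms unfolding wp_def by blast

lemma wp_exec: "exec P (R, M) t (R', M') \<Longrightarrow> wp P R M Q \<longleftrightarrow> Q t R' M'"
  unfolding wp_def by (blast dest: exec_deterministic)

lemma wp_Skip [simp]: "wp Skip R M Q \<longleftrightarrow> Q 1 R M"
  by (rule wp_exec[OF exec.Skip])

lemma wp_SetConst [simp]: "wp (SetConst r c) R M Q \<longleftrightarrow> Q (1 + bits c) (R(r := c)) M"
  by (rule wp_exec[OF exec.SetConst])

lemma wp_Add [simp]: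
  "wp (Add r a b) R M Q \<longleftrightarrow> Q (1 + bits (R a) + bits (R b)) (R(r := R a + R b)) M"
  by (rule wp_exec[OF exec.Add])

lemma wp_Sub [simp]:
  "wp (Sub r a b) R M Q \<longleftrightarrow> Q (1 + bits (R a) + bits (R b)) (R(r := R a - R b)) M"
  by (rule wp_exec[OF exec.Sub])

lemma wp_Load [simp]:
  "wp (Load r a) R M Q \<longleftrightarrow> Q (1 + bits (R a) + bits (M (R a))) (R(r := M (R a))) M"
  by (rule wp_exec[OF exec.Load])

lemma wp_Store [simp]:
  "wp (Store a r) R M Q \<longleftrightarrow> Q (1 + bits (R a) + bits (R r)) R (M(R a := R r))"
  by (rule wp_exec[OF exec.Store])

lemma wp_Seq [simp]:
  "wp (Seq P P') R M Q \<longleftrightarrow> wp P R M (\<lambda>t R' M'. wp P' R' M' (\<lambda>t'. Q (t + t')))"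
  (is "?L \<longleftrightarrow> ?R")
proof
  assume ?L
  then obtain t R' M' where "exec (Seq P P') (R, M) t (R', M')" and Q: "Q t R' M'"
    unfolding wp_def by blast
  from this(1) show ?R
  proof (rule SeqE)
    fix t1 s1 t2
    assume "t = t1 + t2" "exec P (R, M) t1 s1" "exec P' s1 t2 (R', M')"
    with Q show ?R unfolding wp_def by (cases s1) blast
  qed
next
  assume ?R then show ?L unfolding wp_def by (meson exec.Seq)
qed

lemma wp_IfNZ [simp]:
  "wp (IfNZ r P P') R M Q \<longleftrightarrow>
     wp (if R r \<noteq> 0 then P else P') R M (\<lambda>t. Q (1 + bits (R r) + t))" (is "?L \<longleftrightarrow> ?R")
proof
  assume ?L
  then obtain t R' M' where "exec (IfNZ r P P') (R, M) t (R', M')" and Q: "Q t R' M'"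
    unfolding wp_def by blast
  from this(1) show ?R by (rule IfNZE) (use Q in \<open>auto simp: wp_def\<close>)
next
  assume ?R
  then obtain t R' M' where e: "exec (if R r \<noteq> 0 then P else P') (R, M) t (R', M')"
    and Q: "Q (1 + bits (R r) + t) R' M'"
    unfolding wp_def by blast
  from e have "exec (IfNZ r P P') (R, M) (1 + bits (R r) + t) (R', M')"
    using exec.IfTrue[of R r P M t _ P'] exec.IfFalse[of R r P' M t _ P]
    by (cases "R r = 0") auto
  with Q show ?L unfolding wp_def by blast
qed

text \<open>Throughout, logarithmic costs are estimated by the numbers themselves. This crude bound
  suffices because all numbers that occur are polynomially bounded.\<close>

lemma bits_le [simp]: "bits x \<le> x"
proof (cases "x = 0")
  case False
  have "x < 2 ^ x" by simp
  then show ?thesis by (simp add: floorlog_le_iff)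
qed (simp add: floorlog_def)

lemma bits_0 [simp]: "bits 0 = 0" and bits_1 [simp]: "bits (Suc 0) = 1"
  by (simp_all add: floorlog_def)

lemma bits_le_trans: "x \<le> y \<Longrightarrow> bits x \<le> y"
  using bits_le[of x] by linarith

text \<open>Rule for counting loops: \<open>j\<close> rounds are finished and register
  \<open>c\<close> holds the number of remaining ones. Each of the \<open>n + 1\<close> tests costs
  at most \<open>n + 1\<close>, each of the \<open>n\<close> rounds at most
  \<open>T\<close>.\<close>

lemma wp_WhileNZ:
  assumes step: "\<And>j R M. j < n \<Longrightarrow> I j R M \<Longrightarrow> wp P R M (\<lambda>t R' M'. t \<le> T \<and> I (Suc j) R' M')"
    and cnt: "\<And>j R M. j \<le> n \<Longrightarrow> I j R M \<Longrightarrow> R c = n - j"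
    and init: "I 0 R M"
    and post: "\<And>t R' M'. t \<le> Suc n * (T + n + 1) \<Longrightarrow> I n R' M' \<Longrightarrow> Q t R' M'"
  shows "wp (WhileNZ c P) R M Q"
proof -
  have "wp (WhileNZ c P) R M (\<lambda>t R' M'. t \<le> Suc (n - j) * (T + n + 1) \<and> I n R' M')"
    if "j \<le> n" "I j R M" for j R M
    using that
  proof (induction j arbitrary: R M rule: inc_induct)
    case base
    then have "exec (WhileNZ c P) (R, M) (1 + bits (R c)) (R, M)"
      using cnt[of n R M] by (intro exec.WhileFalse) auto
    with base cnt[of n R M] show ?case unfolding wp_def by fastforce
  next
    case (step j)
    from assms(1)[OF step.hyps(2) step.prems] obtain t R' M' where
      t: "exec P (R, M) t (R', M')" "t \<le> T" "I (Suc j) R' M'" unfolding wp_def by blast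
    from step.IH[OF t(3)] obtain t' R'' M'' where
      t': "exec (WhileNZ c P) (R', M') t' (R'', M'')" "t' \<le> Suc (n - Suc j) * (T + n + 1)" "I n R'' M''"
      unfolding wp_def by blast
    have Rc: "R c = n - j" using cnt[of j] step by auto
    then have "exec (WhileNZ c P) (R, M) (1 + bits (R c) + t + t') (R'', M'')"
      using step.hyps t(1) t'(1) by (intro exec.WhileTrue) auto
    moreover have "1 + bits (R c) + t + t' \<le> Suc (n - j) * (T + n + 1)"
    proof -
      have "bits (R c) \<le> n" using Rc bits_le_trans[of "R c" n] by simp
      moreover have "Suc (n - j) * (T + n + 1) = (T + n + 1) + Suc (n - Suc j) * (T + n + 1)"
        using step.hyps by (simp add: Suc_diff_Suc[symmetric])
      ultimately show ?thesis using t(2) t'(2) by linarith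
    qed
    ultimately show ?case using t'(3) unfolding wp_def by blast
  qed
  from this[of 0, OF le0 init] show ?thesis
    by (rule wp_mono) (use post in auto)
qed

section \<open>Registers outside the reach of a program\<close>

fun reg_bound :: "prog \<Rightarrow> nat" where
  "reg_bound Skip = 0"
| "reg_bound (SetConst r c) = Suc r"
| "reg_bound (Add r a b) = Suc (max r (max a b))"
| "reg_bound (Sub r a b) = Suc (max r (max a b))"
| "reg_bound (Load r a) = Suc (max r a)"
| "reg_bound (Store a r) = Suc (max r a)"
| "reg_bound (Seq P Q) = max (reg_bound P) (reg_bound Q)"
| "reg_bound (IfNZ r P Q) = max (Suc r) (max (reg_bound P) (reg_bound Q))"
| "reg_bound (WhileNZ r P) = max (Suc r) (reg_bound P)"

text \<open>The solver is an arbitrary program whose runs are known only from initial states. This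
  lemma allows running it while a register beyond its reach stores other data, namely the
  budget.\<close>

lemma exec_frame:
  assumes "exec P s t s'" and "reg_bound P \<le> K" and "\<And>r. r < K \<Longrightarrow> R r = fst s r"
  shows "exec P (R, snd s) t (\<lambda>r. if r < K then fst s' r else R r, snd s')"
  using assms
proof (induction arbitrary: R rule: exec.induct)
  case (Skip s)
  then have "(\<lambda>r. if r < K then fst s r else R r) = R" by auto
  then show ?case using exec.Skip by simp
next
  case (SetConst r c R0 M)
  then have "(\<lambda>x. if x < K then fst (R0(r := c), M) x else R x) = R(r := c)" by (auto simp: fun_eq_iff)
  then show ?case using exec.SetConst[of r c R M] by simp
next
  case (Add r a b R0 M)
  then have "(\<lambda>x. if x < K then fst (R0(r := R0 a + R0 b), M) x else R x) = R(r := R a + R b)" by (auto simp: fun_eq_iff)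
  then show ?case using exec.Add[of r a b R M] Add by simp
next
  case (Sub r a b R0 M)
  then have "(\<lambda>x. if x < K then fst (R0(r := R0 a - R0 b), M) x else R x) = R(r := R a - R b)" by (auto simp: fun_eq_iff)
  then show ?case using exec.Sub[of r a b R M] Sub by simp
next
  case (Load r a R0 M)
  then have "(\<lambda>x. if x < K then fst (R0(r := M (R0 a)), M) x else R x) = R(r := M (R a))" by (auto simp: fun_eq_iff)
  then show ?case using exec.Load[of r a R M] Load by simp
next
  case (Store a r R0 M)
  then have "(\<lambda>x. if x < K then fst (R0, M(R0 a := R0 r)) x else R x) = R"
    and "R a = R0 a" "R r = R0 r" by auto
  then show ?case using exec.Store[of a r R M] by (simp add: fun_upd_def)
next
  case (Seq P s t s' Q t' s'')
  from Seq.IH(1)[of R] Seq.prems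
  have 1: "exec P (R, snd s) t (\<lambda>r. if r < K then fst s' r else R r, snd s')" by auto
  from Seq.IH(2)[of "\<lambda>r. if r < K then fst s' r else R r"] Seq.prems
  have 2: "exec Q (\<lambda>r. if r < K then fst s' r else R r, snd s') t'
     (\<lambda>r. if r < K then fst s'' r else R r, snd s'')" by (simp cong: if_cong)
  from exec.Seq[OF 1 2] show ?case .
next
  case (IfTrue R0 r P M t s' Q)
  then have "R r = R0 r" "exec P (R, M) t (\<lambda>r. if r < K then fst s' r else R r, snd s')" by auto
  with exec.IfTrue[of R r P M t _ Q] IfTrue show ?case by simp
next
  case (IfFalse R0 r Q M t s' P)
  then have "R r = R0 r" "exec Q (R, M) t (\<lambda>r. if r < K then fst s' r else R r, snd s')" by auto
  with exec.IfFalse[of R r Q M t _ P] IfFalse show ?case by simp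
next
  case (WhileTrue R0 r P M t s' t' s'')
  have r: "R r = R0 r" using WhileTrue by simp
  from WhileTrue.IH(1)[of R] WhileTrue.prems
  have 1: "exec P (R, M) t (\<lambda>r. if r < K then fst s' r else R r, snd s')" by auto
  from WhileTrue.IH(2)[of "\<lambda>r. if r < K then fst s' r else R r"] WhileTrue.prems
  have 2: "exec (WhileNZ r P) (\<lambda>r. if r < K then fst s' r else R r, snd s') t'
     (\<lambda>r. if r < K then fst s'' r else R r, snd s'')" by (simp cong: if_cong)
  from exec.WhileTrue[of R r, OF _ 1 2] r WhileTrue.hyps show ?case by simp
next
  case (WhileFalse R0 r P M)
  then have "(\<lambda>x. if x < K then fst (R0, M) x else R x) = R" and "R r = R0 r" by auto
  then show ?case using exec.WhileFalse[where R = R and r = r and P = P and M = M] WhileFalse by simp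
qed

text \<open>The frame property with \<open>K = r\<close> and the given registers themselves yields a
  second run in which register \<open>r\<close> is kept; determinism identifies both runs.\<close>

corollary exec_reg_unchanged:
  assumes "exec P (R, M) t (R', M')" and "reg_bound P \<le> r"
  shows "R' r = R r"
proof -
  have "exec P (R, M) t (\<lambda>x. if x < r then R' x else R x, M')"
    using exec_frame[OF assms(1), of r R] assms(2) by (simp cong: if_cong)
  from exec_deterministic[OF this assms(1)] have "(\<lambda>x. if x < r then R' x else R x) = R'" by simp
  from fun_cong[OF this, of r] show ?thesis by simp
qed

section \<open>A language of polynomial time list generators\<close>

text \<open>
  Expressions denote numbers and generators denote lists. The input list \<open>xs\<close> is read-only.
  Iteration is clipped at the length of the input, so that all values are bounded by a polynomial
  in the length and the entries of the input.
\<close>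

datatype exp =
    Const nat
  | Var nat
  | Plus exp exp
  | Minus exp exp
  | Read exp
  | Cond exp exp exp
  | Sum nat exp exp
  | Iter nat exp exp exp

datatype gen =
    Emit exp
  | App gen gen
  | Guard exp gen
  | For nat exp gen

fun eval :: "nat list \<Rightarrow> (nat \<Rightarrow> nat) \<Rightarrow> exp \<Rightarrow> nat" where
  "eval xs \<rho> (Const c) = c"
| "eval xs \<rho> (Var v) = \<rho> v"
| "eval xs \<rho> (Plus a b) = eval xs \<rho> a + eval xs \<rho> b"
| "eval xs \<rho> (Minus a b) = eval xs \<rho> a - eval xs \<rho> b"
| "eval xs \<rho> (Read a) = (if eval xs \<rho> a < length xs then xs ! eval xs \<rho> a else 0)"
| "eval xs \<rho> (Cond c a b) = (if eval xs \<rho> c \<noteq> 0 then eval xs \<rho> a else eval xs \<rho> b)"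
| "eval xs \<rho> (Sum v n a) = (\<Sum>i<eval xs \<rho> n. eval xs (\<rho>(v := i)) a)"
| "eval xs \<rho> (Iter v n a b) =
     ((\<lambda>x. min (eval xs (\<rho>(v := x)) b) (length xs)) ^^ eval xs \<rho> n) (eval xs \<rho> a)"

fun gens :: "nat list \<Rightarrow> (nat \<Rightarrow> nat) \<Rightarrow> gen \<Rightarrow> nat list" where
  "gens xs \<rho> (Emit a) = [eval xs \<rho> a]"
| "gens xs \<rho> (App g h) = gens xs \<rho> g @ gens xs \<rho> h"
| "gens xs \<rho> (Guard a g) = (if eval xs \<rho> a \<noteq> 0 then gens xs \<rho> g else [])"
| "gens xs \<rho> (For v n g) = concat (map (\<lambda>i. gens xs (\<rho>(v := i)) g) [0..<eval xs \<rho> n])"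

text \<open>Here \<open>B\<close> bounds the input length, the input entries and the environment.
  The bound variable of \<open>Sum\<close> stays below the number of rounds, hence the enlarged
  argument for the body. In \<open>Iter\<close>, the clipping bounds every iterate after the start
  value by the input length, whatever the number of rounds; otherwise repeated doubling would
  produce exponential values.\<close>

fun val_bound :: "exp \<Rightarrow> nat \<Rightarrow> nat" where
  "val_bound (Const c) B = c"
| "val_bound (Var v) B = B"
| "val_bound (Plus a b) B = val_bound a B + val_bound b B"
| "val_bound (Minus a b) B = val_bound a B"
| "val_bound (Read a) B = B"
| "val_bound (Cond c a b) B = val_bound a B + val_bound b B"
| "val_bound (Sum v n a) B = val_bound n B * val_bound a (B + val_bound n B)"
| "val_bound (Iter v n a b) B = B + val_bound a B"

definition bounded_by :: "nat \<Rightarrow> nat list \<Rightarrow> (nat \<Rightarrow> nat) \<Rightarrow> bool" where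
  "bounded_by B xs \<rho> \<longleftrightarrow> length xs \<le> B \<and> (\<forall>x\<in>set xs. x \<le> B) \<and> (\<forall>v. \<rho> v \<le> B)"

lemma bounded_by_upd: "bounded_by B xs \<rho> \<Longrightarrow> i \<le> C \<Longrightarrow> bounded_by (B + C) xs (\<rho>(v := i))"
  unfolding bounded_by_def by (auto simp: trans_le_add1)

lemma eval_le_val_bound: "bounded_by B xs \<rho> \<Longrightarrow> eval xs \<rho> a \<le> val_bound a B"
proof (induction a arbitrary: B \<rho>)
  case (Plus a b) then show ?case by (simp add: add_mono)
next
  case (Minus a b) then show ?case by (simp add: le_diff_conv trans_le_add1)
next
  case (Cond c a b)
  then show ?case by (auto intro: trans_le_add1 trans_le_add2)
next
  case (Sum v n a)
  let ?n = "eval xs \<rho> n"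
  have n: "?n \<le> val_bound n B" using Sum by auto
  have "(\<Sum>i<?n. eval xs (\<rho>(v := i)) a) \<le> (\<Sum>i<?n. val_bound a (B + val_bound n B))"
    using Sum.IH(2) Sum.prems n by (intro sum_mono Sum.IH(2) bounded_by_upd) auto
  also have "\<dots> \<le> val_bound n B * val_bound a (B + val_bound n B)" using n by simp
  finally show ?case by simp
next
  case (Iter v n a b)
  let ?f = "\<lambda>x. min (eval xs (\<rho>(v := x)) b) (length xs)"
  have "(?f ^^ m) (eval xs \<rho> a) \<le> B + val_bound a B" for m
  proof (cases m)
    case 0 then show ?thesis using Iter.IH(2)[OF Iter.prems] by simp
  next
    case (Suc m)
    have "(?f ^^ Suc m) (eval xs \<rho> a) \<le> length xs" by simp
    also have "\<dots> \<le> B + val_bound a B" using Iter.prems unfolding bounded_by_def by simp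
    finally show ?thesis using Suc by simp
  qed
  then show ?case by simp
qed (auto simp: bounded_by_def)

lemma poly_val_bound: "poly_bounded (val_bound a)"
proof (induction a)
  case (Sum v n a)
  have "poly_bounded (\<lambda>B. val_bound n B * val_bound a (B + val_bound n B))"
    by (intro poly_bounded_mult Sum poly_bounded_comp[OF Sum(2)] poly_bounded_add poly_bounded_id)
  then show ?case by simp
next
  case (Plus a b) then show ?case using poly_bounded_add[of "val_bound a" "val_bound b"] by simp
next
  case (Cond c a b) then show ?case using poly_bounded_add[of "val_bound a" "val_bound b"] by simp
next
  case (Iter v n a b) then show ?case using poly_bounded_add[OF poly_bounded_id, of "val_bound a"] by simp
qed (use poly_bounded_const poly_bounded_id in auto)

section \<open>Compilation of expressions\<close>

definition move :: "reg \<Rightarrow> reg \<Rightarrow> prog" where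
  "move r a = Seq (SetConst r 0) (Add r a r)"

lemma wp_move [simp]:
  "r \<noteq> a \<Longrightarrow> wp (move r a) R M Q \<longleftrightarrow> Q (2 + bits (R a)) (R(r := R a)) M"
  by (simp add: move_def)

text \<open>
  Register \<open>0\<close> holds the length of the list in memory, register \<open>1\<close> the length of the input.
  The remaining odd registers hold the variables, the even ones are temporary:
  \<open>comp_exp a d\<close> returns its result in \<open>tmp d\<close> and overwrites only temporaries from \<open>d\<close> on.
\<close>

definition tmp :: "nat \<Rightarrow> reg" where "tmp d = 2 * d + 2"
definition vreg :: "nat \<Rightarrow> reg" where "vreg v = 2 * v + 3"

lemma tmp_vreg_simps [simp]:
  "tmp d = tmp e \<longleftrightarrow> d = e" "vreg v = vreg w \<longleftrightarrow> v = w"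
  "tmp d \<noteq> vreg v" "vreg v \<noteq> tmp d"
  "tmp d \<noteq> 0" "0 \<noteq> tmp d" "tmp d \<noteq> Suc 0" "Suc 0 \<noteq> tmp d"
  "vreg v \<noteq> 0" "0 \<noteq> vreg v" "vreg v \<noteq> Suc 0" "Suc 0 \<noteq> vreg v"
  unfolding tmp_def vreg_def by presburger+

text \<open>In both loops \<open>tmp d\<close> counts the remaining rounds and
  \<open>tmp (d + 2)\<close> saves the old value of the bound variable, so the body works from
  \<open>d + 3\<close> on. For \<open>Sum\<close>, \<open>tmp (d + 1)\<close> accumulates; for
  \<open>Iter\<close>, the bound variable itself is the current iterate. \<open>Read\<close> tests
  its index by a truncated subtraction from the input length in register \<open>1\<close>.\<close>

fun comp_exp :: "exp \<Rightarrow> nat \<Rightarrow> prog" where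
  "comp_exp (Const c) d = SetConst (tmp d) c"
| "comp_exp (Var v) d = move (tmp d) (vreg v)"
| "comp_exp (Plus a b) d =
     Seq (comp_exp a d) (Seq (comp_exp b (d + 1)) (Add (tmp d) (tmp d) (tmp (d + 1))))"
| "comp_exp (Minus a b) d =
     Seq (comp_exp a d) (Seq (comp_exp b (d + 1)) (Sub (tmp d) (tmp d) (tmp (d + 1))))"
| "comp_exp (Read a) d =
     Seq (comp_exp a d) (Seq (Sub (tmp (d + 1)) 1 (tmp d))
       (IfNZ (tmp (d + 1)) (Load (tmp d) (tmp d)) (SetConst (tmp d) 0)))"
| "comp_exp (Cond c a b) d =
     Seq (comp_exp c d) (IfNZ (tmp d) (comp_exp a d) (comp_exp b d))"
| "comp_exp (Sum v n a) d =
     Seq (comp_exp n d) (Seq (SetConst (tmp (d + 1)) 0) (Seq (move (tmp (d + 2)) (vreg v))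
       (Seq (SetConst (vreg v) 0)
       (Seq (WhileNZ (tmp d) (Seq (comp_exp a (d + 3))
              (Seq (Add (tmp (d + 1)) (tmp (d + 1)) (tmp (d + 3)))
              (Seq (SetConst (tmp (d + 3)) 1)
              (Seq (Add (vreg v) (vreg v) (tmp (d + 3))) (Sub (tmp d) (tmp d) (tmp (d + 3))))))))
       (Seq (move (vreg v) (tmp (d + 2))) (move (tmp d) (tmp (d + 1))))))))"
| "comp_exp (Iter v n a b) d =
     Seq (comp_exp n d) (Seq (comp_exp a (d + 1)) (Seq (move (tmp (d + 2)) (vreg v))
       (Seq (move (vreg v) (tmp (d + 1)))
       (Seq (WhileNZ (tmp d) (Seq (comp_exp b (d + 3))
              (Seq (Sub (tmp (d + 4)) (tmp (d + 3)) 1)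
              (Seq (Sub (tmp (d + 3)) (tmp (d + 3)) (tmp (d + 4)))
              (Seq (move (vreg v) (tmp (d + 3)))
              (Seq (SetConst (tmp (d + 3)) 1) (Sub (tmp d) (tmp d) (tmp (d + 3)))))))))
       (Seq (move (tmp (d + 1)) (vreg v))
       (Seq (move (vreg v) (tmp (d + 2))) (move (tmp d) (tmp (d + 1)))))))))"

text \<open>The last summands for \<open>Sum\<close> and \<open>Iter\<close> have the shape
  \<open>Suc N * (T + N + 1)\<close> that \<open>wp_WhileNZ\<close> delivers, with \<open>T\<close>
  bounding one round.\<close>

fun exp_time :: "exp \<Rightarrow> nat \<Rightarrow> nat" where
  "exp_time (Const c) B = 1 + c"
| "exp_time (Var v) B = 2 + B"
| "exp_time (Plus a b) B = exp_time a B + exp_time b B + 1 + val_bound a B + val_bound b B"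
| "exp_time (Minus a b) B = exp_time a B + exp_time b B + 1 + val_bound a B + val_bound b B"
| "exp_time (Read a) B = exp_time a B + 3 + 4 * B + val_bound a B"
| "exp_time (Cond c a b) B = exp_time c B + 1 + val_bound c B + exp_time a B + exp_time b B"
| "exp_time (Sum v n a) B = exp_time n B + 8 + 2 * B + val_bound n B * val_bound a (B + val_bound n B) +
     Suc (val_bound n B) *
       ((exp_time a (B + val_bound n B) + 7 + 2 * val_bound n B + val_bound a (B + val_bound n B)
         + val_bound n B * val_bound a (B + val_bound n B)) + val_bound n B + 1)"
| "exp_time (Iter v n a b) B = exp_time n B + exp_time a B + 10 + 4 * B + 3 * (B + val_bound a B) +
     Suc (val_bound n B) *
       ((exp_time b (B + (B + val_bound a B)) + 8 + 2 * B + val_bound n B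
         + 4 * val_bound b (B + (B + val_bound a B))) + val_bound n B + 1)"

lemma poly_exp_time: "poly_bounded (exp_time a)"
proof (induction a)
  case (Sum v n a)
  have "poly_bounded (\<lambda>B. exp_time (Sum v n a) B)" unfolding exp_time.simps
    by (intro poly_bounded_mult poly_bounded_add poly_bounded_id poly_bounded_Suc poly_bounded_const
        Sum(1) poly_val_bound poly_bounded_comp[OF Sum(2)] poly_bounded_comp[OF poly_val_bound[of a]])
  then show ?case by simp
next
  case (Iter v n a b)
  have "poly_bounded (\<lambda>B. exp_time (Iter v n a b) B)" unfolding exp_time.simps
    by (intro poly_bounded_mult poly_bounded_add poly_bounded_id poly_bounded_Suc poly_bounded_const
        Iter(1,2) poly_val_bound poly_bounded_comp[OF Iter(3)] poly_bounded_comp[OF poly_val_bound[of b]])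
  then show ?case by simp
next
  case (Plus a b)
  have "poly_bounded (\<lambda>B. exp_time (Plus a b) B)" unfolding exp_time.simps
    by (intro poly_bounded_add poly_bounded_const Plus poly_val_bound)
  then show ?case by simp
next
  case (Minus a b)
  have "poly_bounded (\<lambda>B. exp_time (Minus a b) B)" unfolding exp_time.simps
    by (intro poly_bounded_add poly_bounded_const Minus poly_val_bound)
  then show ?case by simp
next
  case (Read a)
  have "poly_bounded (\<lambda>B. exp_time (Read a) B)" unfolding exp_time.simps
    by (intro poly_bounded_mult poly_bounded_id poly_bounded_add poly_bounded_const Read poly_val_bound)
  then show ?case by simp
next
  case (Cond c a b)
  have "poly_bounded (\<lambda>B. exp_time (Cond c a b) B)" unfolding exp_time.simps
    by (intro poly_bounded_add poly_bounded_const Cond poly_val_bound)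
  then show ?case by simp
next
  case (Const c)
  have "poly_bounded (\<lambda>B. exp_time (Const c) B)" unfolding exp_time.simps
    by (intro poly_bounded_add poly_bounded_const)
  then show ?case by simp
next
  case (Var c)
  have "poly_bounded (\<lambda>B. exp_time (Var c) B)" unfolding exp_time.simps
    by (intro poly_bounded_add poly_bounded_const poly_bounded_id)
  then show ?case by simp
qed

definition represents :: "nat list \<Rightarrow> (nat \<Rightarrow> nat) \<Rightarrow> (nat \<Rightarrow> nat) \<Rightarrow> (nat \<Rightarrow> nat) \<Rightarrow> bool" where
  "represents xs \<rho> R M \<longleftrightarrow>
     R 1 = length xs \<and> (\<forall>i<length xs. M i = xs ! i) \<and> (\<forall>v. R (vreg v) = \<rho> v)"

definition preserves :: "nat \<Rightarrow> (nat \<Rightarrow> nat) \<Rightarrow> (nat \<Rightarrow> nat) \<Rightarrow> bool" where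
  "preserves d R R' \<longleftrightarrow> R' 0 = R 0 \<and> R' 1 = R 1 \<and>
     (\<forall>v. R' (vreg v) = R (vreg v)) \<and> (\<forall>e<d. R' (tmp e) = R (tmp e))"

lemma preserves_represents: "preserves d R R' \<Longrightarrow> represents xs \<rho> R M \<Longrightarrow> represents xs \<rho> R' M"
  unfolding preserves_def represents_def by auto

lemma preserves_trans: "preserves d R R' \<Longrightarrow> preserves e R' R'' \<Longrightarrow> d \<le> e \<Longrightarrow> preserves d R R''"
  unfolding preserves_def by auto

definition exp_post :: "nat list \<Rightarrow> (nat \<Rightarrow> nat) \<Rightarrow> exp \<Rightarrow> nat \<Rightarrow> nat \<Rightarrow> (nat \<Rightarrow> nat) \<Rightarrow> (nat \<Rightarrow> nat) \<Rightarrow>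
    nat \<Rightarrow> (nat \<Rightarrow> nat) \<Rightarrow> (nat \<Rightarrow> nat) \<Rightarrow> bool" where
  "exp_post xs \<rho> a d B R M t R' M' \<longleftrightarrow>
     t \<le> exp_time a B \<and> M' = M \<and> R' (tmp d) = eval xs \<rho> a \<and> preserves d R R'"

lemma wp_comp_exp:
  assumes "represents xs \<rho> R M" and "bounded_by B xs \<rho>"
  shows "wp (comp_exp a d) R M (exp_post xs \<rho> a d B R M)"
  using assms
proof (induction a arbitrary: d \<rho> R M B)
  case (Const c)
  then show ?case by (simp add: exp_post_def preserves_def)
next
  case (Var v)
  have "bits (R (vreg v)) \<le> B"
    using Var bits_le_trans unfolding bounded_by_def represents_def by auto
  then show ?case using Var unfolding comp_exp.simps wp_move[OF tmp_vreg_simps(3)]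
    by (simp add: exp_post_def preserves_def represents_def)
next
  case (Plus a b)
  show ?case unfolding comp_exp.simps wp_Seq
  proof (rule wp_mono[OF Plus.IH(1)[OF Plus.prems]], rule wp_mono[OF Plus.IH(2)])
    fix t R1 M1 t2 R2 M2
    assume 1: "exp_post xs \<rho> a d B R M t R1 M1" and 2: "exp_post xs \<rho> b (d + 1) B R1 M1 t2 R2 M2"
    have "bits (eval xs \<rho> a) \<le> val_bound a B" "bits (eval xs \<rho> b) \<le> val_bound b B"
      using eval_le_val_bound[OF Plus.prems(2)] by (auto intro: bits_le_trans)
    then show "wp (Add (tmp d) (tmp d) (tmp (d + 1))) R2 M2
        (\<lambda>t'. exp_post xs \<rho> (Plus a b) d B R M (t + (t2 + t')))"
      using 1 2 by (auto simp: exp_post_def preserves_def)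
  qed (use Plus.prems in \<open>auto simp: exp_post_def intro: preserves_represents\<close>)
next
  case (Minus a b)
  show ?case unfolding comp_exp.simps wp_Seq
  proof (rule wp_mono[OF Minus.IH(1)[OF Minus.prems]], rule wp_mono[OF Minus.IH(2)])
    fix t R1 M1 t2 R2 M2
    assume 1: "exp_post xs \<rho> a d B R M t R1 M1" and 2: "exp_post xs \<rho> b (d + 1) B R1 M1 t2 R2 M2"
    have "bits (eval xs \<rho> a) \<le> val_bound a B" "bits (eval xs \<rho> b) \<le> val_bound b B"
      using eval_le_val_bound[OF Minus.prems(2)] by (auto intro: bits_le_trans)
    then show "wp (Sub (tmp d) (tmp d) (tmp (d + 1))) R2 M2
        (\<lambda>t'. exp_post xs \<rho> (Minus a b) d B R M (t + (t2 + t')))"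
      using 1 2 by (auto simp: exp_post_def preserves_def)
  qed (use Minus.prems in \<open>auto simp: exp_post_def intro: preserves_represents\<close>)
next
  case (Read a)
  show ?case unfolding comp_exp.simps wp_Seq
  proof (rule wp_mono[OF Read.IH[OF Read.prems]])
    fix t R1 M1
    assume 1: "exp_post xs \<rho> a d B R M t R1 M1"
    let ?a = "eval xs \<rho> a"
    have e: "R1 (tmp d) = ?a" "M1 = M" "preserves d R R1" "R1 1 = length xs" "t \<le> exp_time a B"
      using 1 Read.prems unfolding exp_post_def represents_def by (auto simp: preserves_def)
    have L: "length xs \<le> B" using Read.prems unfolding bounded_by_def by auto
    have b: "bits ?a \<le> val_bound a B" "bits (length xs) \<le> B" "bits (length xs - ?a) \<le> B"
      using eval_le_val_bound[OF Read.prems(2)] L by (auto intro: bits_le_trans)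
    show "wp (Sub (tmp (d + 1)) 1 (tmp d)) R1 M1 (\<lambda>t' R' M'.
            wp (IfNZ (tmp (d + 1)) (Load (tmp d) (tmp d)) (SetConst (tmp d) 0)) R' M'
              (\<lambda>t''. exp_post xs \<rho> (Read a) d B R M (t + (t' + t''))))"
    proof (cases "?a < length xs")
      case True
      then have "bits ?a \<le> B" "bits (xs ! ?a) \<le> B" "M ?a = xs ! ?a"
        using Read.prems L unfolding bounded_by_def represents_def by (auto intro!: bits_le_trans)
      then show ?thesis using True e b
        by (auto simp: exp_post_def preserves_def)
    next
      case False
      then show ?thesis using e b
        by (auto simp: exp_post_def preserves_def)
    qed
  qed
next
  case (Cond c a b)
  show ?case unfolding comp_exp.simps wp_Seq
  proof (rule wp_mono[OF Cond.IH(1)[OF Cond.prems]])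
    fix t R1 M1
    assume 1: "exp_post xs \<rho> c d B R M t R1 M1"
    then have r: "represents xs \<rho> R1 M1" using Cond.prems
      unfolding exp_post_def by (auto intro: preserves_represents)
    have b: "bits (eval xs \<rho> c) \<le> val_bound c B"
      using eval_le_val_bound[OF Cond.prems(2)] by (auto intro: bits_le_trans)
    show "wp (IfNZ (tmp d) (comp_exp a d) (comp_exp b d)) R1 M1
       (\<lambda>t'. exp_post xs \<rho> (Cond c a b) d B R M (t + t'))"
    proof (cases "eval xs \<rho> c = 0")
      case True
      have "wp (comp_exp b d) R1 M1
         (\<lambda>t'. exp_post xs \<rho> (Cond c a b) d B R M (t + (1 + bits (R1 (tmp d)) + t')))"
        by (rule wp_mono[OF Cond.IH(3)[OF r Cond.prems(2)]])
          (use 1 b True in \<open>auto simp: exp_post_def elim: preserves_trans\<close>)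
      then show ?thesis using 1 True unfolding wp_IfNZ by (simp add: exp_post_def)
    next
      case False
      have "wp (comp_exp a d) R1 M1
         (\<lambda>t'. exp_post xs \<rho> (Cond c a b) d B R M (t + (1 + bits (R1 (tmp d)) + t')))"
        by (rule wp_mono[OF Cond.IH(2)[OF r Cond.prems(2)]])
          (use 1 b False in \<open>auto simp: exp_post_def elim: preserves_trans\<close>)
      then show ?thesis using 1 False unfolding wp_IfNZ by (simp add: exp_post_def)
    qed
  qed
next
  case (Sum v n a)
  let ?n = "eval xs \<rho> n" and ?N = "val_bound n B"
  let ?C = "B + ?N"
  let ?A = "val_bound a ?C"
  let ?s = "\<lambda>j. \<Sum>i<j. eval xs (\<rho>(v := i)) a"
  let ?T = "exp_time a ?C + 7 + 2 * ?N + ?A + ?N * ?A"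
  let ?body = "Seq (comp_exp a (d + 3))
              (Seq (Add (tmp (d + 1)) (tmp (d + 1)) (tmp (d + 3)))
              (Seq (SetConst (tmp (d + 3)) 1)
              (Seq (Add (vreg v) (vreg v) (tmp (d + 3))) (Sub (tmp d) (tmp d) (tmp (d + 3))))))"
  have n: "?n \<le> ?N" using eval_le_val_bound[OF Sum.prems(2)] by simp
  have bd: "bounded_by ?C xs (\<rho>(v := j))" if "j \<le> ?n" for j
    using bounded_by_upd[OF Sum.prems(2)] that n by auto
  have ev: "eval xs (\<rho>(v := j)) a \<le> ?A" if "j \<le> ?n" for j
    using eval_le_val_bound[OF bd[OF that]] .
  have s: "?s j \<le> ?N * ?A" if "j \<le> ?n" for j
  proof -
    have "?s j \<le> (\<Sum>i<j. ?A)" using that by (intro sum_mono ev) auto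
    also have "\<dots> \<le> ?N * ?A" using that n by simp
    finally show ?thesis .
  qed
  have rv: "R (vreg v) = \<rho> v" "\<rho> v \<le> B"
    using Sum.prems unfolding represents_def bounded_by_def by auto
  \<comment> \<open>The register of \<open>v\<close> is exempt from preservation while the loop
    runs; its old value waits in \<open>tmp (d + 2)\<close> and is restored afterwards.\<close>
  define I where "I j R' M' \<longleftrightarrow> M' = M \<and> R' (tmp d) = ?n - j \<and> R' (tmp (d+1)) = ?s j \<and>
      R' (tmp (d+2)) = \<rho> v \<and> R' (vreg v) = j \<and>
      R' 0 = R 0 \<and> R' 1 = R 1 \<and>
      (\<forall>w. w \<noteq> v \<longrightarrow> R' (vreg w) = R (vreg w)) \<and> (\<forall>e<d. R' (tmp e) = R (tmp e))" for j R' M'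
  show ?case unfolding comp_exp.simps wp_Seq
  proof (rule wp_mono[OF Sum.IH(1)[OF Sum.prems]])
    fix t R1 M1
    assume 1: "exp_post xs \<rho> n d B R M t R1 M1"
    have loop: "wp (WhileNZ (tmp d) ?body) R' M'
       (\<lambda>t R' M'. t \<le> Suc ?n * (?T + ?n + 1) \<and> I ?n R' M')" if "I 0 R' M'" for R' M'
    proof (rule wp_WhileNZ[where I = I and T = ?T, OF _ _ that])
      fix j R2 M2
      assume j: "j < ?n" and I: "I j R2 M2"
      have rep: "represents xs (\<rho>(v := j)) R2 M2"
        using I Sum.prems(1) unfolding represents_def I_def by auto
      have b: "bits j \<le> ?N" "bits (?n - j) \<le> ?N" "bits (?s j) \<le> ?N * ?A"
        "bits (eval xs (\<rho>(v := j)) a) \<le> ?A"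
        using j n s[of j] ev[of j] by (auto intro!: bits_le_trans)
      show "wp ?body R2 M2
          (\<lambda>t R' M'. t \<le> ?T \<and> I (Suc j) R' M')"
        unfolding wp_Seq
      proof (rule wp_mono[OF Sum.IH(2)[OF rep bd]])
        show "j \<le> ?n" using j by simp
        fix t3 R3 M3
        assume 3: "exp_post xs (\<rho>(v := j)) a (d + 3) ?C R2 M2 t3 R3 M3"
        then have p: "preserves (d + 3) R2 R3" and t3: "t3 \<le> exp_time a ?C" "M3 = M2"
          "R3 (tmp (d + 3)) = eval xs (\<rho>(v := j)) a"
          unfolding exp_post_def by auto
        have q: "R3 (tmp d) = ?n - j" "R3 (tmp (d + 1)) = ?s j" "R3 (tmp (d + 2)) = \<rho> v" "R3 (vreg v) = j"
          using I p unfolding I_def preserves_def by auto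
        have "R3 0 = R 0" "R3 1 = R 1" "\<And>w. w \<noteq> v \<Longrightarrow> R3 (vreg w) = R (vreg w)"
            "\<And>e. e < d \<Longrightarrow> R3 (tmp e) = R (tmp e)"
          using p I unfolding I_def preserves_def by auto
        then show "wp (Add (tmp (d + 1)) (tmp (d + 1)) (tmp (d + 3))) R3 M3 (\<lambda>t' R' M'.
            wp (SetConst (tmp (d + 3)) 1) R' M' (\<lambda>t'a R' M'.
            wp (Add (vreg v) (vreg v) (tmp (d + 3))) R' M' (\<lambda>t'b R' M'.
            wp (Sub (tmp d) (tmp d) (tmp (d + 3))) R' M' (\<lambda>t'c R' M'.
              t3 + (t' + (t'a + (t'b + t'c))) \<le> ?T \<and> I (Suc j) R' M'))))"
          using q t3 b I by (auto simp: I_def)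
      qed
    qed (auto simp: I_def)
    have t: "t \<le> exp_time n B" "M1 = M" "R1 (tmp d) = ?n" "preserves d R R1"
      using 1 unfolding exp_post_def by auto
    have v1: "R1 (vreg v) = \<rho> v" using t(4) rv unfolding preserves_def by simp
    let ?R = "R1(tmp (d + 1) := 0, tmp (d + 2) := \<rho> v, vreg v := 0)"
    have I0: "I 0 ?R M" using t v1 unfolding I_def preserves_def by auto
    have bv: "bits (\<rho> v) \<le> B" using rv by (auto intro: bits_le_trans)
    have "wp (WhileNZ (tmp d) ?body) ?R M
         (\<lambda>t' R2 M2. wp (move (vreg v) (tmp (d + 2))) R2 M2 (\<lambda>t'' R3 M3.
           wp (move (tmp d) (tmp (d + 1))) R3 M3 (\<lambda>t3. exp_post xs \<rho> (Sum v n a) d B R M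
              (t + (1 + (2 + bits (\<rho> v) + (1 + (t' + (t'' + t3)))))))))"
    proof (rule wp_mono[OF loop[OF I0]])
      fix t' R2 M2
      assume 2: "t' \<le> Suc ?n * (?T + ?n + 1) \<and> I ?n R2 M2"
      have "Suc ?n * (?T + ?n + 1) \<le> Suc ?N * (?T + ?N + 1)" using n by (intro mult_mono) auto
      then have t': "t' \<le> Suc ?N * (?T + ?N + 1)" using 2 by linarith
      have "bits (?s ?n) \<le> ?N * ?A" using s[of ?n] by (auto intro: bits_le_trans)
      moreover have "preserves d R (R2(vreg v := \<rho> v, tmp d := ?s ?n))"
        using 2 rv unfolding I_def preserves_def by auto
      ultimately show "wp (move (vreg v) (tmp (d + 2))) R2 M2 (\<lambda>t'' R3 M3.
           wp (move (tmp d) (tmp (d + 1))) R3 M3 (\<lambda>t3. exp_post xs \<rho> (Sum v n a) d B R M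
              (t + (1 + (2 + bits (\<rho> v) + (1 + (t' + (t'' + t3))))))))"
        using 2 t' t(1) bv unfolding exp_post_def I_def by simp
    qed
    then show "wp (SetConst (tmp (d + 1)) 0) R1 M1 (\<lambda>t'a R' M'. wp (move (tmp (d + 2)) (vreg v)) R' M'
       (\<lambda>t'b R' M'. wp (SetConst (vreg v) 0) R' M' (\<lambda>t'c R' M'.
          wp (WhileNZ (tmp d) ?body) R' M'
         (\<lambda>t' R2 M2. wp (move (vreg v) (tmp (d + 2))) R2 M2 (\<lambda>t'' R3 M3.
           wp (move (tmp d) (tmp (d + 1))) R3 M3 (\<lambda>t3. exp_post xs \<rho> (Sum v n a) d B R M
              (t + (t'a + (t'b + (t'c + (t' + (t'' + t3)))))))))))) "
      using v1 t(2) by simp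
  qed
next
  case (Iter v n a b)
  let ?n = "eval xs \<rho> n" and ?N = "val_bound n B"
  let ?a = "eval xs \<rho> a" and ?L = "length xs"
  let ?D = "B + val_bound a B"
  let ?C = "B + ?D"
  let ?A = "val_bound b ?C"
  let ?f = "\<lambda>x. min (eval xs (\<rho>(v := x)) b) ?L"
  let ?s = "\<lambda>j. (?f ^^ j) ?a"
  let ?T = "exp_time b ?C + 8 + 2 * B + ?N + 4 * ?A"
  let ?body = "Seq (comp_exp b (d + 3))
              (Seq (Sub (tmp (d + 4)) (tmp (d + 3)) 1)
              (Seq (Sub (tmp (d + 3)) (tmp (d + 3)) (tmp (d + 4)))
              (Seq (move (vreg v) (tmp (d + 3)))
              (Seq (SetConst (tmp (d + 3)) 1) (Sub (tmp d) (tmp d) (tmp (d + 3)))))))"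
  have n: "?n \<le> ?N" using eval_le_val_bound[OF Iter.prems(2)] by simp
  have L: "?L \<le> B" using Iter.prems unfolding bounded_by_def by auto
  \<comment> \<open>The \<open>j\<close>-th iterate is itself the value of an \<open>Iter\<close>
    expression with a constant count, so the general value bound applies, and it does not depend on
    \<open>j\<close>.\<close>
  have s: "?s j \<le> ?D" for j
    using eval_le_val_bound[OF Iter.prems(2), of "Iter v (Const j) a b"] by simp
  have bd: "bounded_by ?C xs (\<rho>(v := ?s j))" for j
    using bounded_by_upd[OF Iter.prems(2) s] .
  have ev: "eval xs (\<rho>(v := ?s j)) b \<le> ?A" for j
    using eval_le_val_bound[OF bd] .
  have rv: "R (vreg v) = \<rho> v" "\<rho> v \<le> B"
    using Iter.prems unfolding represents_def bounded_by_def by auto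
  define I where "I j R' M' \<longleftrightarrow> M' = M \<and> R' (tmp d) = ?n - j \<and>
      R' (tmp (d+2)) = \<rho> v \<and> R' (vreg v) = ?s j \<and>
      R' 0 = R 0 \<and> R' 1 = R 1 \<and>
      (\<forall>w. w \<noteq> v \<longrightarrow> R' (vreg w) = R (vreg w)) \<and> (\<forall>e<d. R' (tmp e) = R (tmp e))" for j R' M'
  have loop: "wp (WhileNZ (tmp d) ?body) R' M'
       (\<lambda>t R' M'. t \<le> Suc ?n * (?T + ?n + 1) \<and> I ?n R' M')" if "I 0 R' M'" for R' M'
  proof (rule wp_WhileNZ[where I = I and T = ?T, OF _ _ that])
    fix j R2 M2
    assume j: "j < ?n" and I: "I j R2 M2"
    let ?e = "eval xs (\<rho>(v := ?s j)) b"
    have rep: "represents xs (\<rho>(v := ?s j)) R2 M2"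
      using I Iter.prems(1) unfolding represents_def I_def by auto
    \<comment> \<open>Two truncated subtractions compute the minimum.\<close>
    have m: "?e - (?e - ?L) = ?s (Suc j)" by (simp add: min_def)
    have bits: "bits ?L \<le> B" "bits (?n - j) \<le> ?N" "bits ?e \<le> ?A" "bits (?e - ?L) \<le> ?A"
        "bits (?s (Suc j)) \<le> ?A"
      using j n ev[of j] L by (auto intro!: bits_le_trans)
    show "wp ?body R2 M2 (\<lambda>t R' M'. t \<le> ?T \<and> I (Suc j) R' M')"
      unfolding wp_Seq
    proof (rule wp_mono[OF Iter.IH(3)[OF rep bd]])
      fix t3 R3 M3
      assume 3: "exp_post xs (\<rho>(v := ?s j)) b (d + 3) ?C R2 M2 t3 R3 M3"
      then have p: "preserves (d + 3) R2 R3" and t3: "t3 \<le> exp_time b ?C" "M3 = M2"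
          "R3 (tmp (d + 3)) = ?e"
        unfolding exp_post_def by auto
      have q: "R3 (tmp d) = ?n - j" "R3 (tmp (d + 2)) = \<rho> v" "M2 = M"
        using I p unfolding I_def preserves_def by auto
      have k: "R3 0 = R 0" "R3 1 = R 1" "\<And>w. w \<noteq> v \<Longrightarrow> R3 (vreg w) = R (vreg w)"
            "\<And>e. e < d \<Longrightarrow> R3 (tmp e) = R (tmp e)"
        using p I unfolding I_def preserves_def by auto
      have "R3 1 = ?L" using k(2) Iter.prems(1) unfolding represents_def by auto
      then show "wp (Sub (tmp (d + 4)) (tmp (d + 3)) 1) R3 M3 (\<lambda>t' R' M'.
          wp (Sub (tmp (d + 3)) (tmp (d + 3)) (tmp (d + 4))) R' M' (\<lambda>t'a R' M'.
          wp (move (vreg v) (tmp (d + 3))) R' M' (\<lambda>t'b R' M'.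
          wp (SetConst (tmp (d + 3)) 1) R' M' (\<lambda>t'c R' M'.
          wp (Sub (tmp d) (tmp d) (tmp (d + 3))) R' M' (\<lambda>t'd R' M'.
            t3 + (t' + (t'a + (t'b + (t'c + t'd)))) \<le> ?T \<and> I (Suc j) R' M')))))"
        using q t3 bits k m by (auto simp: I_def simp del: funpow.simps)
    qed
  qed (auto simp: I_def)
  show ?case unfolding comp_exp.simps wp_Seq
  proof (rule wp_mono[OF Iter.IH(1)[OF Iter.prems]], rule wp_mono[OF Iter.IH(2)])
    fix t R1 M1 t2 R2 M2
    assume 1: "exp_post xs \<rho> n d B R M t R1 M1" and 2: "exp_post xs \<rho> a (d + 1) B R1 M1 t2 R2 M2"
    have t: "t \<le> exp_time n B" "t2 \<le> exp_time a B" "M2 = M" "R2 (tmp d) = ?n" "R2 (tmp (d+1)) = ?a"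
      "preserves d R R2"
      using 1 2 unfolding exp_post_def preserves_def by auto
    have v2: "R2 (vreg v) = \<rho> v" using t(6) rv unfolding preserves_def by simp
    let ?R = "R2(tmp (d + 2) := \<rho> v, vreg v := ?a)"
    have I0: "I 0 ?R M" using t v2 unfolding I_def preserves_def by auto
    have bv: "bits (\<rho> v) \<le> B" "bits ?a \<le> ?D"
      using rv s[of 0] by (auto intro!: bits_le_trans)
    have "wp (WhileNZ (tmp d) ?body) ?R M
         (\<lambda>t' R2 M2. wp (move (tmp (d + 1)) (vreg v)) R2 M2 (\<lambda>u R2 M2.
           wp (move (vreg v) (tmp (d + 2))) R2 M2 (\<lambda>t'' R3 M3.
           wp (move (tmp d) (tmp (d + 1))) R3 M3 (\<lambda>t3. exp_post xs \<rho> (Iter v n a b) d B R M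
              (t + (t2 + (2 + bits (\<rho> v) + (2 + bits ?a + (t' + (u + (t'' + t3)))))))))))"
    proof (rule wp_mono[OF loop[OF I0]])
      fix t' R4 M4
      assume 4: "t' \<le> Suc ?n * (?T + ?n + 1) \<and> I ?n R4 M4"
      have "Suc ?n * (?T + ?n + 1) \<le> Suc ?N * (?T + ?N + 1)" using n by (intro mult_mono) auto
      then have t': "t' \<le> Suc ?N * (?T + ?N + 1)" using 4 by linarith
      have "bits (?s ?n) \<le> ?D" using s[of ?n] by (auto intro: bits_le_trans)
      moreover have "preserves d R (R4(tmp (d+1) := ?s ?n, vreg v := \<rho> v, tmp d := ?s ?n))"
        using 4 rv unfolding I_def preserves_def by auto
      ultimately show "wp (move (tmp (d + 1)) (vreg v)) R4 M4 (\<lambda>u R2 M2.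
           wp (move (vreg v) (tmp (d + 2))) R2 M2 (\<lambda>t'' R3 M3.
           wp (move (tmp d) (tmp (d + 1))) R3 M3 (\<lambda>t3. exp_post xs \<rho> (Iter v n a b) d B R M
              (t + (t2 + (2 + bits (\<rho> v) + (2 + bits ?a + (t' + (u + (t'' + t3))))))))))"
        using 4 t' t(1,2) bv unfolding exp_post_def I_def by simp
    qed
    then show "wp (move (tmp (d + 2)) (vreg v)) R2 M2
       (\<lambda>t'b R' M'. wp (move (vreg v) (tmp (d + 1))) R' M' (\<lambda>t'c R' M'.
          wp (WhileNZ (tmp d) ?body) R' M'
         (\<lambda>t' R2 M2. wp (move (tmp (d + 1)) (vreg v)) R2 M2 (\<lambda>u R2 M2.
           wp (move (vreg v) (tmp (d + 2))) R2 M2 (\<lambda>t'' R3 M3.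
           wp (move (tmp d) (tmp (d + 1))) R3 M3 (\<lambda>t3. exp_post xs \<rho> (Iter v n a b) d B R M
              (t + (t2 + (t'b + (t'c + (t' + (u + (t'' + t3)))))))))))))"
      using v2 t(3,5) by simp
  qed (use Iter.prems in \<open>auto simp: exp_post_def intro: preserves_represents\<close>)
qed


section \<open>Compilation of generators\<close>

definition mem :: "nat list \<Rightarrow> nat \<Rightarrow> nat" where
  "mem ys a = (if a < length ys then ys ! a else 0)"

lemma mem_append: "(mem ys)(length ys := y) = mem (ys @ [y])"
  by (auto simp: mem_def nth_append fun_eq_iff)

text \<open>The output is appended to the input in memory, so the input stays readable. Register
  \<open>0\<close> is at once the length of the combined list and the address of the next free cell:
  emitting is a store at that address followed by an increment.\<close>

fun comp_gen :: "gen \<Rightarrow> nat \<Rightarrow> prog" where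
  "comp_gen (Emit a) d = Seq (comp_exp a d) (Seq (Store 0 (tmp d))
     (Seq (SetConst (tmp d) 1) (Add 0 0 (tmp d))))"
| "comp_gen (App g h) d = Seq (comp_gen g d) (comp_gen h d)"
| "comp_gen (Guard a g) d = Seq (comp_exp a d) (IfNZ (tmp d) (comp_gen g d) Skip)"
| "comp_gen (For v n g) d = Seq (comp_exp n d) (Seq (move (tmp (d + 1)) (vreg v))
     (Seq (SetConst (vreg v) 0)
     (Seq (WhileNZ (tmp d) (Seq (comp_gen g (d + 2)) (Seq (SetConst (tmp (d + 2)) 1)
            (Seq (Add (vreg v) (vreg v) (tmp (d + 2))) (Sub (tmp d) (tmp d) (tmp (d + 2)))))))
     (move (vreg v) (tmp (d + 1))))))"

fun len_bound :: "gen \<Rightarrow> nat \<Rightarrow> nat" where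
  "len_bound (Emit a) B = 1"
| "len_bound (App g h) B = len_bound g B + len_bound h B"
| "len_bound (Guard a g) B = len_bound g B"
| "len_bound (For v n g) B = val_bound n B * len_bound g (B + val_bound n B)"

text \<open>The additional parameter \<open>D\<close> bounds the addresses that are written to.\<close>

fun gen_time :: "gen \<Rightarrow> nat \<Rightarrow> nat \<Rightarrow> nat" where
  "gen_time (Emit a) B D = exp_time a B + val_bound a B + 5 + 2 * D"
| "gen_time (App g h) B D = gen_time g B D + gen_time h B D"
| "gen_time (Guard a g) B D = exp_time a B + val_bound a B + gen_time g B D + 2"
| "gen_time (For v n g) B D = exp_time n B + 6 + 2 * B +
     Suc (val_bound n B) * ((gen_time g (B + val_bound n B) D + 6 + 2 * val_bound n B) + val_bound n B + 1)"

lemma length_gens_le: "bounded_by B xs \<rho> \<Longrightarrow> length (gens xs \<rho> g) \<le> len_bound g B"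
proof (induction g arbitrary: B \<rho>)
  case (App g h) then show ?case by (simp add: add_mono)
next
  case (For v n g)
  let ?n = "eval xs \<rho> n"
  have n: "?n \<le> val_bound n B" using eval_le_val_bound[OF For.prems] .
  have "length (gens xs \<rho> (For v n g)) = (\<Sum>i<?n. length (gens xs (\<rho>(v := i)) g))"
    by (simp add: length_concat comp_def interv_sum_list_conv_sum_set_nat atLeast0LessThan)
  also have "\<dots> \<le> (\<Sum>i<?n. len_bound g (B + val_bound n B))"
    using For.prems n by (intro sum_mono For.IH bounded_by_upd) auto
  also have "\<dots> \<le> len_bound (For v n g) B" using n by simp
  finally show ?case .
qed auto

lemma poly_len_bound: "poly_bounded (len_bound g)"
proof (induction g)
  case (For v n g)
  have "poly_bounded (\<lambda>B. len_bound (For v n g) B)" unfolding len_bound.simps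
    by (intro poly_bounded_mult poly_val_bound poly_bounded_comp[OF For] poly_bounded_add poly_bounded_id)
  then show ?case by simp
next
  case (App g h)
  then show ?case using poly_bounded_add[of "len_bound g" "len_bound h"] by simp
qed (use poly_bounded_const in auto)

lemma poly_gen_time:
  "poly_bounded p \<Longrightarrow> poly_bounded q \<Longrightarrow> poly_bounded (\<lambda>B. gen_time g (p B) (q B))"
proof (induction g arbitrary: p)
  case (For v n g)
  note v = poly_bounded_comp[OF poly_val_bound[of n] For.prems(1)]
  show ?case unfolding gen_time.simps
    by (intro poly_bounded_mult poly_bounded_add poly_bounded_const poly_bounded_Suc For.IH For.prems v
        poly_bounded_comp[OF poly_exp_time])
next
  case (Emit a)
  then show ?case unfolding gen_time.simps
    by (intro poly_bounded_mult poly_bounded_add poly_bounded_const poly_bounded_comp[OF poly_exp_time]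
        poly_bounded_comp[OF poly_val_bound])
next
  case (Guard a g)
  then show ?case unfolding gen_time.simps
    by (intro poly_bounded_add poly_bounded_const poly_bounded_comp[OF poly_exp_time]
        poly_bounded_comp[OF poly_val_bound])
next
  case (App g h)
  then show ?case unfolding gen_time.simps by (intro poly_bounded_add)
qed

definition gen_pre :: "nat list \<Rightarrow> (nat \<Rightarrow> nat) \<Rightarrow> (nat \<Rightarrow> nat) \<Rightarrow> nat list \<Rightarrow> bool" where
  "gen_pre xs \<rho> R zs \<longleftrightarrow> R 0 = length (xs @ zs) \<and> R 1 = length xs \<and> (\<forall>v. R (vreg v) = \<rho> v)"

text \<open>The list \<open>zs\<close> is the output produced before \<open>g\<close> starts. A
  generator advances register \<open>0\<close>, which \<open>preserves\<close> would forbid; the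
  update of \<open>R\<close> exempts this register.\<close>

definition gen_post :: "nat list \<Rightarrow> (nat \<Rightarrow> nat) \<Rightarrow> gen \<Rightarrow> nat \<Rightarrow> nat \<Rightarrow> nat \<Rightarrow> nat list \<Rightarrow> (nat \<Rightarrow> nat) \<Rightarrow>
    nat \<Rightarrow> (nat \<Rightarrow> nat) \<Rightarrow> (nat \<Rightarrow> nat) \<Rightarrow> bool" where
  "gen_post xs \<rho> g d B D zs R t R' M' \<longleftrightarrow> t \<le> gen_time g B D \<and> M' = mem (xs @ zs @ gens xs \<rho> g) \<and>
     R' 0 = length (xs @ zs @ gens xs \<rho> g) \<and> preserves d (R(0 := R' 0)) R'"

lemma gen_pre_represents: "gen_pre xs \<rho> R zs \<Longrightarrow> represents xs \<rho> R (mem (xs @ zs))"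
  by (auto simp: gen_pre_def represents_def mem_def nth_append)

lemma wp_comp_gen:
  assumes "gen_pre xs \<rho> R zs" and "bounded_by B xs \<rho>" and "length (xs @ zs @ gens xs \<rho> g) \<le> D"
  shows "wp (comp_gen g d) R (mem (xs @ zs)) (gen_post xs \<rho> g d B D zs R)"
  using assms
proof (induction g arbitrary: d \<rho> R zs B)
  case (Emit a)
  show ?case unfolding comp_gen.simps wp_Seq
  proof (rule wp_mono[OF wp_comp_exp[OF gen_pre_represents[OF Emit.prems(1)] Emit.prems(2)]])
    fix t R1 M1
    assume 1: "exp_post xs \<rho> a d B R (mem (xs @ zs)) t R1 M1"
    let ?a = "eval xs \<rho> a"
    have "bits ?a \<le> val_bound a B"
      using eval_le_val_bound[OF Emit.prems(2)] by (auto intro: bits_le_trans)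
    moreover have "bits (length xs + length zs) \<le> D" using Emit.prems(3) by (auto intro: bits_le_trans)
    ultimately show "wp (Store 0 (tmp d)) R1 M1 (\<lambda>t' R' M'. wp (SetConst (tmp d) 1) R' M' (\<lambda>t'' R' M'.
        wp (Add 0 0 (tmp d)) R' M' (\<lambda>t3. gen_post xs \<rho> (Emit a) d B D zs R (t + (t' + (t'' + t3))))))"
      using 1 Emit.prems(1) mem_append[of "xs @ zs" ?a]
      by (auto simp: exp_post_def gen_post_def gen_pre_def preserves_def)
  qed
next
  case (App g h)
  show ?case unfolding comp_gen.simps wp_Seq
  proof (rule wp_mono[OF App.IH(1)[OF App.prems(1,2)]])
    show "length (xs @ zs @ gens xs \<rho> g) \<le> D" using App.prems(3) by simp
    fix t R1 M1
    assume 1: "gen_post xs \<rho> g d B D zs R t R1 M1"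
    then have p: "gen_pre xs \<rho> R1 (zs @ gens xs \<rho> g)" and m: "M1 = mem (xs @ zs @ gens xs \<rho> g)"
      using App.prems(1) unfolding gen_post_def gen_pre_def preserves_def by auto
    show "wp (comp_gen h d) R1 M1 (\<lambda>t'. gen_post xs \<rho> (App g h) d B D zs R (t + t'))"
      unfolding m
    proof (rule wp_mono[OF App.IH(2)[OF p App.prems(2)]])
      show "length (xs @ (zs @ gens xs \<rho> g) @ gens xs \<rho> h) \<le> D" using App.prems(3) by simp
    qed (use 1 in \<open>auto simp: gen_post_def preserves_def\<close>)
  qed
next
  case (Guard a g)
  show ?case unfolding comp_gen.simps wp_Seq
  proof (rule wp_mono[OF wp_comp_exp[OF gen_pre_represents[OF Guard.prems(1)] Guard.prems(2)]])
    fix t R1 M1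
    assume 1: "exp_post xs \<rho> a d B R (mem (xs @ zs)) t R1 M1"
    then have m: "M1 = mem (xs @ zs)" "R1 (tmp d) = eval xs \<rho> a" and p: "gen_pre xs \<rho> R1 zs"
      using Guard.prems(1) unfolding exp_post_def gen_pre_def preserves_def by auto
    have b: "bits (eval xs \<rho> a) \<le> val_bound a B"
      using eval_le_val_bound[OF Guard.prems(2)] by (auto intro: bits_le_trans)
    show "wp (IfNZ (tmp d) (comp_gen g d) Skip) R1 M1
        (\<lambda>t'. gen_post xs \<rho> (Guard a g) d B D zs R (t + t'))"
    proof (cases "eval xs \<rho> a = 0")
      case True
      then show ?thesis using 1 Guard.prems(1) m
        by (auto simp: exp_post_def gen_post_def preserves_def gen_pre_def)
    next
      case False
      have "wp (comp_gen g d) R1 (mem (xs @ zs))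
         (\<lambda>t'. gen_post xs \<rho> (Guard a g) d B D zs R (t + (1 + bits (R1 (tmp d)) + t')))"
      proof (rule wp_mono[OF Guard.IH[OF p Guard.prems(2)]])
        show "length (xs @ zs @ gens xs \<rho> g) \<le> D" using Guard.prems(3) False by simp
      qed (use 1 False b in \<open>auto simp: exp_post_def gen_post_def preserves_def\<close>)
      then show ?thesis using False m unfolding wp_IfNZ by simp
    qed
  qed
next
  case (For v n g)
  let ?n = "eval xs \<rho> n" and ?N = "val_bound n B"
  let ?C = "B + ?N"
  let ?f = "\<lambda>i. gens xs (\<rho>(v := i)) g"
  let ?s = "\<lambda>j. concat (map ?f [0..<j])"
  let ?T = "gen_time g ?C D + 6 + 2 * ?N"
  let ?body = "Seq (comp_gen g (d + 2)) (Seq (SetConst (tmp (d + 2)) 1)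
            (Seq (Add (vreg v) (vreg v) (tmp (d + 2))) (Sub (tmp d) (tmp d) (tmp (d + 2)))))"
  have n: "?n \<le> ?N" using eval_le_val_bound[OF For.prems(2)] by simp
  have bd: "bounded_by ?C xs (\<rho>(v := j))" if "j \<le> ?n" for j
    using bounded_by_upd[OF For.prems(2)] that n by auto
  have s_Suc: "?s (Suc j) = ?s j @ ?f j" for j by simp
  \<comment> \<open>The output after each round is a prefix of the final one, so the address bound
    \<open>D\<close> for the whole loop covers every round.\<close>
  have len: "length (xs @ (zs @ ?s j) @ ?f j) \<le> D" if "j < ?n" for j
  proof -
    have "[0..<?n] = [0..<Suc j] @ [Suc j..<?n]"
      using that upt_add_eq_append[of 0 "Suc j" "?n - Suc j"] by simp
    then have "length (?s (Suc j)) \<le> length (?s ?n)" by simp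
    then show ?thesis using For.prems(3) s_Suc[of j] by simp
  qed
  have rv: "R (vreg v) = \<rho> v" "\<rho> v \<le> B"
    using For.prems unfolding gen_pre_def bounded_by_def by auto
  define I where "I j R' M' \<longleftrightarrow> M' = mem (xs @ zs @ ?s j) \<and> R' (tmp d) = ?n - j \<and>
      R' (tmp (d+1)) = \<rho> v \<and> R' (vreg v) = j \<and> R' 0 = length (xs @ zs @ ?s j) \<and> R' 1 = R 1 \<and>
      (\<forall>w. w \<noteq> v \<longrightarrow> R' (vreg w) = R (vreg w)) \<and> (\<forall>e<d. R' (tmp e) = R (tmp e))" for j R' M'
  have loop: "wp (WhileNZ (tmp d) ?body) R' M'
       (\<lambda>t R' M'. t \<le> Suc ?n * (?T + ?n + 1) \<and> I ?n R' M')" if "I 0 R' M'" for R' M'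
  proof (rule wp_WhileNZ[where I = I and T = ?T, OF _ _ that])
    fix j R2 M2
    assume j: "j < ?n" and I: "I j R2 M2"
    have pre: "gen_pre xs (\<rho>(v := j)) R2 (zs @ ?s j)"
      using I For.prems(1) unfolding gen_pre_def I_def by auto
    have m: "M2 = mem (xs @ zs @ ?s j)" using I unfolding I_def by simp
    have b: "bits j \<le> ?N" "bits (?n - j) \<le> ?N"
      using j n by (auto intro!: bits_le_trans)
    show "wp ?body R2 M2 (\<lambda>t R' M'. t \<le> ?T \<and> I (Suc j) R' M')"
      unfolding wp_Seq m
    proof (rule wp_mono[OF For.IH[OF pre bd len[OF j]]])
      show "j \<le> ?n" using j by simp
      fix t3 R3 M3
      assume 3: "gen_post xs (\<rho>(v := j)) g (d + 2) ?C D (zs @ ?s j) R2 t3 R3 M3"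
      then show "wp (SetConst (tmp (d + 2)) 1) R3 M3 (\<lambda>t' R' M'.
          wp (Add (vreg v) (vreg v) (tmp (d + 2))) R' M' (\<lambda>t'a R' M'.
          wp (Sub (tmp d) (tmp d) (tmp (d + 2))) R' M' (\<lambda>t'b R' M'.
            t3 + (t' + (t'a + t'b)) \<le> ?T \<and> I (Suc j) R' M')))"
        using I b by (auto simp: I_def gen_post_def preserves_def)
    qed
  qed (auto simp: I_def)
  show ?case unfolding comp_gen.simps wp_Seq
  proof (rule wp_mono[OF wp_comp_exp[OF gen_pre_represents[OF For.prems(1)] For.prems(2)]])
    fix t R1 M1
    assume 1: "exp_post xs \<rho> n d B R (mem (xs @ zs)) t R1 M1"
    have t: "t \<le> exp_time n B" "M1 = mem (xs @ zs)" "R1 (tmp d) = ?n" "preserves d R R1"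
      using 1 unfolding exp_post_def by auto
    have v1: "R1 (vreg v) = \<rho> v" using t(4) rv unfolding preserves_def by simp
    let ?R = "R1(tmp (d + 1) := \<rho> v, vreg v := 0)"
    have I0: "I 0 ?R (mem (xs @ zs))"
      using t v1 For.prems(1) unfolding I_def preserves_def gen_pre_def by auto
    have bv: "bits (\<rho> v) \<le> B" using rv by (auto intro: bits_le_trans)
    have "wp (WhileNZ (tmp d) ?body) ?R (mem (xs @ zs))
         (\<lambda>t' R2 M2. wp (move (vreg v) (tmp (d + 1))) R2 M2 (\<lambda>t''.
           gen_post xs \<rho> (For v n g) d B D zs R (t + (2 + bits (\<rho> v) + (1 + (t' + t''))))))"
    proof (rule wp_mono[OF loop[OF I0]])
      fix t' R2 M2
      assume 2: "t' \<le> Suc ?n * (?T + ?n + 1) \<and> I ?n R2 M2"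
      have "Suc ?n * (?T + ?n + 1) \<le> Suc ?N * (?T + ?N + 1)" using n by (intro mult_mono) auto
      then have t': "t' \<le> Suc ?N * (?T + ?N + 1)" using 2 by linarith
      have "preserves d (R(0 := R2 0)) (R2(vreg v := \<rho> v))"
        using 2 rv unfolding I_def preserves_def by auto
      then show "wp (move (vreg v) (tmp (d + 1))) R2 M2 (\<lambda>t''.
           gen_post xs \<rho> (For v n g) d B D zs R (t + (2 + bits (\<rho> v) + (1 + (t' + t'')))))"
        using 2 t' t(1) bv unfolding gen_post_def I_def by simp
    qed
    then show "wp (move (tmp (d + 1)) (vreg v)) R1 M1 (\<lambda>t'a R' M'. wp (SetConst (vreg v) 0) R' M'
        (\<lambda>t'b R' M'. wp (WhileNZ (tmp d) ?body) R' M' (\<lambda>t' R2 M2.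
           wp (move (vreg v) (tmp (d + 1))) R2 M2 (\<lambda>t''.
             gen_post xs \<rho> (For v n g) d B D zs R (t + (t'a + (t'b + (t' + t''))))))))"
      using v1 t(2) by simp
  qed
qed

text \<open>The generated entries are moved afterwards, at a cost that depends on their bit
  lengths.\<close>

fun out_bound :: "gen \<Rightarrow> nat \<Rightarrow> nat" where
  "out_bound (Emit a) B = val_bound a B"
| "out_bound (App g h) B = out_bound g B + out_bound h B"
| "out_bound (Guard a g) B = out_bound g B"
| "out_bound (For v n g) B = out_bound g (B + val_bound n B)"

lemma gens_le_out_bound: "bounded_by B xs \<rho> \<Longrightarrow> x \<in> set (gens xs \<rho> g) \<Longrightarrow> x \<le> out_bound g B"
proof (induction g arbitrary: B \<rho>)
  case (Emit a) then show ?case using eval_le_val_bound by auto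
next
  case (App g h) then show ?case by (auto intro: trans_le_add1 trans_le_add2)
next
  case (Guard a g) then show ?case by (auto split: if_splits)
next
  case (For v n g)
  then obtain i where i: "i < eval xs \<rho> n" "x \<in> set (gens xs (\<rho>(v := i)) g)" by auto
  have "i \<le> val_bound n B" using i(1) eval_le_val_bound[OF For.prems(1), of n] by simp
  from For.IH[OF bounded_by_upd[OF For.prems(1) this] i(2)] show ?case by simp
qed

lemma poly_out_bound: "poly_bounded (out_bound g)"
proof (induction g)
  case (Emit a)
  then show ?case using poly_val_bound[of a] by simp
next
  case (App g h)
  then show ?case using poly_bounded_add[of "out_bound g" "out_bound h"] by simp
next
  case (For v n g)
  then show ?case
    using poly_bounded_comp[OF For poly_bounded_add[OF poly_bounded_id poly_val_bound[of n]]] by simp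
qed auto

section \<open>Running the solver on the generated list\<close>

lemma wp_reg_unchanged:
  assumes "wp P R M Q" and "reg_bound P \<le> K"
  shows "wp P R M (\<lambda>t R' M'. Q t R' M' \<and> (\<forall>r\<ge>K. R' r = R r))"
  using assms exec_reg_unchanged unfolding wp_def by (metis order_trans)

fun clear_regs :: "nat \<Rightarrow> prog" where
  "clear_regs 0 = Skip"
| "clear_regs (Suc K) = Seq (SetConst (Suc K) 0) (clear_regs K)"

lemma wp_clear_regs [simp]:
  "wp (clear_regs K) R M Q \<longleftrightarrow> Q (K + 1) (\<lambda>r. if 1 \<le> r \<and> r \<le> K then 0 else R r) M"
proof (induction K arbitrary: R Q)
  case 0
  have "(\<lambda>r. if 1 \<le> r \<and> r \<le> 0 then 0 else R r) = R" by auto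
  then show ?case by simp
next
  case (Suc K)
  have "(\<lambda>r. if 1 \<le> r \<and> r \<le> K then 0 else (R(Suc K := 0)) r) =
        (\<lambda>r. if 1 \<le> r \<and> r \<le> Suc K then 0 else R r)" by (auto simp: fun_eq_iff)
  then show ?case using Suc by simp
qed

definition copy_down :: prog where
  "copy_down = WhileNZ 4 (Seq (Load 7 3) (Seq (Store 6 7) (Seq (Add 3 3 2) (Seq (Add 6 6 2) (Sub 4 4 2)))))"

definition clear_up :: prog where
  "clear_up = WhileNZ 4 (Seq (Store 6 7) (Seq (Add 6 6 2) (Sub 4 4 2)))"

text \<open>The cell right behind the input holds the first generated number, the budget, which is
  saved in register \<open>K\<close>. The remaining list is shifted to address \<open>0\<close> and
  its length, kept in register \<open>5\<close>, goes to register \<open>0\<close>. Leftover cells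
  and registers below \<open>K\<close> are cleared, because the solver is only specified on initial
  states.\<close>

definition relocate :: "reg \<Rightarrow> prog" where
  "relocate K = Seq (Load K 1) (Seq (SetConst 2 1) (Seq (Add 3 1 2) (Seq (Sub 4 0 3) (Seq (move 5 4)
     (Seq (SetConst 6 0) (Seq copy_down (Seq (Sub 4 0 6) (Seq (SetConst 7 0) (Seq clear_up
     (Seq (move 0 5) (clear_regs (K - 1))))))))))))"

text \<open>Source and target may overlap. Copying in ascending order to lower addresses is safe:
  after \<open>j\<close> rounds only cells below \<open>j\<close> are overwritten, and the next
  source cell lies beyond them.\<close>

lemma wp_copy_down:
  assumes M: "M = mem (xs @ k # ys)" and D: "length (xs @ k # ys) \<le> D" and V: "\<forall>y\<in>set ys. y \<le> V"
    and R: "R 2 = 1" "R 3 = length xs + 1" "R 4 = length ys" "R 6 = 0"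
  shows "wp copy_down R M (\<lambda>t R' M'. t \<le> Suc D * (12 + 6 * D + 2 * V) \<and>
     M' = (\<lambda>a. if a < length ys then ys ! a else mem (xs @ k # ys) a) \<and>
     R' 6 = length ys \<and> (\<forall>r. r \<notin> {3, 4, 6, 7} \<longrightarrow> R' r = R r))"
proof -
  let ?n = "length ys"
  let ?T = "11 + 5 * D + 2 * V"
  define I where "I j R' M' \<longleftrightarrow> M' = (\<lambda>a. if a < j then ys ! a else mem (xs @ k # ys) a) \<and>
     R' 3 = length xs + 1 + j \<and> R' 4 = ?n - j \<and> R' 6 = j \<and>
     (\<forall>r. r \<notin> {3, 4, 6, 7} \<longrightarrow> R' r = R r)" for j R' M'
  show ?thesis unfolding copy_down_def
  proof (rule wp_WhileNZ[where I = I and n = ?n and T = ?T])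
    fix j R1 M1
    assume j: "j < ?n" and I: "I j R1 M1"
    have m: "M1 (length xs + 1 + j) = ys ! j"
      using I j by (simp add: I_def mem_def nth_append)
    have u: "M1(j := ys ! j) = (\<lambda>a. if a < Suc j then ys ! a else mem (xs @ k # ys) a)"
      using I by (auto simp: I_def fun_eq_iff less_Suc_eq)
    have b: "bits (ys ! j) \<le> V" "bits (Suc (length xs + j)) \<le> D" "bits j \<le> D" "bits (?n - j) \<le> D"
      using j V D by (auto intro!: bits_le_trans)
    have "R1 2 = 1" using I R by (simp add: I_def)
    then show "wp (Seq (Load 7 3) (Seq (Store 6 7) (Seq (Add 3 3 2) (Seq (Add 6 6 2) (Sub 4 4 2)))))
         R1 M1 (\<lambda>t R' M'. t \<le> ?T \<and> I (Suc j) R' M')"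
      using I m u b j by (auto simp: I_def)
  next
    show "I 0 R M" using assms by (simp add: I_def)
  next
    fix t R' M' assume t: "t \<le> Suc ?n * (?T + ?n + 1)" and I: "I ?n R' M'"
    have "Suc ?n * (?T + ?n + 1) \<le> Suc D * (12 + 6 * D + 2 * V)"
      using D by (intro mult_mono) auto
    then show "t \<le> Suc D * (12 + 6 * D + 2 * V) \<and>
     M' = (\<lambda>a. if a < length ys then ys ! a else mem (xs @ k # ys) a) \<and>
     R' 6 = length ys \<and> (\<forall>r. r \<notin> {3, 4, 6, 7} \<longrightarrow> R' r = R r)"
      using t I by (simp add: I_def)
  qed (simp add: I_def)
qed

text \<open>The list moved down by \<open>length xs + 1\<close> cells, so exactly that many cells
  behind its new end still hold old contents.\<close>

lemma wp_clear_up: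
  assumes M: "M = (\<lambda>a. if a < length ys then ys ! a else mem (xs @ k # ys) a)"
    and D: "length (xs @ k # ys) \<le> D"
    and R: "R 2 = 1" "R 4 = length xs + 1" "R 6 = length ys" "R 7 = 0"
  shows "wp clear_up R M (\<lambda>t R' M'. t \<le> Suc D * (9 + 4 * D) \<and>
     M' = mem ys \<and> (\<forall>r. r \<notin> {3, 4, 6, 7} \<longrightarrow> R' r = R r))"
proof -
  let ?n = "length xs + 1"
  let ?T = "8 + 3 * D"
  define I where "I j R' M' \<longleftrightarrow> M' = (\<lambda>a. if a < length ys then ys ! a
        else if a < length ys + j then 0 else mem (xs @ k # ys) a) \<and>
     R' 4 = ?n - j \<and> R' 6 = length ys + j \<and> R' 7 = 0 \<and>
     (\<forall>r. r \<notin> {3, 4, 6, 7} \<longrightarrow> R' r = R r)" for j R' M'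
  show ?thesis unfolding clear_up_def
  proof (rule wp_WhileNZ[where I = I and n = ?n and T = ?T])
    fix j R1 M1
    assume j: "j < ?n" and I: "I j R1 M1"
    have u: "M1(length ys + j := 0) = (\<lambda>a. if a < length ys then ys ! a
        else if a < length ys + Suc j then 0 else mem (xs @ k # ys) a)"
      using I by (auto simp: I_def fun_eq_iff less_Suc_eq)
    have b: "bits (length ys + j) \<le> D" "bits (Suc (length xs) - j) \<le> D"
      using j D by (auto intro!: bits_le_trans)
    have "R1 2 = 1" using I R by (simp add: I_def)
    then show "wp (Seq (Store 6 7) (Seq (Add 6 6 2) (Sub 4 4 2)))
         R1 M1 (\<lambda>t R' M'. t \<le> ?T \<and> I (Suc j) R' M')"
      using I u b j by (auto simp: I_def)
  next
    show "I 0 R M" using assms by (auto simp: I_def)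
  next
    fix t R' M' assume t: "t \<le> Suc ?n * (?T + ?n + 1)" and I: "I ?n R' M'"
    have "Suc ?n * (?T + ?n + 1) \<le> Suc D * (9 + 4 * D)"
      using D by (intro mult_mono) auto
    moreover have "M' = mem ys" using I unfolding I_def by (auto simp: mem_def fun_eq_iff)
    ultimately show "t \<le> Suc D * (9 + 4 * D) \<and> M' = mem ys \<and> (\<forall>r. r \<notin> {3, 4, 6, 7} \<longrightarrow> R' r = R r)"
      using t I by (simp add: I_def)
  qed (simp add: I_def)
qed

lemma init_state_mem: "init_state xs = ((\<lambda>r. if r = 0 then length xs else 0), mem xs)"
  by (auto simp: init_state_def mem_def)

lemma wp_relocate:
  assumes R: "R 0 = length (xs @ k # ys)" "R 1 = length xs" "\<And>r. r > K \<Longrightarrow> R r = 0" and "K > 7"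
    and D: "length (xs @ k # ys) \<le> D" and V: "\<forall>y\<in>set (k # ys). y \<le> V"
  shows "wp (relocate K) R (mem (xs @ k # ys)) (\<lambda>t R' M'.
     t \<le> Suc D * (12 + 6 * D + 2 * V) + Suc D * (9 + 4 * D) + 20 + 10 * D + V + K \<and>
     R' = (fst (init_state ys))(K := k) \<and> M' = mem ys)"
proof -
  have b: "bits (length xs) \<le> D" "bits (Suc (length xs + length ys)) \<le> D" "bits (Suc (length xs)) \<le> D"
     "bits (length ys) \<le> D" "bits k \<le> V"
    using D V by (auto intro!: bits_le_trans)
  have m: "mem (xs @ k # ys) (length xs) = k" by (simp add: mem_def)
  let ?R = "R(K := k, 2 := 1, 3 := length xs + 1, 4 := length ys, 5 := length ys, 6 := 0)"
  let ?t = "1 + bits (length xs) + bits k + (2 + (1 + bits (length xs) + 1 +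
       (1 + bits (Suc (length xs + length ys)) + bits (Suc (length xs)) + (2 + bits (length ys) + 1))))"
  have "wp copy_down ?R (mem (xs @ k # ys)) (\<lambda>t R' M'.
     wp (Sub 4 0 6) R' M' (\<lambda>t1 R' M'. wp (SetConst 7 0) R' M' (\<lambda>t2 R' M'. wp clear_up R' M' (\<lambda>t3 R' M'.
     wp (move 0 5) R' M' (\<lambda>t4 R' M'. wp (clear_regs (K - 1)) R' M' (\<lambda>t5 R' M'.
       ?t + (t + (t1 + (t2 + (t3 + (t4 + t5)))))
        \<le> Suc D * (12 + 6 * D + 2 * V) + Suc D * (9 + 4 * D) + 20 + 10 * D + V + K \<and>
       R' = (fst (init_state ys))(K := k) \<and> M' = mem ys))))))"
  proof (rule wp_mono[OF wp_copy_down[where xs = xs and k = k and ys = ys and D = D and V = V]])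
    fix t R1 M1
    assume 1: "t \<le> Suc D * (12 + 6 * D + 2 * V) \<and>
     M1 = (\<lambda>a. if a < length ys then ys ! a else mem (xs @ k # ys) a) \<and>
     R1 6 = length ys \<and> (\<forall>r. r \<notin> {3, 4, 6, 7} \<longrightarrow> R1 r = ?R r)"
    then have r: "R1 0 = Suc (length xs + length ys)" "R1 6 = length ys" "R1 5 = length ys" "R1 2 = 1"
      "R1 K = k" "\<And>r. r > K \<Longrightarrow> R1 r = 0"
      using R \<open>K > 7\<close> by auto
    have "wp clear_up (R1(4 := Suc (length xs), 7 := 0)) M1 (\<lambda>t3 R' M'.
     wp (move 0 5) R' M' (\<lambda>t4 R' M'. wp (clear_regs (K - 1)) R' M' (\<lambda>t5 R' M'.
       ?t + (t + (1 + bits (Suc (length xs + length ys)) + bits (length ys) + (1 + (t3 + (t4 + t5)))))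
        \<le> Suc D * (12 + 6 * D + 2 * V) + Suc D * (9 + 4 * D) + 20 + 10 * D + V + K \<and>
       R' = (fst (init_state ys))(K := k) \<and> M' = mem ys)))"
    proof (rule wp_mono[OF wp_clear_up[where xs = xs and k = k and ys = ys and D = D]])
      fix t' R2 M2
      assume 2: "t' \<le> Suc D * (9 + 4 * D) \<and> M2 = mem ys \<and>
        (\<forall>ra. ra \<notin> {3, 4, 6, 7} \<longrightarrow> R2 ra = (R1(4 := Suc (length xs), 7 := 0)) ra)"
      then have r2: "R2 5 = length ys" "R2 K = k" "\<And>r. r > K \<Longrightarrow> R2 r = 0" using r \<open>K > 7\<close> by auto
      have "(\<lambda>ra. if 1 \<le> ra \<and> ra \<le> K - 1 then 0 else (R2(0 := length ys)) ra) = (fst (init_state ys))(K := k)"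
      proof
        fix ra
        show "(if 1 \<le> ra \<and> ra \<le> K - 1 then 0 else (R2(0 := length ys)) ra) = ((fst (init_state ys))(K := k)) ra"
          using r2 \<open>K > 7\<close> by (cases "ra < K"; cases "ra = K") (auto simp: init_state_def)
      qed
      then show "wp (move 0 5) R2 M2 (\<lambda>t4 R' M'. wp (clear_regs (K - 1)) R' M' (\<lambda>t5 R' M'.
         ?t + (t + (1 + bits (Suc (length xs + length ys)) + bits (length ys) + (1 + (t' + (t4 + t5)))))
        \<le> Suc D * (12 + 6 * D + 2 * V) + Suc D * (9 + 4 * D) + 20 + 10 * D + V + K \<and>
       R' = (fst (init_state ys))(K := k) \<and> M' = mem ys))"
        using 1 2 r2 b \<open>K > 7\<close> by simp
    qed (use 1 r D in auto)
    then show "wp (Sub 4 0 6) R1 M1 (\<lambda>t1 R' M'. wp (SetConst 7 0) R' M' (\<lambda>t2 R' M'.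
      wp clear_up R' M' (\<lambda>t3 R' M'.
     wp (move 0 5) R' M' (\<lambda>t4 R' M'. wp (clear_regs (K - 1)) R' M' (\<lambda>t5 R' M'.
       ?t + (t + (t1 + (t2 + (t3 + (t4 + t5)))))
        \<le> Suc D * (12 + 6 * D + 2 * V) + Suc D * (9 + 4 * D) + 20 + 10 * D + V + K \<and>
       R' = (fst (init_state ys))(K := k) \<and> M' = mem ys)))))"
      using r by simp
  qed (use D V \<open>K > 7\<close> in auto)
  then show ?thesis unfolding relocate_def using R m \<open>K > 7\<close> by (simp add: add.assoc)
qed

text \<open>For a fixed generator and solver \<open>P\<close>, the first generated number is the
  budget and the rest is the input of \<open>P\<close>. As \<open>P\<close> runs once, its time is
  added, not multiplied; twice the result length pays for the final comparison.\<close>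

theorem reduction_program:
  "\<exists>Q f. poly_bounded f \<and> (\<forall>xs B k ys t s. bounded_by B xs (\<lambda>_. 0) \<longrightarrow>
     gens xs (\<lambda>_. 0) g = k # ys \<longrightarrow> exec P (init_state ys) t s \<longrightarrow>
     (\<exists>t' s'. exec Q (init_state xs) t' s' \<and> t' \<le> f B + t + 2 * length (result s) \<and>
        result s' = [if length (result s) \<le> k then 1 else 0]))"
proof -
  define K where "K = max 8 (max (reg_bound (comp_gen g 0)) (reg_bound P))"
  have K: "7 < K" "reg_bound (comp_gen g 0) \<le> K" "reg_bound P \<le> K" unfolding K_def by auto
  \<comment> \<open>The truncated difference in register \<open>K\<close> is zero exactly if the
    result respects the budget. Register \<open>0\<close> serves first as the result length, then as
    the address \<open>0\<close> of the answer, and finally as the output length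
    \<open>1\<close>.\<close>
  define finish where "finish = Seq (Sub K 0 K)
    (Seq (IfNZ K (SetConst (K + 1) 0) (SetConst (K + 1) 1))
    (Seq (SetConst 0 0) (Seq (Store 0 (K + 1)) (SetConst 0 1))))"
  define Q where "Q = Seq (move 1 0) (Seq (comp_gen g 0) (Seq (relocate K) (Seq P finish)))"
  define D where "D B = B + len_bound g B" for B
  define V where "V = out_bound g"
  define f where "f B = 2 + B + gen_time g B (D B) +
     (Suc (D B) * (12 + 6 * D B + 2 * V B) + Suc (D B) * (9 + 4 * D B) + 20 + 10 * D B + V B + K)
     + 10 + (V B + D B)" for B
  have pD: "poly_bounded D" unfolding D_def by (intro poly_bounded_add poly_bounded_id poly_len_bound)
  have pV: "poly_bounded V" unfolding V_def by (rule poly_out_bound)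
  have poly: "poly_bounded (\<lambda>B. f B)" unfolding f_def
    by (intro poly_bounded_add poly_bounded_mult poly_bounded_Suc poly_bounded_const poly_bounded_id
        poly_gen_time pD pV)
  have main: "\<exists>t' s'. exec Q (init_state xs) t' s' \<and> t' \<le> f B + t + 2 * length (result s) \<and>
        result s' = [if length (result s) \<le> k then 1 else 0]"
    if B: "bounded_by B xs (\<lambda>_. 0)" and g: "gens xs (\<lambda>_. 0) g = k # ys" and P: "exec P (init_state ys) t s"
    for xs B k ys t s
  proof -
    let ?R = "(\<lambda>r. if r = 0 then length xs else 0)(1 := length xs)"
    have D: "length (xs @ [] @ gens xs (\<lambda>_. 0) g) \<le> D B"
      using B length_gens_le[OF B, of g] unfolding D_def bounded_by_def by simp
    have V: "\<forall>y\<in>set (k # ys). y \<le> V B"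
      using gens_le_out_bound[OF B, of _ g] unfolding V_def g by blast
    have pre: "gen_pre xs (\<lambda>_. 0) ?R []" by (auto simp: gen_pre_def)
    have len: "length (result s) = fst s 0" by (simp add: result_def)
    have "wp (comp_gen g 0) ?R (mem (xs @ [])) (\<lambda>t1 R' M'. wp (relocate K) R' M' (\<lambda>t2 R' M'.
        wp P R' M' (\<lambda>t3 R' M'. wp finish R' M' (\<lambda>t4 R' M'.
        2 + bits (length xs) + (t1 + (t2 + (t3 + t4))) \<le> f B + t + 2 * length (result s) \<and>
        result (R', M') = [if length (result s) \<le> k then 1 else 0]))))"
    proof (rule wp_mono[OF wp_reg_unchanged[OF wp_comp_gen[OF pre B D] K(2)]])
      fix t1 R1 M1
      assume 1: "gen_post xs (\<lambda>_. 0) g 0 B (D B) [] ?R t1 R1 M1 \<and> (\<forall>r\<ge>K. R1 r = ?R r)"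
      then have M1: "M1 = mem (xs @ k # ys)" and R1: "R1 0 = length (xs @ k # ys)" "R1 1 = length xs"
          "\<And>r. r > K \<Longrightarrow> R1 r = 0" and t1: "t1 \<le> gen_time g B (D B)"
        using K(1) g by (auto simp: gen_post_def preserves_def)
      show "wp (relocate K) R1 M1 (\<lambda>t2 R' M'.
        wp P R' M' (\<lambda>t3 R' M'. wp finish R' M' (\<lambda>t4 R' M'.
        2 + bits (length xs) + (t1 + (t2 + (t3 + t4))) \<le> f B + t + 2 * length (result s) \<and>
        result (R', M') = [if length (result s) \<le> k then 1 else 0])))"
        unfolding M1
      proof (rule wp_mono[OF wp_relocate[OF R1 K(1) _ V]])
        show "length (xs @ k # ys) \<le> D B" using D g by simp
        fix t2 R2 M2
        assume 2: "t2 \<le> Suc (D B) * (12 + 6 * D B + 2 * V B) + Suc (D B) * (9 + 4 * D B) + 20 + 10 * D B + V B + K \<and>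
            R2 = (fst (init_state ys))(K := k) \<and> M2 = mem ys"
        \<comment> \<open>The state differs from an initial one only in register \<open>K\<close>,
          which is out of reach for \<open>P\<close>, so the given run of \<open>P\<close> carries
          over and the budget survives it.\<close>
        let ?R3 = "\<lambda>r. if r < K then fst s r else R2 r"
        have e: "exec P (R2, M2) t (?R3, snd s)"
          using exec_frame[OF P K(3), of R2] 2 by (simp add: init_state_mem)
        have "wp finish ?R3 (snd s) (\<lambda>t4 R' M'.
          2 + bits (length xs) + (t1 + (t2 + (t + t4))) \<le> f B + t + 2 * length (result s) \<and>
          result (R', M') = [if length (result s) \<le> k then 1 else 0])"
        proof -
          have r: "?R3 0 = length (result s)" "?R3 K = k" using 2 K(1) len by auto
          have b: "bits (length xs) \<le> B" "bits k \<le> V B" "bits (length (result s) - k) \<le> length (result s)"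
              "bits (length (result s)) \<le> length (result s)"
            using B V by (auto intro!: bits_le_trans simp: bounded_by_def)
          show ?thesis
          proof (cases "length (result s) \<le> k")
            case True
            then show ?thesis
              using r b t1 2 K(1) unfolding finish_def f_def by (simp add: result_def del: bits_le)
          next
            case False
            then show ?thesis
              using r b t1 2 K(1) unfolding finish_def f_def by (simp add: result_def del: bits_le)
          qed
        qed
        then show "wp P R2 M2 (\<lambda>t3 R' M'. wp finish R' M' (\<lambda>t4 R' M'.
          2 + bits (length xs) + (t1 + (t2 + (t3 + t4))) \<le> f B + t + 2 * length (result s) \<and>
          result (R', M') = [if length (result s) \<le> k then 1 else 0]))"
          unfolding wp_exec[OF e] .
      qed
    qed
    then have "wp Q (\<lambda>r. if r = 0 then length xs else 0) (mem xs) (\<lambda>t' R' M'.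
        t' \<le> f B + t + 2 * length (result s) \<and>
        result (R', M') = [if length (result s) \<le> k then 1 else 0])"
      unfolding Q_def by (simp only: wp_Seq wp_move[OF one_neq_zero] append_Nil2 refl if_True)
    then show ?thesis unfolding wp_def init_state_mem by blast
  qed
  show ?thesis
    by (intro exI[of _ Q] exI[of _ f] conjI allI impI) (use poly in simp, rule main)
qed

section \<open>Reductions to Dominating Set\<close>

definition edge_list :: "nat \<Rightarrow> (nat \<Rightarrow> nat \<Rightarrow> bool) \<Rightarrow> (nat \<times> nat) list" where
  "edge_list N adj =
     concat (map (\<lambda>y. concat (map (\<lambda>x. if adj x y then [(x, y)] else []) [0..<y])) [0..<N])"

definition ds_of :: "nat \<Rightarrow> nat \<Rightarrow> (nat \<Rightarrow> nat \<Rightarrow> bool) \<Rightarrow> ds_instance" where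
  "ds_of N p adj = (N, edge_list N adj, [0..<p])"

text \<open>The number of edges must precede the edges, so the adjacency test \<open>a\<close>
  occurs twice: under a double sum for counting and under a double loop for emission. Variable
  \<open>0\<close> is the smaller and variable \<open>1\<close> the larger endpoint.\<close>

definition ds_gen :: "exp \<Rightarrow> exp \<Rightarrow> exp \<Rightarrow> exp \<Rightarrow> gen" where
  "ds_gen k N p a = App (Emit k) (App (Emit N)
     (App (Emit (Sum 1 N (Sum 0 (Var 1) (Cond a (Const 1) (Const 0)))))
     (App (For 1 N (For 0 (Var 1) (Guard a (App (Emit (Var 0)) (Emit (Var 1))))))
     (App (Emit p) (For 0 p (Emit (Var 0)))))))"

lemma length_edge_list: "length (edge_list N adj) = (\<Sum>y<N. \<Sum>x<y. if adj x y then 1 else 0)"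
proof -
  have "length (concat (map (\<lambda>x. if adj x y then [(x, y)] else []) [0..<y]))
      = (\<Sum>x<y. if adj x y then 1 else 0)" for y
    by (simp add: length_concat comp_def interv_sum_list_conv_sum_set_nat atLeast0LessThan
        if_distrib[of length] cong: if_cong)
  then show ?thesis
    by (simp add: edge_list_def length_concat comp_def interv_sum_list_conv_sum_set_nat atLeast0LessThan)
qed

lemma gens_ds_gen:
  "gens xs \<rho> (ds_gen k N p a) =
     eval xs \<rho> k # enc_ds (ds_of (eval xs \<rho> N) (eval xs \<rho> p) (\<lambda>x y. eval xs (\<rho>(1 := y, 0 := x)) a \<noteq> 0))"
proof -
  let ?adj = "\<lambda>x y. eval xs (\<rho>(1 := y, 0 := x)) a \<noteq> 0"
  have cc: "concat (map f (concat (map g ys))) = concat (map (\<lambda>y. concat (map f (g y))) ys)"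
    for f :: "nat \<times> nat \<Rightarrow> nat list" and g and ys :: "nat list"
    by (induction ys) auto
  have "concat (map (\<lambda>(u, v). [u, v]) (edge_list (eval xs \<rho> N) ?adj)) =
     gens xs \<rho> (For 1 N (For 0 (Var 1) (Guard a (App (Emit (Var 0)) (Emit (Var 1))))))"
    by (simp add: edge_list_def cc if_distrib[of "map _"] if_distrib[of concat] cong: if_cong)
  moreover have "concat (map (\<lambda>q. [q]) [0..<n]) = [0..<n]" for n :: nat by (induction n) auto
  moreover have "gens xs \<rho> (For 0 p (Emit (Var 0))) = [0..<eval xs \<rho> p]" by (simp add: concat_map_singleton)
  moreover have "eval xs \<rho> (Sum 1 N (Sum 0 (Var 1) (Cond a (Const 1) (Const 0)))) =
     length (edge_list (eval xs \<rho> N) ?adj)"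
    by (simp add: length_edge_list cong: if_cong)
  ultimately show ?thesis
    by (simp add: ds_gen_def ds_of_def enc_list_def del: eval.simps gens.simps(3,4) One_nat_def)
qed

lemma set_edge_list: "set (edge_list N adj) = {(x, y). x < y \<and> y < N \<and> adj x y}"
  by (auto simp: edge_list_def split: if_splits)

lemma distinct_edge_list: "distinct (map edge (edge_list N adj))"
proof -
  have d: "distinct (concat (map f [0..<n]))"
    if dist: "\<And>i. distinct (f i)" and disj: "\<And>i j. i \<noteq> j \<Longrightarrow> set (f i) \<inter> set (f j) = {}"
    for f :: "nat \<Rightarrow> (nat \<times> nat) list" and n
  proof (induction n)
    case (Suc n)
    have "set (f i) \<inter> set (f n) = {}" if "i < n" for i using that disj[of i n] by simp
    then show ?case using Suc dist by (auto simp: disjoint_iff)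
  qed simp
  have "distinct (edge_list N adj)" unfolding edge_list_def
    by (rule d, rule d) (auto split: if_splits)
  moreover have "inj_on edge (set (edge_list N adj))"
    by (auto simp: inj_on_def set_edge_list doubleton_eq_iff)
  ultimately show ?thesis by (simp add: distinct_map)
qed

definition edges_of :: "nat \<Rightarrow> (nat \<Rightarrow> nat \<Rightarrow> bool) \<Rightarrow> nat set set" where
  "edges_of N adj = {{x, y} |x y. x < y \<and> y < N \<and> adj x y}"

lemma edge_set_edge_list: "edge ` set (edge_list N adj) = edges_of N adj"
  by (auto simp: set_edge_list edges_of_def image_iff Bex_def; blast)

lemma pair_in_edges_of:
  assumes "x < y"
  shows "{x, y} \<in> edges_of N adj \<longleftrightarrow> y < N \<and> adj x y" "{y, x} \<in> edges_of N adj \<longleftrightarrow> y < N \<and> adj x y"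
  using assms by (auto simp: edges_of_def doubleton_eq_iff)

lemma loop_notin_edges_of: "{x, x} \<notin> edges_of N adj"
  by (auto simp: edges_of_def doubleton_eq_iff)

text \<open>The hub vertices come first in the numbering, so \<open>x < p\<close> for the smaller
  endpoint means that every edge meets the hub. All components outside are then single vertices, and
  \<open>\<delta>\<close> bounds their degrees.\<close>

lemma hub_instance_ds_of:
  assumes "p \<le> N"
    and hub: "\<And>x y. x < y \<Longrightarrow> y < N \<Longrightarrow> adj x y \<Longrightarrow> x < p"
    and deg: "\<And>y. p \<le> y \<Longrightarrow> y < N \<Longrightarrow> card {x. x < p \<and> adj x y} \<le> \<delta>"
  shows "hub_instance 1 \<delta> (ds_of N p adj)"
proof -
  let ?E = "edges_of N adj"
  have "card e = 2" "e \<subseteq> {..<N}" if "e \<in> ?E" for e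
    using that by (auto simp: edges_of_def)
  then have "simple_graph {..<N} ?E" by (auto simp: simple_graph_def)
  moreover have "is_hub 1 \<delta> {..<N} ?E {0..<p}"
    unfolding is_hub_def
  proof (intro conjI ballI)
    show "{0..<p} \<subseteq> {..<N}" using assms(1) by auto
    fix C assume C: "C \<in> components_on ({..<N} - {0..<p}) ?E"
    have "{x, y} \<notin> ?E" if "p \<le> x" "p \<le> y" for x y
      using that hub by (auto simp: edges_of_def doubleton_eq_iff) (meson leD)+
    then have empty: "{(x, y). x \<in> {..<N} - {0..<p} \<and> y \<in> {..<N} - {0..<p} \<and> {x, y} \<in> ?E} = {}"
      by auto
    obtain v where v: "C = {v}" "p \<le> v" "v < N"
      using C unfolding components_on_def empty by auto
    show "card C \<le> 1" using v by simp
    have "{q \<in> {0..<p}. \<exists>v\<in>C. {q, v} \<in> ?E} = {x. x < p \<and> adj x v}"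
      using v by (auto simp: pair_in_edges_of)
    then show "card {q \<in> {0..<p}. \<exists>v\<in>C. {q, v} \<in> ?E} \<le> \<delta>" using deg v by simp
  qed
  ultimately show ?thesis
    using distinct_edge_list by (simp add: ds_of_def edge_set_edge_list atLeast0LessThan)
qed

definition has_dominating_set :: "nat \<Rightarrow> (nat \<Rightarrow> nat \<Rightarrow> bool) \<Rightarrow> nat \<Rightarrow> bool" where
  "has_dominating_set N adj k \<longleftrightarrow> (\<exists>X. dominating_set {..<N} (edges_of N adj) X \<and> card X \<le> k)"

text \<open>The solver returns a minimum dominating set, so its length decides every budget; the
  bound by \<open>N\<close> keeps the comparison cheap.\<close>

lemma ds_solution_ds_of:
  assumes "ds_solution (ds_of N p adj) ys"
  shows "length ys \<le> N" and "length ys \<le> k \<longleftrightarrow> has_dominating_set N adj k"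
proof -
  have m: "min_dominating_set {..<N} (edges_of N adj) (set ys)" and d: "distinct ys"
    using assms by (auto simp: ds_of_def edge_set_edge_list)
  have l: "length ys = card (set ys)" using d by (simp add: distinct_card)
  have "set ys \<subseteq> {..<N}" using m by (simp add: min_dominating_set_def dominating_set_def)
  then show "length ys \<le> N" using card_mono[of "{..<N}" "set ys"] l by simp
  show "length ys \<le> k \<longleftrightarrow> has_dominating_set N adj k"
    using m l unfolding has_dominating_set_def min_dominating_set_def by (auto intro: order_trans)
qed

text \<open>One call of the solver decides the instance. The expressions \<open>N\<close>,
  \<open>p\<close>, \<open>k\<close> and \<open>a\<close> for the number of vertices, the hub size,
  the budget and the adjacency are the same for all instances. The exponential factor enters through
  \<open>size\<close> only, which permits a change of base and a constant factor
  \<open>C\<close>.\<close>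

theorem solvable_by_dominating_set:
  fixes b b' C :: real and par :: "'i \<Rightarrow> nat"
  assumes solver: "dominating_set_hub_solvable 1 \<delta> b" and b: "b' \<ge> 1" "C \<ge> 0"
    and q: "poly_bounded q"
    and bounded: "\<And>i. valid i \<Longrightarrow> bounded_by (q (par i)) (enc i) (\<lambda>_. 0)"
    and adj: "\<And>i x y. adj i x y \<longleftrightarrow> eval (enc i) ((\<lambda>_. 0)(1 := y, 0 := x)) a \<noteq> 0"
    and hub: "\<And>i. valid i \<Longrightarrow>
       hub_instance 1 \<delta> (ds_of (eval (enc i) (\<lambda>_. 0) N) (eval (enc i) (\<lambda>_. 0) p) (adj i))"
    and size: "\<And>i. valid i \<Longrightarrow> b ^ eval (enc i) (\<lambda>_. 0) p \<le> C * b' ^ par i"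
    and yes: "\<And>i. valid i \<Longrightarrow>
       yes i \<longleftrightarrow> has_dominating_set (eval (enc i) (\<lambda>_. 0) N) (adj i) (eval (enc i) (\<lambda>_. 0) k)"
  shows "solvable_in_time valid enc (\<lambda>i. decides (yes i)) b' par par"
proof -
  let ?ev = "\<lambda>i. eval (enc i) (\<lambda>_. 0)"
  let ?ds = "\<lambda>i. ds_of (?ev i N) (?ev i p) (adj i)"
  obtain P c where P: "\<And>i. hub_instance 1 \<delta> i \<Longrightarrow> \<exists>t s. exec P (init_state (enc_ds i)) t s \<and>
      real t \<le> b ^ hub_size i * (real (num_vertices i) + 2) ^ c \<and> ds_solution i (result s)"
    using solver unfolding dominating_set_hub_solvable_def solvable_in_time_def solves_within_def by blast
  obtain Q f where f: "poly_bounded f" and Q: "\<And>xs B k' ys t s. bounded_by B xs (\<lambda>_. 0) \<Longrightarrow>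
     gens xs (\<lambda>_. 0) (ds_gen k N p a) = k' # ys \<Longrightarrow> exec P (init_state ys) t s \<Longrightarrow>
     (\<exists>t' s'. exec Q (init_state xs) t' s' \<and> t' \<le> f B + t + 2 * length (result s) \<and>
        result s' = [if length (result s) \<le> k' then 1 else 0])"
    using reduction_program[of "ds_gen k N p a" P] by blast
  define Nb where "Nb n = val_bound N (q n)" for n
  \<comment> \<open>Generation and comparison, plus the polynomial factor of the solver at the
    vertex bound \<open>Nb\<close>; the constant \<open>C\<close> is rounded up and absorbed
    here.\<close>
  define F where "F n = f (q n) + 2 * Nb n + nat \<lceil>C\<rceil> * (Nb n + 2) ^ c" for n
  have Nb: "poly_bounded Nb" unfolding Nb_def by (intro poly_bounded_comp[OF poly_val_bound] q)
  have "poly_bounded F" unfolding F_def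
    by (intro poly_bounded_add poly_bounded_mult poly_bounded_power poly_bounded_const Nb
        poly_bounded_comp[OF f] q)
  then obtain e where e: "\<And>n. F n \<le> (n + 2) ^ e" unfolding poly_bounded_def by blast
  have "\<exists>t s. exec Q (init_state (enc i)) t s \<and> real t \<le> b' ^ par i * (real (par i) + 2) ^ e \<and>
      decides (yes i) (result s)" if i: "valid i" for i
  proof -
    obtain t s where t: "exec P (init_state (enc_ds (?ds i))) t s"
      "real t \<le> b ^ hub_size (?ds i) * (real (num_vertices (?ds i)) + 2) ^ c"
      and s: "ds_solution (?ds i) (result s)"
      using P[OF hub[OF i]] by blast
    have "gens (enc i) (\<lambda>_. 0) (ds_gen k N p a) = ?ev i k # enc_ds (?ds i)"
      unfolding gens_ds_gen adj[abs_def] by simp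
    from Q[OF bounded[OF i] this t(1)] obtain t' s' where
      t': "exec Q (init_state (enc i)) t' s'" "t' \<le> f (q (par i)) + t + 2 * length (result s)"
      "result s' = [if length (result s) \<le> ?ev i k then 1 else 0]" by blast
    have N: "?ev i N \<le> Nb (par i)" unfolding Nb_def by (rule eval_le_val_bound[OF bounded[OF i]])
    have t2: "real t \<le> C * b' ^ par i * (real (?ev i N) + 2) ^ c"
    proof -
      have "real t \<le> b ^ ?ev i p * (real (?ev i N) + 2) ^ c" using t(2) by (simp add: ds_of_def)
      also have "\<dots> \<le> C * b' ^ par i * (real (?ev i N) + 2) ^ c"
        by (intro mult_right_mono size i) simp
      finally show ?thesis .
    qed
    also have "\<dots> \<le> real (nat \<lceil>C\<rceil>) * b' ^ par i * (real (Nb (par i)) + 2) ^ c"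
      using b N by (intro mult_mono power_mono mult_nonneg_nonneg) auto
    finally have t3: "real t \<le> b' ^ par i * (real (nat \<lceil>C\<rceil> * (Nb (par i) + 2) ^ c))"
      by (simp add: algebra_simps)
    \<comment> \<open>With base at least 1, the polynomial overhead may be multiplied by the
      exponential factor as well.\<close>
    have b1: "1 \<le> b' ^ par i" using b by simp
    have "real t' \<le> real (f (q (par i)) + 2 * Nb (par i)) + real t"
      using t'(2) ds_solution_ds_of(1)[OF s] N by linarith
    also have "\<dots> \<le> b' ^ par i * real (f (q (par i)) + 2 * Nb (par i)) + real t"
      using mult_right_mono[OF b1, of "real (f (q (par i)) + 2 * Nb (par i))"] by simp
    also have "\<dots> \<le> b' ^ par i * real (F (par i))"
      using t3 unfolding F_def by (simp add: algebra_simps)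
    also have "\<dots> \<le> b' ^ par i * real ((par i + 2) ^ e)"
      using b1 e by (intro mult_left_mono) (auto simp del: of_nat_power)
    finally have "real t' \<le> b' ^ par i * (real (par i) + 2) ^ e" by (simp add: add.commute)
    moreover have "decides (yes i) (result s')"
      using t'(3) yes[OF i] ds_solution_ds_of(2)[OF s] by (simp add: decides_def)
    ultimately show ?thesis using t'(1) by blast
  qed
  then show ?thesis unfolding solvable_in_time_def solves_within_def by blast
qed

subsection \<open>Derived expressions\<close>

fun fv :: "exp \<Rightarrow> nat set" where
  "fv (Const c) = {}"
| "fv (Var v) = {v}"
| "fv (Plus a b) = fv a \<union> fv b"
| "fv (Minus a b) = fv a \<union> fv b"
| "fv (Read a) = fv a"
| "fv (Cond c a b) = fv c \<union> fv a \<union> fv b"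
| "fv (Sum v n a) = fv n \<union> (fv a - {v})"
| "fv (Iter v n a b) = fv n \<union> fv a \<union> (fv b - {v})"

text \<open>Needed because \<open>Div\<close> puts its argument below the binder of variable
  \<open>9\<close>; the value is unaffected if that variable is not free in it.\<close>

lemma eval_cong: "(\<And>v. v \<in> fv a \<Longrightarrow> \<rho> v = \<rho>' v) \<Longrightarrow> eval xs \<rho> a = eval xs \<rho>' a"
proof (induction a arbitrary: \<rho> \<rho>')
  case (Plus a b)
  from Plus.IH(1)[of \<rho> \<rho>'] Plus.IH(2)[of \<rho> \<rho>'] Plus.prems show ?case by simp
next
  case (Minus a b)
  from Minus.IH(1)[of \<rho> \<rho>'] Minus.IH(2)[of \<rho> \<rho>'] Minus.prems show ?case by simp
next
  case (Read a)
  from Read.IH[of \<rho> \<rho>'] Read.prems show ?case by simp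
next
  case (Cond c a b)
  from Cond.IH(1)[of \<rho> \<rho>'] Cond.IH(2)[of \<rho> \<rho>'] Cond.IH(3)[of \<rho> \<rho>'] Cond.prems show ?case by simp
next
  case (Sum v n a)
  have "eval xs \<rho> n = eval xs \<rho>' n" using Sum.prems by (intro Sum.IH(1)) auto
  moreover have "eval xs (\<rho>(v := i)) a = eval xs (\<rho>'(v := i)) a" for i
    using Sum.prems by (intro Sum.IH(2)) auto
  ultimately show ?case by simp
next
  case (Iter v n a b)
  have "eval xs \<rho> n = eval xs \<rho>' n" using Iter.prems by (intro Iter.IH(1)) auto
  moreover have "eval xs \<rho> a = eval xs \<rho>' a" using Iter.prems by (intro Iter.IH(2)) auto
  moreover have "eval xs (\<rho>(v := i)) b = eval xs (\<rho>'(v := i)) b" for i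
    using Iter.prems by (intro Iter.IH(3)) auto
  ultimately show ?case by simp
qed auto

definition Neg_exp :: "exp \<Rightarrow> exp" where "Neg_exp a = Cond a (Const 0) (Const 1)"
definition And_exp :: "exp \<Rightarrow> exp \<Rightarrow> exp" where "And_exp a b = Cond a b (Const 0)"
definition Or_exp :: "exp \<Rightarrow> exp \<Rightarrow> exp" where "Or_exp a b = Cond a (Const 1) b"
definition Less_exp :: "exp \<Rightarrow> exp \<Rightarrow> exp" where "Less_exp a b = Minus b a"
definition Eq_exp :: "exp \<Rightarrow> exp \<Rightarrow> exp" where "Eq_exp a b = Neg_exp (Plus (Minus a b) (Minus b a))"
definition Scale :: "nat \<Rightarrow> exp \<Rightarrow> exp" where "Scale c a = Sum 9 a (Const c)"
text \<open>The quotient counts the \<open>i\<close> below the dividend with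
  \<open>(i + 1) * c\<close> at most the dividend. Divisors are constants, so products can be formed
  by \<open>Scale\<close>.\<close>

definition Div :: "exp \<Rightarrow> nat \<Rightarrow> exp" where
  "Div a c = Sum 9 a (Cond (Minus (Scale c (Plus (Var 9) (Const 1))) a) (Const 0) (Const 1))"
definition Mod :: "exp \<Rightarrow> nat \<Rightarrow> exp" where "Mod a c = Minus a (Scale c (Div a c))"

text \<open>Hard-wires a finite table into the program. This is how objects that are only known to
  exist enter the computation.\<close>

fun Table :: "nat \<Rightarrow> (nat \<Rightarrow> exp) \<Rightarrow> exp \<Rightarrow> exp" where
  "Table 0 F a = Const 0"
| "Table (Suc n) F a = Cond (Eq_exp a (Const n)) (F n) (Table n F a)"

definition holds :: "nat list \<Rightarrow> (nat \<Rightarrow> nat) \<Rightarrow> exp \<Rightarrow> bool" where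
  "holds xs \<rho> a \<longleftrightarrow> eval xs \<rho> a \<noteq> 0"

lemma fv_derived [simp]:
  "fv (Scale c a) = fv a" "fv (Div a c) = fv a" "fv (Mod a c) = fv a"
  by (auto simp: Scale_def Div_def Mod_def)

text \<open>With nonzero values read as true, \<open>Sum\<close> acts as a bounded existential
  quantifier.\<close>

lemma holds_derived [simp]:
  "holds xs \<rho> (Neg_exp a) \<longleftrightarrow> \<not> holds xs \<rho> a"
  "holds xs \<rho> (And_exp a b) \<longleftrightarrow> holds xs \<rho> a \<and> holds xs \<rho> b"
  "holds xs \<rho> (Or_exp a b) \<longleftrightarrow> holds xs \<rho> a \<or> holds xs \<rho> b"
  "holds xs \<rho> (Less_exp a b) \<longleftrightarrow> eval xs \<rho> a < eval xs \<rho> b"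
  "holds xs \<rho> (Eq_exp a b) \<longleftrightarrow> eval xs \<rho> a = eval xs \<rho> b"
  "holds xs \<rho> (Cond c a b) \<longleftrightarrow> (if holds xs \<rho> c then holds xs \<rho> a else holds xs \<rho> b)"
  "holds xs \<rho> (Sum v n a) \<longleftrightarrow> (\<exists>i<eval xs \<rho> n. holds xs (\<rho>(v := i)) a)"
  "holds xs \<rho> (Const m) \<longleftrightarrow> m \<noteq> 0"
  by (auto simp: holds_def Neg_exp_def And_exp_def Or_exp_def Less_exp_def Eq_exp_def)

lemma holds_Table [simp]: "holds xs \<rho> (Table n F a) \<longleftrightarrow>
    eval xs \<rho> a < n \<and> holds xs \<rho> (F (eval xs \<rho> a))"
  by (induction n) (auto simp: less_Suc_eq)

lemma eval_Scale [simp]: "eval xs \<rho> (Scale c a) = eval xs \<rho> a * c"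
  by (simp add: Scale_def)

lemma eval_Div [simp]:
  assumes "9 \<notin> fv a" and "c > 0"
  shows "eval xs \<rho> (Div a c) = eval xs \<rho> a div c"
proof -
  let ?a = "eval xs \<rho> a"
  have "eval xs (\<rho>(9 := i)) a = ?a" for i using assms(1) by (intro eval_cong) auto
  then have "eval xs \<rho> (Div a c) = (\<Sum>i<?a. if Suc i * c \<le> ?a then 1 else 0)"
    unfolding Div_def by (auto simp: intro!: sum.cong)
  also have "\<dots> = (\<Sum>i<?a. if i < ?a div c then 1 else 0)"
    using assms(2) by (intro sum.cong) (auto simp: less_eq_div_iff_mult_less_eq Suc_le_eq[symmetric] simp del: mult_Suc)
  also have "\<dots> = card {i. i < ?a \<and> i < ?a div c}"
    by (simp add: sum.If_cases Int_def)
  also have "{i. i < ?a \<and> i < ?a div c} = {..<?a div c}"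
    by (auto intro: less_le_trans[OF _ div_le_dividend])
  finally show ?thesis by simp
qed

lemma eval_Mod [simp]: "9 \<notin> fv a \<Longrightarrow> c > 0 \<Longrightarrow> eval xs \<rho> (Mod a c) = eval xs \<rho> a mod c"
  by (simp add: Mod_def minus_div_mult_eq_mod)

subsection \<open>Access to lists of lists\<close>

text \<open>Items have varying lengths, so the \<open>j\<close>-th one is found by skipping
  \<open>j\<close> items from address \<open>p\<close>, where the first length entry stands.\<close>

definition Offset :: "nat \<Rightarrow> exp \<Rightarrow> exp" where
  "Offset p j = Iter 8 j (Const p) (Plus (Plus (Var 8) (Const 1)) (Read (Var 8)))"

definition Item_length :: "nat \<Rightarrow> exp \<Rightarrow> exp" where
  "Item_length p j = Read (Offset p j)"

definition Item :: "nat \<Rightarrow> exp \<Rightarrow> exp \<Rightarrow> exp" where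
  "Item p j i = Read (Plus (Plus (Offset p j) (Const 1)) i)"

lemma fv_Item [simp]: "fv (Item p j i) = fv j \<union> fv i" "fv (Item_length p j) = fv j"
  by (auto simp: Item_def Item_length_def Offset_def)

abbreviation items :: "nat list list \<Rightarrow> nat list" where
  "items cs \<equiv> concat (map (\<lambda>C. length C # C) cs)"

lemma items_split:
  "j < length cs \<Longrightarrow> items cs = items (take j cs) @ (length (cs ! j) # cs ! j) @ items (drop (Suc j) cs)"
  by (subst id_take_nth_drop[of j cs]) auto

text \<open>The end of every item lies within the input, so the clipping in \<open>Iter\<close>
  never takes effect on these positions.\<close>

lemma eval_Offset:
  assumes "xs = pre @ items cs" and "eval xs \<rho> j \<le> length cs"
  shows "eval xs \<rho> (Offset (length pre) j) = length pre + length (items (take (eval xs \<rho> j) cs))"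
proof -
  let ?f = "\<lambda>x. min (x + 1 + (if x < length xs then xs ! x else 0)) (length xs)"
  have "(?f ^^ m) (length pre) = length pre + length (items (take m cs))" if "m \<le> length cs" for m
    using that
  proof (induction m)
    case (Suc m)
    let ?o = "length pre + length (items (take m cs))"
    have xs: "xs = (pre @ items (take m cs)) @ (length (cs ! m) # cs ! m) @ items (drop (Suc m) cs)"
      using assms(1) items_split[of m cs] Suc.prems by simp
    have "?o < length xs" "xs ! ?o = length (cs ! m)" "?o + 1 + length (cs ! m) \<le> length xs"
      by (subst xs; simp add: nth_append)+
    then have "?f ?o = ?o + 1 + length (cs ! m)" by simp
    moreover have "(?f ^^ m) (length pre) = ?o" using Suc by simp
    ultimately have "(?f ^^ Suc m) (length pre) = ?o + 1 + length (cs ! m)"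
      by (simp only: funpow.simps comp_apply)
    then show ?case using Suc.prems by (simp add: take_Suc_conv_app_nth)
  qed simp
  then show ?thesis using assms(2) by (simp add: Offset_def cong: if_cong)
qed

lemma eval_Item:
  assumes xs: "xs = pre @ items cs" and p: "p = length pre" and j: "eval xs \<rho> j < length cs"
  shows "eval xs \<rho> (Item_length p j) = length (cs ! eval xs \<rho> j)"
    and "eval xs \<rho> i < length (cs ! eval xs \<rho> j) \<Longrightarrow>
      eval xs \<rho> (Item p j i) = cs ! eval xs \<rho> j ! eval xs \<rho> i"
proof -
  obtain m where m: "eval xs \<rho> j = m" by simp
  let ?o = "length pre + length (items (take m cs))"
  have o: "eval xs \<rho> (Offset p j) = ?o" using eval_Offset[OF xs, of \<rho> j] j p m by simp
  have xs': "xs = (pre @ items (take m cs)) @ (length (cs ! m) # cs ! m) @ items (drop (Suc m) cs)"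
    using xs items_split[of m cs] j m by simp
  have "?o < length xs" "xs ! ?o = length (cs ! m)"
    by (subst xs'; simp add: nth_append)+
  then show "eval xs \<rho> (Item_length p j) = length (cs ! eval xs \<rho> j)"
    using o m by (simp add: Item_length_def)
  have n: "?o + 1 + l < length xs" "xs ! (?o + 1 + l) = cs ! m ! l" if "l < length (cs ! m)" for l
    by (subst xs'; use that in \<open>simp add: nth_append\<close>)+
  show "eval xs \<rho> i < length (cs ! eval xs \<rho> j) \<Longrightarrow>
      eval xs \<rho> (Item p j i) = cs ! eval xs \<rho> j ! eval xs \<rho> i"
    using o n[of "eval xs \<rho> i"] m by (simp add: Item_def)
qed

lemma length_items_le: "(\<And>C. C \<in> set cs \<Longrightarrow> length C \<le> d) \<Longrightarrow> length (items cs) \<le> length cs * (d + 1)"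
proof (induction cs)
  case (Cons C cs)
  have "length C \<le> d" "length (items cs) \<le> length cs * (d + 1)" using Cons by auto
  then show ?case by simp
qed simp

lemma bounded_by_items:
  assumes "xs = pre @ items cs" and "\<And>C. C \<in> set cs \<Longrightarrow> length C \<le> d \<and> (\<forall>x\<in>set C. x \<le> B)"
    and "\<And>x. x \<in> set pre \<Longrightarrow> x \<le> B" and "length pre + length cs * (d + 1) \<le> B" and "d \<le> B"
  shows "bounded_by B xs (\<lambda>_. 0)"
proof -
  have "length xs \<le> B" using length_items_le[of cs d] assms(1,2,4) by simp
  moreover have "\<forall>x\<in>set xs. x \<le> B" using assms(1,2,3,5) by (fastforce intro: order_trans)
  ultimately show ?thesis by (simp add: bounded_by_def)
qed

text \<open>Distinct sets are given by distinct lists of length at most \<open>d\<close>, of which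
  there are polynomially many in \<open>m\<close>. This makes the length of an instance polynomial
  in the number of elements or variables alone.\<close>

lemma length_distinct_sets_le:
  assumes "distinct (map set cs)" and "\<And>C. C \<in> set cs \<Longrightarrow> set C \<subseteq> A \<and> length C \<le> d"
    and "finite A" and "card A \<le> m"
  shows "length cs \<le> (d + 1) * (m + 1) ^ d"
proof -
  have "length cs = card (set cs)" using assms(1) by (simp add: distinct_map distinct_card)
  also have "\<dots> \<le> card {xs. set xs \<subseteq> A \<and> length xs \<le> d}"
    using assms(2) finite_lists_length_le[OF assms(3)] by (intro card_mono) auto
  also have "\<dots> = (\<Sum>i\<le>d. card A ^ i)" by (rule card_lists_length_le[OF assms(3)])
  \<comment> \<open>The base \<open>m + 1\<close> is positive, so its powers grow with the exponent
    even for \<open>m = 0\<close>.\<close>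
  also have "\<dots> \<le> (\<Sum>i\<le>d. (m + 1) ^ d)"
  proof (rule sum_mono)
    fix i assume "i \<in> {..d}"
    have "card A ^ i \<le> (m + 1) ^ i" using assms(4) by (intro power_mono) auto
    also have "\<dots> \<le> (m + 1) ^ d" using \<open>i \<in> {..d}\<close> by (intro power_increasing) auto
    finally show "card A ^ i \<le> (m + 1) ^ d" .
  qed
  finally show ?thesis by simp
qed

lemma dominating_set_edges_of:
  "dominating_set {..<N} (edges_of N adj) X \<longleftrightarrow> X \<subseteq> {..<N} \<and>
     (\<forall>v<N. v \<in> X \<or> (\<exists>x\<in>X. x < v \<and> adj x v) \<or> (\<exists>y\<in>X. v < y \<and> adj v y))" (is "?L \<longleftrightarrow> ?R")
proof -
  have e: "{v, x} \<in> edges_of N adj \<longleftrightarrow> x < v \<and> adj x v \<or> v < x \<and> adj v x" if "v < N" "x < N" for v x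
    using that by (cases v x rule: linorder_cases) (auto simp: pair_in_edges_of loop_notin_edges_of[simplified])
  show ?thesis unfolding dominating_set_def
    by (intro conj_cong refl) (use e in \<open>auto simp: subset_iff; blast\<close>)
qed

subsection \<open>Set Cover\<close>

text \<open>Elements are the vertices below \<open>u\<close>, \<open>u\<close> is the vertex
  \<open>z\<close> of the overview, \<open>u + 1\<close> its pendant vertex, and
  \<open>u + 2 + j\<close> the \<open>j\<close>-th set. Only the case that \<open>x\<close> is the
  smaller endpoint matters.\<close>

definition sc_adj :: "nat \<Rightarrow> nat list list \<Rightarrow> nat \<Rightarrow> nat \<Rightarrow> bool" where
  "sc_adj u fs x y \<longleftrightarrow> u < y \<and> (x = u \<or> x < u \<and> u + 1 < y \<and> x \<in> set (fs ! (y - (u + 2))))"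

lemma set_cover_iff_dominating_set:
  assumes "sc_instance d (u, fs, t)"
  shows "sc_yes (u, fs, t) \<longleftrightarrow> has_dominating_set (u + 2 + length fs) (sc_adj u fs) (t + 1)"
proof
  let ?N = "u + 2 + length fs"
  assume "sc_yes (u, fs, t)"
  then obtain C where C: "C \<subseteq> set ` set fs" "finite C" "card C \<le> t" "\<Union>C = {..<u}"
    by (auto simp: has_cover_def)
  have "\<forall>S\<in>C. \<exists>j<length fs. set (fs ! j) = S" 
    using C(1) by (metis (no_types, lifting) imageE in_set_conv_nth subsetD)
  then obtain j where j: "\<And>S. S \<in> C \<Longrightarrow> j S < length fs \<and> set (fs ! j S) = S" by metis
  define X where "X = insert u ((\<lambda>S. u + 2 + j S) ` C)"
  have "card X \<le> t + 1"
  proof -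
    have "card X \<le> Suc (card ((\<lambda>S. u + 2 + j S) ` C))" unfolding X_def by (rule card_insert_le_m1) auto
    also have "\<dots> \<le> t + 1" using card_image_le[OF C(2), of "\<lambda>S. u + 2 + j S"] C(3) by linarith
    finally show ?thesis .
  qed
  moreover have "dominating_set {..<?N} (edges_of ?N (sc_adj u fs)) X"
    unfolding dominating_set_edges_of
  proof (intro conjI allI impI)
    show "X \<subseteq> {..<?N}" using j unfolding X_def by fastforce
    fix v assume "v < ?N"
    show "v \<in> X \<or> (\<exists>x\<in>X. x < v \<and> sc_adj u fs x v) \<or> (\<exists>y\<in>X. v < y \<and> sc_adj u fs v y)"
    proof (cases "v < u")
      case True
      then obtain S where S: "S \<in> C" "v \<in> S" using C(4) by blast
      then have "u + 2 + j S \<in> X" "sc_adj u fs v (u + 2 + j S)"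
        using True j[of S] by (auto simp: X_def sc_adj_def)
      then show ?thesis using True by (intro disjI2 bexI[of _ "u + 2 + j S"]) auto
    next
      case False
      then show ?thesis by (cases "v = u") (auto simp: X_def sc_adj_def)
    qed
  qed
  ultimately show "has_dominating_set ?N (sc_adj u fs) (t + 1)" unfolding has_dominating_set_def by blast
next
  let ?N = "u + 2 + length fs" and ?F = "set ` set fs"
  assume "has_dominating_set ?N (sc_adj u fs) (t + 1)"
  then obtain X where X: "X \<subseteq> {..<?N}" and card: "card X \<le> t + 1"
    and dom: "\<And>v. v < ?N \<Longrightarrow> v \<in> X \<or> (\<exists>x\<in>X. x < v \<and> sc_adj u fs x v) \<or> (\<exists>y\<in>X. v < y \<and> sc_adj u fs v y)"
    unfolding has_dominating_set_def dominating_set_edges_of by blast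
  have F: "\<Union>?F = {..<u}" using assms by simp
  have finX: "finite X" using X finite_subset by blast
  \<comment> \<open>Sends a set vertex to its set and an element to an arbitrary set containing it,
    which covers at least what the selected vertex dominated among the elements.\<close>
  define \<phi> where "\<phi> x = (if x < u then SOME S. S \<in> ?F \<and> x \<in> S else set (fs ! (x - (u + 2))))" for x
  have \<phi>: "\<phi> x \<in> ?F \<and> x \<in> \<phi> x" if "x < u" for x
  proof -
    have "\<exists>S. S \<in> ?F \<and> x \<in> S" using F that by blast
    from someI_ex[OF this] show ?thesis using that by (simp add: \<phi>_def)
  qed
  define C where "C = \<phi> ` (X - {u, u + 1})"
  \<comment> \<open>Dominating the pendant vertex costs one selected vertex, which accounts for the
    budget \<open>t + 1\<close> in place of \<open>t\<close>.\<close>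
  have "u \<in> X \<or> u + 1 \<in> X" using dom[of "u + 1"] by (auto simp: sc_adj_def)
  then have "card (X - {u, u + 1}) < card X" by (intro psubset_card_mono finX) auto
  then have "card C \<le> t" unfolding C_def
    using card_image_le[of "X - {u, u + 1}" \<phi>] finX card by auto
  moreover have sub: "C \<subseteq> ?F"
  proof -
    have "\<phi> x \<in> ?F" if "x \<in> X" "x \<noteq> u" "x \<noteq> u + 1" for x
    proof (cases "x < u")
      case False
      then have "x - (u + 2) < length fs" using that X by auto
      then show ?thesis using False by (simp add: \<phi>_def)
    qed (use \<phi> in blast)
    then show ?thesis unfolding C_def by auto
  qed
  moreover have "\<Union>C = {..<u}"
  proof
    show "\<Union>C \<subseteq> {..<u}" using sub F by blast
    show "{..<u} \<subseteq> \<Union>C"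
    proof
      fix v assume v: "v \<in> {..<u}"
      with dom[of v] consider "v \<in> X" | y where "y \<in> X" "sc_adj u fs v y"
        by (auto simp: sc_adj_def)
      then show "v \<in> \<Union>C"
      proof cases
        case 1 then show ?thesis using v \<phi>[of v] unfolding C_def by auto
      next
        case 2
        then have "y \<in> X - {u, u + 1}" "v \<in> \<phi> y" using v by (auto simp: sc_adj_def \<phi>_def)
        then show ?thesis unfolding C_def by blast
      qed
    qed
  qed
  ultimately show "sc_yes (u, fs, t)" using finX unfolding C_def by (auto simp: has_cover_def)
qed

text \<open>The items start at address \<open>3\<close>, behind \<open>u\<close>, \<open>t\<close>
  and the number of sets. Variable \<open>2\<close> runs over the positions in a set.\<close>

definition Sc_adj :: exp where
  "Sc_adj = (let u = Read (Const 0); x = Var 0; y = Var 1; j = Minus y (Plus u (Const 2)) in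
     And_exp (Less_exp u y) (Or_exp (Eq_exp x u) (And_exp (Less_exp x u) (And_exp (Less_exp (Plus u (Const 1)) y)
       (Sum 2 (Item_length 3 j) (Eq_exp (Item 3 j (Var 2)) x))))))"

lemma enc_sc_items: "enc_sc (u, fs, t) = [u, t, length fs] @ items fs"
proof -
  have "concat (map (\<lambda>x. [x]) S) = S" for S :: "nat list" by (induction S) auto
  then show ?thesis by (simp add: enc_list_def[abs_def])
qed

lemma holds_Sc_adj:
  assumes "y < u + 2 + length fs"
  shows "holds (enc_sc (u, fs, t)) ((\<lambda>_. 0)(1 := y, 0 := x)) Sc_adj \<longleftrightarrow> sc_adj u fs x y"
proof -
  let ?xs = "enc_sc (u, fs, t)" and ?j = "Minus (Var 1) (Plus (Read (Const 0)) (Const 2))"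
  have u: "eval ?xs \<rho> (Read (Const 0)) = u" for \<rho> by (simp add: enc_sc_items)
  show ?thesis
  proof (cases "u + 1 < y")
    case True
    let ?S = "fs ! (y - (u + 2))" and ?\<rho> = "(\<lambda>_. 0)(1 := y, 0 := x)"
    have j: "eval ?xs \<rho> ?j = y - (u + 2)" if "\<rho> 1 = y" for \<rho> using that u[of \<rho>] by simp
    have l: "y - (u + 2) < length fs" using True assms by auto
    have len: "eval ?xs ?\<rho> (Item_length 3 ?j) = length ?S"
      using eval_Item(1)[where pre = "[u, t, length fs]" and xs = ?xs and cs = fs and p = 3 and \<rho> = ?\<rho> and j = ?j, OF enc_sc_items] j[of ?\<rho>] l by simp
    have it: "eval ?xs (?\<rho>(2 := i)) (Item 3 ?j (Var 2)) = ?S ! i" if "i < length ?S" for i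
      using eval_Item(2)[where pre = "[u, t, length fs]" and xs = ?xs and cs = fs and p = 3 and \<rho> = "?\<rho>(2 := i)" and j = ?j and i = "Var 2", OF enc_sc_items] j[of "?\<rho>(2 := i)"] l that by simp
    have "holds ?xs ?\<rho> (Sum 2 (Item_length 3 ?j) (Eq_exp (Item 3 ?j (Var 2)) (Var 0))) \<longleftrightarrow> x \<in> set ?S"
      unfolding holds_derived len using it by (auto simp: in_set_conv_nth)
    then show ?thesis unfolding Sc_adj_def Let_def sc_adj_def holds_derived(2-5) u using True
      by (simp del: eval.simps(5) enc_sc.simps add: u)
  next
    case False
    then show ?thesis unfolding Sc_adj_def Let_def sc_adj_def holds_derived(2-5) 
      by (simp del: eval.simps(5) enc_sc.simps add: u)
  qed
qed

text \<open>The hub has \<open>u + 1\<close> vertices, hence the constant factor \<open>b\<close>. A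
  set vertex sees at most \<open>d\<close> elements and \<open>z\<close>, hence the degree
  \<open>d + 1\<close>.\<close>

theorem set_cover_solvable_by_dominating_set:
  assumes "dominating_set_hub_solvable 1 (d + 1) b" and "b \<ge> 1"
  shows "set_cover_solvable d b"
  unfolding set_cover_solvable_def
proof (rule solvable_by_dominating_set[where C = b and a = Sc_adj, OF assms(1) assms(2)])
  define q where "q u = 3 + u + d + ((d + 1) * (u + 1) ^ d) * (d + 1)" for u
  show "poly_bounded q" unfolding q_def
    by (intro poly_bounded_add poly_bounded_mult poly_bounded_power poly_bounded_const poly_bounded_id)
  define adj where "adj i x y \<longleftrightarrow> eval (enc_sc i) ((\<lambda>_. 0)(1 := y, 0 := x)) Sc_adj \<noteq> 0" for i x y
  show "adj i x y \<longleftrightarrow> eval (enc_sc i) ((\<lambda>_. 0)(1 := y, 0 := x)) Sc_adj \<noteq> 0" for i x y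
    unfolding adj_def ..
  let ?u = "Read (Const 0)"
  let ?N = "Plus (Plus ?u (Const 2)) (Read (Const 2))" and ?p = "Plus ?u (Const 1)"
    and ?k = "Plus (Read (Const 1)) (Const 1)"
  fix i assume i: "sc_instance d i"
  obtain u fs t where [simp]: "i = (u, fs, t)" by (cases i)
  have sub: "set S \<subseteq> {..<u} \<and> length S \<le> d" if "S \<in> set fs" for S using i that by auto
  have len: "length fs \<le> (d + 1) * (u + 1) ^ d"
    using length_distinct_sets_le[of fs "{..<u}" d u] i sub by auto
  then have len': "length fs * (d + 1) \<le> ((d + 1) * (u + 1) ^ d) * (d + 1)" by (rule mult_le_mono1)
  have len2: "length fs \<le> length fs * (d + 1)" by simp
  show "bounded_by (q (fst i)) (enc_sc i) (\<lambda>_. 0)"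
  proof (rule bounded_by_items[where pre = "[u, t, length fs]" and cs = fs and d = d])
    show "enc_sc i = [u, t, length fs] @ items fs" by (simp add: enc_sc_items del: enc_sc.simps)
    show "length S \<le> d \<and> (\<forall>x\<in>set S. x \<le> q (fst i))" if "S \<in> set fs" for S
      using sub[OF that] by (auto simp: q_def subset_iff intro!: trans_le_add1 less_imp_le)
    show "x \<le> q (fst i)" if "x \<in> set [u, t, length fs]" for x
      using that i len' len2 unfolding q_def by auto
    show "length [u, t, length fs] + length fs * (d + 1) \<le> q (fst i)"
      using len' unfolding q_def by simp
    show "d \<le> q (fst i)" by (simp add: q_def)
  qed
  have ev: "eval (enc_sc i) (\<lambda>_. 0) ?N = u + 2 + length fs" "eval (enc_sc i) (\<lambda>_. 0) ?p = u + 1"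
    "eval (enc_sc i) (\<lambda>_. 0) ?k = t + 1"
    by (simp_all add: enc_sc_items del: enc_sc.simps)
  have adj: "adj i x y \<longleftrightarrow> sc_adj u fs x y" if "y < u + 2 + length fs" for x y
    using holds_Sc_adj[OF that, of t x] by (simp add: adj_def holds_def)
  show "hub_instance 1 (d + 1) (ds_of (eval (enc_sc i) (\<lambda>_. 0) ?N) (eval (enc_sc i) (\<lambda>_. 0) ?p) (adj i))"
    unfolding ev
  proof (rule hub_instance_ds_of)
    fix y assume y: "u + 1 \<le> y" "y < u + 2 + length fs"
    have "{x. x < u + 1 \<and> adj i x y} \<subseteq> insert u (if y = u + 1 then {} else set (fs ! (y - (u + 2))))"
      using y adj by (auto simp: sc_adj_def)
    then have "card {x. x < u + 1 \<and> adj i x y} \<le> card (insert u (if y = u + 1 then {} else set (fs ! (y - (u + 2)))))"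
      by (rule card_mono[rotated]) simp
    also have "card (insert u (if y = u + 1 then {} else set (fs ! (y - (u + 2))))) \<le> d + 1"
    proof (cases "y = u + 1")
      case False
      then have "fs ! (y - (u + 2)) \<in> set fs" using y by auto
      then have "card (set (fs ! (y - (u + 2)))) \<le> d" using sub card_length order_trans by blast
      then show ?thesis using False card_insert_le_m1[of "d + 1"] by simp
    qed simp
    finally show "card {x. x < u + 1 \<and> adj i x y} \<le> d + 1" .
  qed (use adj in \<open>auto simp: sc_adj_def\<close>)
  show "b ^ eval (enc_sc i) (\<lambda>_. 0) ?p \<le> b * b ^ fst i" unfolding ev by simp
  show "sc_yes i \<longleftrightarrow> has_dominating_set (eval (enc_sc i) (\<lambda>_. 0) ?N) (adj i) (eval (enc_sc i) (\<lambda>_. 0) ?k)"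
  proof -
    have "edges_of (u + 2 + length fs) (adj i) = edges_of (u + 2 + length fs) (sc_adj u fs)"
      unfolding edges_of_def using adj by auto
    then show ?thesis unfolding ev has_dominating_set_def
      using set_cover_iff_dominating_set[of d u fs t] i by (simp add: has_dominating_set_def)
  qed
next
  show "0 \<le> b" using assms(2) by simp
qed

subsection \<open>Satisfiability\<close>

text \<open>
  A block of \<open>\<beta>\<close> variables is represented by \<open>2 * H\<close> vertices, and \<open>dec A\<close> is the assignment of the
  block that is encoded by the selection of exactly the vertices in \<open>A\<close>, where \<open>|A| = H\<close>. Such
  selections form an antichain, so that \<open>A\<close> can be excluded by demanding a vertex outside of \<open>A\<close>.
  The index \<open>a < K\<close> enumerates both the \<open>k\<close>-tuples \<open>h a\<close> of selections and the sets \<open>G a\<close> of size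
  \<open>H + 1\<close>.
\<close>

locale block_code =
  fixes H \<beta> k K :: nat and h :: "nat \<Rightarrow> nat \<Rightarrow> nat set" and G :: "nat \<Rightarrow> nat set"
    and dec :: "nat set \<Rightarrow> nat \<Rightarrow> bool"
  assumes H: "0 < H" and \<beta>: "0 < \<beta>" and K: "0 < K"
    and h: "\<And>a i. a < K \<Longrightarrow> i < k \<Longrightarrow> h a i \<subseteq> {..<2 * H} \<and> card (h a i) = H"
    and h_surj: "\<And>f. (\<And>i. i < k \<Longrightarrow> f i \<subseteq> {..<2 * H} \<and> card (f i) = H) \<Longrightarrow> \<exists>a<K. \<forall>i<k. h a i = f i"
    and G: "\<And>a. a < K \<Longrightarrow> G a \<subseteq> {..<2 * H} \<and> card (G a) = H + 1"
    and G_surj: "\<And>S. S \<subseteq> {..<2 * H} \<Longrightarrow> card S = H + 1 \<Longrightarrow> \<exists>a<K. G a = S"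
    and dec_surj: "\<And>\<alpha>. \<exists>A\<subseteq>{..<2 * H}. card A = H \<and> (\<forall>i<\<beta>. dec A i = \<alpha> i)"

text \<open>Assignments of a block, seen as subsets of \<open>{..<\<beta>}\<close>, inject into the
  \<open>H\<close>-subsets by the binomial bound, and \<open>dec\<close> inverts this injection.
  Outside of its image \<open>dec\<close> is arbitrary, which is harmless: every selection only has
  to decode to some assignment.\<close>

lemma block_code_exists:
  assumes "0 < H" and "0 < \<beta>" and le: "2 ^ \<beta> \<le> (2 * H) choose H"
  obtains K h G dec where "block_code H \<beta> k K h G dec"
proof -
  define \<A> where "\<A> = {A. A \<subseteq> {..<2 * H} \<and> card A = H}"
  define \<G> where "\<G> = {A. A \<subseteq> {..<2 * H} \<and> card A = H + 1}"
  define \<H> where "\<H> = PiE {..<k} (\<lambda>_. \<A>)"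
  have fin: "finite \<A>" "finite \<G>" "finite \<H>"
    unfolding \<A>_def \<G>_def \<H>_def by (auto intro!: finite_PiE)
  have "card (Pow {..<\<beta>}) \<le> card \<A>" using le by (simp add: \<A>_def n_subsets card_Pow)
  then obtain g where g: "g ` Pow {..<\<beta>} \<subseteq> \<A>" "inj_on g (Pow {..<\<beta>})"
    using card_le_inj[of "Pow {..<\<beta>}" \<A>] fin by auto
  define dec where "dec A i \<longleftrightarrow> i \<in> inv_into (Pow {..<\<beta>}) g A" for A i
  have ne: "\<H> \<noteq> {}" "\<G> \<noteq> {}"
  proof -
    \<comment> \<open>The second membership needs \<open>H + 1 \<le> 2 * H\<close>, that is,
      \<open>0 < H\<close>.\<close>
    have "{..<H} \<in> \<A>" "{..<H + 1} \<in> \<G>" using assms(1) by (auto simp: \<A>_def \<G>_def)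
    then show "\<H> \<noteq> {}" "\<G> \<noteq> {}" by (auto simp: \<H>_def PiE_eq_empty_iff)
  qed
  obtain h0 where h0: "bij_betw h0 {0..<card \<H>} \<H>" using ex_bij_betw_nat_finite[OF fin(3)] by blast
  obtain g0 where g0: "bij_betw g0 {0..<card \<G>} \<G>" using ex_bij_betw_nat_finite[OF fin(2)] by blast
  \<comment> \<open>The sum is large enough for both enumerations; indices beyond the end of one of
    them repeat its entry \<open>0\<close>.\<close>
  define K where "K = card \<H> + card \<G>"
  define h where "h a = h0 (if a < card \<H> then a else 0)" for a
  define G where "G a = g0 (if a < card \<G> then a else 0)" for a
  have pos: "0 < card \<H>" "0 < card \<G>" using ne fin by (auto simp: card_gt_0_iff)
  have hin: "h a \<in> \<H>" for a unfolding h_def using bij_betwE[OF h0] pos by auto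
  have Gin: "G a \<in> \<G>" for a unfolding G_def using bij_betwE[OF g0] pos by auto
  have "block_code H \<beta> k K h G dec"
  proof
    show "0 < H" "0 < \<beta>" "0 < K" using assms pos by (auto simp: K_def)
    show "h a i \<subseteq> {..<2 * H} \<and> card (h a i) = H" if "i < k" for a i
      using hin[of a] that by (auto simp: \<H>_def \<A>_def PiE_def Pi_def)
    show "G a \<subseteq> {..<2 * H} \<and> card (G a) = H + 1" for a
      using Gin[of a] by (simp add: \<G>_def)
    show "\<exists>a<K. G a = S" if "S \<subseteq> {..<2 * H}" "card S = H + 1" for S
    proof -
      have "S \<in> \<G>" using that by (simp add: \<G>_def)
      then obtain a where "a < card \<G>" "g0 a = S"
        using g0 unfolding bij_betw_def by (metis atLeastLessThan_iff imageE)
      then show ?thesis by (intro exI[of _ a]) (auto simp: G_def K_def)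
    qed
    show "\<exists>a<K. \<forall>i<k. h a i = f i" if "\<And>i. i < k \<Longrightarrow> f i \<subseteq> {..<2 * H} \<and> card (f i) = H" for f
    proof -
      have "restrict f {..<k} \<in> \<H>" using that by (auto simp: \<H>_def \<A>_def)
      then obtain a where "a < card \<H>" "h0 a = restrict f {..<k}"
        using h0 unfolding bij_betw_def by (metis atLeastLessThan_iff imageE)
      then show ?thesis by (intro exI[of _ a]) (auto simp: h_def K_def)
    qed
    show "\<exists>A\<subseteq>{..<2 * H}. card A = H \<and> (\<forall>i<\<beta>. dec A i = \<alpha> i)" for \<alpha>
    proof -
      let ?S = "{i. i < \<beta> \<and> \<alpha> i}"
      have S: "?S \<in> Pow {..<\<beta>}" by auto
      then have "g ?S \<in> \<A>" "inv_into (Pow {..<\<beta>}) g (g ?S) = ?S"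
        using g by (auto intro: inv_into_f_f)
      then show ?thesis by (intro exI[of _ "g ?S"]) (auto simp: \<A>_def dec_def)
    qed
  qed
  then show ?thesis by (rule that)
qed

fun is_neg :: "literal \<Rightarrow> bool" where
  "is_neg (Pos x) = False"
| "is_neg (Neg x) = True"

lemma lit_true_iff: "lit_true \<alpha> l \<longleftrightarrow> \<alpha> (var l) \<noteq> is_neg l"
  by (cases l) auto

section \<open>Correctness of the reduction from satisfiability\<close>

context block_code
begin

text \<open>The \<open>+ 1\<close> covers an incomplete last block. If \<open>\<beta>\<close>
  divides \<open>n\<close>, it is a spare block, which changes the running time by a constant factor
  only.\<close>

definition blocks :: "nat \<Rightarrow> nat" where "blocks n = n div \<beta> + 1"
definition elems :: "nat \<Rightarrow> nat" where "elems n = blocks n * (2 * H)"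
definition verts :: "nat \<Rightarrow> literal list list \<Rightarrow> nat" where
  "verts n cs = elems n + 2 + (blocks n + length cs) * K"

text \<open>
  The vertices below \<open>u = elems n\<close> form the blocks, \<open>u\<close> dominates all of them and \<open>u + 1\<close> forces the
  selection of \<open>u\<close>. A further vertex is a constraint, given by a block or clause and an index
  \<open>a < K\<close>. If the \<open>a\<close>-th tuple does not falsify the clause, then the constraint is void and hence
  adjacent to \<open>u\<close>.
\<close>

definition sat_adj :: "nat \<Rightarrow> literal list list \<Rightarrow> nat \<Rightarrow> nat \<Rightarrow> bool" where
  "sat_adj n cs x y \<longleftrightarrow> (let u = elems n; q = y - (u + 2); c = q div K; a = q mod K; C = cs ! (c - blocks n) in
     if u + 1 < y then
       if x < u then
         if c < blocks n then x div (2 * H) = c \<and> x mod (2 * H) \<in> G a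
         else \<exists>i<length C. var (C ! i) div \<beta> = x div (2 * H) \<and> x mod (2 * H) \<notin> h a i
       else x = u \<and> \<not> c < blocks n \<and> (\<exists>i<length C. dec (h a i) (var (C ! i) mod \<beta>) \<noteq> is_neg (C ! i))
     else x < u \<and> y = u \<or> x = u \<and> y = u + 1)"

definition constr :: "nat \<Rightarrow> nat \<Rightarrow> nat \<Rightarrow> nat" where
  "constr n c a = elems n + 2 + c * K + a"

lemma constr_lt: "c < blocks n + length cs \<Longrightarrow> a < K \<Longrightarrow> constr n c a < verts n cs"
proof -
  assume "c < blocks n + length cs" "a < K"
  then have "c * K + a < Suc c * K" "Suc c * K \<le> (blocks n + length cs) * K"
    by (simp, intro mult_le_mono1, simp)
  then show ?thesis unfolding constr_def verts_def by linarith
qed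

lemma constr_cases:
  assumes "elems n + 1 < y" and "y < verts n cs"
  obtains c a where "c < blocks n + length cs" "a < K" "y = constr n c a"
proof -
  let ?q = "y - (elems n + 2)"
  have "?q < (blocks n + length cs) * K" using assms by (simp add: verts_def)
  then have "?q div K < blocks n + length cs" by (simp add: less_mult_imp_div_less)
  moreover have "?q mod K < K" using K by simp
  moreover have "y = constr n (?q div K) (?q mod K)" using assms by (simp add: constr_def)
  ultimately show ?thesis by (rule that)
qed

lemma sat_adj_guard:
  assumes "a < K" and "c < blocks n" and "x < elems n"
  shows "sat_adj n cs x (constr n c a) \<longleftrightarrow> x div (2 * H) = c \<and> x mod (2 * H) \<in> G a"
  using assms K by (simp add: sat_adj_def constr_def Let_def)

lemma sat_adj_clause:
  assumes "a < K" and "x < elems n"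
  shows "sat_adj n cs x (constr n (blocks n + j) a) \<longleftrightarrow>
    (\<exists>i<length (cs ! j). var (cs ! j ! i) div \<beta> = x div (2 * H) \<and> x mod (2 * H) \<notin> h a i)"
  using assms K by (simp add: sat_adj_def constr_def Let_def)

lemma sat_adj_clause_void:
  assumes "a < K"
  shows "sat_adj n cs (elems n) (constr n (blocks n + j) a) \<longleftrightarrow>
    (\<exists>i<length (cs ! j). dec (h a i) (var (cs ! j ! i) mod \<beta>) \<noteq> is_neg (cs ! j ! i))"
  using assms K by (simp add: sat_adj_def constr_def Let_def)

lemma sat_adj_guard_void: "a < K \<Longrightarrow> c < blocks n \<Longrightarrow> \<not> sat_adj n cs (elems n) (constr n c a)"
  using K by (simp add: sat_adj_def constr_def Let_def)

lemma sat_adj_le: "sat_adj n cs x y \<Longrightarrow> x \<le> elems n"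
  by (auto simp: sat_adj_def Let_def split: if_splits)

lemma sat_adj_small:
  "y \<le> elems n + 1 \<Longrightarrow> sat_adj n cs x y \<longleftrightarrow> x < elems n \<and> y = elems n \<or> x = elems n \<and> y = elems n + 1"
  by (simp add: sat_adj_def Let_def)

lemma elem_lt: "b < blocks n \<Longrightarrow> e < 2 * H \<Longrightarrow> b * (2 * H) + e < elems n"
proof -
  assume "b < blocks n" "e < 2 * H"
  then have "b * (2 * H) + e < Suc b * (2 * H)" "Suc b * (2 * H) \<le> blocks n * (2 * H)"
    by (simp, intro mult_le_mono1, simp)
  then show ?thesis unfolding elems_def by linarith
qed

lemma var_block: "x < n \<Longrightarrow> x div \<beta> < blocks n"
  by (simp add: blocks_def div_le_mono less_Suc_eq_le)

lemma sat_imp_dominating: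
  assumes valid: "ksat_instance k (n, cs)" and sat: "satisfiable (set ` set cs)"
  shows "has_dominating_set (verts n cs) (sat_adj n cs) (blocks n * H + 1)"
proof -
  let ?N = "verts n cs" and ?u = "elems n" and ?adj = "sat_adj n cs"
  obtain \<alpha> where \<alpha>: "\<And>C. C \<in> set cs \<Longrightarrow> \<exists>l\<in>set C. lit_true \<alpha> l"
  proof -
    obtain \<alpha> where "\<forall>C\<in>set ` set cs. \<exists>l\<in>C. lit_true \<alpha> l"
      using sat unfolding satisfiable_def by blast
    then show ?thesis by (intro that[of \<alpha>]) blast
  qed
  have "\<forall>b. \<exists>A\<subseteq>{..<2 * H}. card A = H \<and> (\<forall>i<\<beta>. dec A i = \<alpha> (b * \<beta> + i))"
    by (intro allI dec_surj)
  then obtain A where A: "\<And>b. A b \<subseteq> {..<2 * H}" "\<And>b. card (A b) = H"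
    "\<And>b i. i < \<beta> \<Longrightarrow> dec (A b) i = \<alpha> (b * \<beta> + i)" by metis
  have finA: "finite (A b)" for b using A(1) finite_subset by blast
  define S where "S = (\<lambda>(b, e). b * (2 * H) + e) ` (SIGMA b:{..<blocks n}. A b)"
  define X where "X = insert ?u S"
  have "card S \<le> card (SIGMA b:{..<blocks n}. A b)"
    unfolding S_def using finA by (intro card_image_le) auto
  also have "\<dots> = blocks n * H" using A(2) finA by simp
  finally have card: "card X \<le> blocks n * H + 1"
    unfolding X_def using card_insert_le_m1[of "blocks n * H + 1" S ?u] by simp
  have S: "b * (2 * H) + e \<in> S" if "b < blocks n" "e \<in> A b" for b e
    using that unfolding S_def by force
  have S_lt: "S \<subseteq> {..<?u}" unfolding S_def using A(1) elem_lt by fastforce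
  have uN: "?u + 2 \<le> ?N" by (simp add: verts_def)
  have "dominating_set {..<?N} (edges_of ?N ?adj) X"
    unfolding dominating_set_edges_of
  proof (intro conjI allI impI)
    show "X \<subseteq> {..<?N}" using S_lt uN unfolding X_def by fastforce
    fix v assume v: "v < ?N"
    consider "v < ?u" | "v = ?u" | "v = ?u + 1" | "?u + 1 < v" by linarith
    then show "v \<in> X \<or> (\<exists>x\<in>X. x < v \<and> ?adj x v) \<or> (\<exists>y\<in>X. v < y \<and> ?adj v y)"
    proof cases
      case 1
      then have "?adj v ?u" by (simp add: sat_adj_small)
      then show ?thesis using 1 unfolding X_def by blast
    next
      case 2 then show ?thesis by (simp add: X_def)
    next
      case 3
      then have "?adj ?u v" by (simp add: sat_adj_small)
      then show ?thesis using 3 unfolding X_def by auto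
    next
      case 4
      then obtain c a where ca: "c < blocks n + length cs" "a < K" "v = constr n c a"
        using constr_cases v by blast
      have hit: ?thesis if "x \<in> S" "?adj x v" for x
      proof -
        have "x < v" using that S_lt 4 by auto
        then show ?thesis using that unfolding X_def by blast
      qed
      show ?thesis
      proof (cases "c < blocks n")
        case True
        \<comment> \<open>Disjointness is impossible, since the sizes add up to
          \<open>2 * H + 1\<close> in a block of \<open>2 * H\<close> vertices.\<close>
        have "A c \<inter> G a \<noteq> {}"
        proof
          assume "A c \<inter> G a = {}"
          then have "card (A c \<union> G a) = H + (H + 1)"
            using A(2)[of c] G[OF ca(2)] finA[of c] finite_subset[of "G a" "{..<2 * H}"]
            by (simp add: card_Un_disjoint)
          moreover have "card (A c \<union> G a) \<le> card {..<2 * H}"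
            using A(1)[of c] G[OF ca(2)] by (intro card_mono) auto
          ultimately show False by simp
        qed
        then obtain e where e: "e \<in> A c" "e \<in> G a" by blast
        have e_lt: "e < 2 * H" using e(1) A(1) by blast
        have "?adj (c * (2 * H) + e) v"
          unfolding ca(3) using e e_lt True ca(2) elem_lt[OF True e_lt] by (simp add: sat_adj_guard)
        then show ?thesis by (rule hit[OF S[OF True e(1)]])
      next
        case False
        define j where "j = c - blocks n"
        have j: "c = blocks n + j" "j < length cs" using False ca(1) by (auto simp: j_def)
        let ?C = "cs ! j"
        have C: "?C \<in> set cs" using j by simp
        then obtain i where i: "i < length ?C" "lit_true \<alpha> (?C ! i)"
          using \<alpha>[OF C] by (auto simp: in_set_conv_nth)
        have len: "length ?C \<le> k" and vars: "var ` set ?C \<subseteq> {..<n}" using valid C by auto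
        let ?x = "var (?C ! i)"
        have xn: "?x < n" using vars i(1) by (auto simp: subset_iff)
        show ?thesis
        proof (cases "dec (h a i) (?x mod \<beta>) = is_neg (?C ! i)")
          \<comment> \<open>The tuple satisfies literal \<open>i\<close>, so the constraint is void
            and \<open>u\<close> dominates it.\<close>
          case False
          then have "?adj ?u v" unfolding ca(3) j(1) using i(1) ca(2) by (auto simp: sat_adj_clause_void)
          then show ?thesis using 4 unfolding X_def by auto
        next
          case True
          let ?b = "?x div \<beta>"
          have "dec (A ?b) (?x mod \<beta>) = \<alpha> ?x" using A(3)[of "?x mod \<beta>" ?b] \<beta> by simp
          \<comment> \<open>The two codes decode differently at this variable. Having the same size,
            they are then incomparable, so the chosen code contains a vertex outside of
            \<open>h a i\<close>.\<close>
          then have "A ?b \<noteq> h a i" using True i(2) by (auto simp: lit_true_iff)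
          moreover have hi: "card (h a i) = H" "finite (h a i)"
            using h[of a i] ca(2) i(1) len finite_subset[of "h a i" "{..<2 * H}"] by auto
          ultimately have "\<not> A ?b \<subseteq> h a i" using card_subset_eq[OF hi(2)] A(2) by metis
          then obtain e where e: "e \<in> A ?b" "e \<notin> h a i" by blast
          have e_lt: "e < 2 * H" using e(1) A(1) by blast
          have b: "?b < blocks n" using var_block[OF xn] .
          have "?adj (?b * (2 * H) + e) v"
            unfolding ca(3) j(1) sat_adj_clause[OF ca(2) elem_lt[OF b e_lt]]
            using i(1) e(2) e_lt by auto
          then show ?thesis by (rule hit[OF S[OF b e(1)]])
        qed
      qed
    qed
  qed
  then show ?thesis using card unfolding has_dominating_set_def by blast
qed

text \<open>Each selected constraint is exchanged for a hub vertex of its demanded set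
  \<open>T y\<close>. Constraints with an empty demand, as those of an empty clause, admit no
  exchange; they are counted separately. Since the blocks need the whole budget, no such constraint
  is selected and every block contains exactly \<open>H\<close> vertices, which decode to a
  satisfying assignment.\<close>

lemma dominating_imp_sat:
  assumes valid: "ksat_instance k (n, cs)"
    and dominating: "has_dominating_set (verts n cs) (sat_adj n cs) (blocks n * H + 1)"
  shows "satisfiable (set ` set cs)"
proof -
  let ?N = "verts n cs" and ?u = "elems n" and ?adj = "sat_adj n cs" and ?mb = "blocks n"
  obtain X where X: "X \<subseteq> {..<?N}" and card: "card X \<le> ?mb * H + 1"
    and dom: "\<And>v. v < ?N \<Longrightarrow> v \<in> X \<or> (\<exists>x\<in>X. x < v \<and> ?adj x v) \<or> (\<exists>y\<in>X. v < y \<and> ?adj v y)"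
    using dominating unfolding has_dominating_set_def dominating_set_edges_of by blast
  have finX: "finite X" using X finite_subset by blast
  define T where "T y = {x. x < ?u \<and> ?adj x y}" for y
  define pick where "pick y = (SOME x. x \<in> T y)" for y
  have pick: "pick y \<in> T y" if "T y \<noteq> {}" for y unfolding pick_def using that by (auto intro: someI_ex)
  define W where "W = {y \<in> X. ?u + 1 < y \<and> T y \<noteq> {}}"
  define Iso where "Iso = {y \<in> X. ?u + 1 < y \<and> T y = {}}"
  define S where "S = (X \<inter> {..<?u}) \<union> pick ` W"
  have dom': "y \<in> X \<or> (\<exists>x\<in>X. x \<in> T y) \<or> ?adj ?u y" if y: "?u + 1 < y" "y < ?N" for y
  proof -
    have "\<not> ?adj y z" for z using y sat_adj_le[of n cs y z] by auto
    then consider "y \<in> X" | x where "x \<in> X" "?adj x y" using dom[OF y(2)] by blast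
    then show ?thesis
    proof cases
      case 2
      then have "x = ?u \<or> x \<in> T y" using sat_adj_le[OF 2(2)] by (auto simp: T_def)
      then show ?thesis using 2 by blast
    qed simp
  qed
  have hits: "S \<inter> T y \<noteq> {}" if y: "?u + 1 < y" "y < ?N" "T y \<noteq> {}" "\<not> ?adj ?u y" for y
    using dom'[OF y(1,2)] y pick[of y] by (auto simp: S_def W_def T_def)
  have card_S: "card S + card Iso \<le> ?mb * H"
  proof -
    \<comment> \<open>Dominating \<open>u + 1\<close> uses up the \<open>+ 1\<close> of the
      budget.\<close>
    have "?u \<in> X \<or> ?u + 1 \<in> X"
      using dom[of "?u + 1"] sat_adj_le[of n cs "?u + 1"] by (auto simp: verts_def sat_adj_small)
    then have "card (X - {?u, ?u + 1}) < card X" by (intro psubset_card_mono finX) auto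
    moreover have "card ((X \<inter> {..<?u}) \<union> W \<union> Iso) = card (X \<inter> {..<?u}) + card W + card Iso"
      using finX by (subst card_Un_disjoint; (subst card_Un_disjoint)?) (auto simp: W_def Iso_def)
    moreover have "(X \<inter> {..<?u}) \<union> W \<union> Iso \<subseteq> X - {?u, ?u + 1}" by (auto simp: W_def Iso_def)
    then have "card ((X \<inter> {..<?u}) \<union> W \<union> Iso) \<le> card (X - {?u, ?u + 1})"
      using finX by (intro card_mono) auto
    moreover have "card S \<le> card (X \<inter> {..<?u}) + card (pick ` W)" unfolding S_def by (rule card_Un_le)
    moreover have "card (pick ` W) \<le> card W" using finX by (intro card_image_le) (auto simp: W_def)
    ultimately show ?thesis using card by linarith
  qed
  have finS: "finite S" using finX by (auto simp: S_def W_def)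
  define B where "B b = {e. e < 2 * H \<and> b * (2 * H) + e \<in> S}" for b
  have B: "B b \<subseteq> {..<2 * H}" "finite (B b)" for b unfolding B_def by auto
  have mod_B: "x mod (2 * H) \<in> B (x div (2 * H))" if "x \<in> S" for x
    unfolding B_def mem_Collect_eq div_mult_mod_eq using that H by simp
  \<comment> \<open>With fewer than \<open>H\<close> selected vertices, the rest of the block
    contains an \<open>(H + 1)\<close>-set, whose guard constraint would not be hit.\<close>
  have ge: "H \<le> card (B b)" if b: "b < ?mb" for b
  proof (rule ccontr)
    assume "\<not> H \<le> card (B b)"
    then have "H + 1 \<le> card ({..<2 * H} - B b)" using B[of b] by (simp add: card_Diff_subset)
    then obtain D where D: "D \<subseteq> {..<2 * H} - B b" "card D = H + 1"
      by (meson obtain_subset_with_card_n)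
    then obtain a where a: "a < K" "G a = D" using G_surj[of D] by blast
    let ?y = "constr n b a"
    have y: "?u + 1 < ?y" "?y < ?N" "\<not> ?adj ?u ?y"
      using constr_lt[of b n cs a] a(1) b sat_adj_guard_void by (auto simp: constr_def)
    have Ty: "x \<in> T ?y \<longleftrightarrow> x < ?u \<and> x div (2 * H) = b \<and> x mod (2 * H) \<in> D" for x
      using sat_adj_guard[OF a(1) b] a(2) by (auto simp: T_def)
    obtain e where e: "e \<in> D" using D(2) by fastforce
    have e_lt: "e < 2 * H" using e D(1) by auto
    have "b * (2 * H) + e \<in> T ?y" unfolding Ty using e e_lt elem_lt[OF b e_lt] by simp
    then obtain x where x: "x \<in> S" "x \<in> T ?y" using hits[OF y(1,2) _ y(3)] by blast
    then have "x mod (2 * H) \<in> D" "x mod (2 * H) \<in> B b" unfolding Ty using mod_B[of x] by auto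
    then show False using D(1) by blast
  qed
  have sum_le: "(\<Sum>b<?mb. card (B b)) \<le> card S"
  proof -
    let ?f = "\<lambda>(b, e). b * (2 * H) + e"
    have "inj_on ?f (SIGMA b:{..<?mb}. B b)"
    proof (rule inj_onI, clarify)
      fix b e b' e'
      assume *: "e \<in> B b" "e' \<in> B b'" "b * (2 * H) + e = b' * (2 * H) + e'"
      have l: "e < 2 * H" "e' < 2 * H" using *(1,2) by (auto simp: B_def)
      have "b = (b * (2 * H) + e) div (2 * H)" using l by simp
      also have "\<dots> = b'" unfolding *(3) using l by simp
      finally show "b = b' \<and> e = e'" using *(3) by simp
    qed
    then have "card (SIGMA b:{..<?mb}. B b) = card (?f ` (SIGMA b:{..<?mb}. B b))"
      by (simp add: card_image)
    also have "\<dots> \<le> card S" using finS by (intro card_mono) (auto simp: B_def)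
    finally show ?thesis using B(2) by simp
  qed
  have sum_ge: "(\<Sum>b<?mb. H) \<le> (\<Sum>b<?mb. card (B b))" using ge by (intro sum_mono) auto
  \<comment> \<open>The blocks already account for all of the budget, so nothing is left for
    \<open>Iso\<close>.\<close>
  have iso: "Iso = {}"
  proof -
    have "card Iso = 0" using sum_le sum_ge card_S by simp
    then show ?thesis using finX by (simp add: Iso_def)
  qed
  have "(\<Sum>b<?mb. H) = (\<Sum>b<?mb. card (B b))" using sum_le sum_ge card_S by simp
  from sum_mono_inv[OF this] have cardB: "card (B b) = H" if "b < ?mb" for b using ge that by force
  define \<alpha> where "\<alpha> x = dec (B (x div \<beta>)) (x mod \<beta>)" for x
  have "\<exists>l\<in>set C. lit_true \<alpha> l" if C: "C \<in> set cs" for C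
  proof (rule ccontr)
    assume "\<not> ?thesis"
    then have false: "\<alpha> (var (C ! i)) = is_neg (C ! i)" if "i < length C" for i
      using that by (auto simp: lit_true_iff)
    have len: "length C \<le> k" and vars: "var ` set C \<subseteq> {..<n}" using valid C by auto
    obtain j where j: "j < length cs" "cs ! j = C" using C by (auto simp: in_set_conv_nth)
    have blk: "var (C ! i) div \<beta> < ?mb" if "i < length C" for i
      using vars that by (intro var_block) (auto simp: subset_iff)
    \<comment> \<open>The enumerated tuples have length \<open>k\<close>; positions beyond the end
      of a shorter clause are filled with an arbitrary \<open>H\<close>-set.\<close>
    define f where "f i = (if i < length C then B (var (C ! i) div \<beta>) else {..<H})" for i
    have "f i \<subseteq> {..<2 * H} \<and> card (f i) = H" for i
      using B(1) cardB blk by (auto simp: f_def)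
    then obtain a where a: "a < K" "\<And>i. i < k \<Longrightarrow> h a i = f i" using h_surj by metis
    have ha: "h a i = B (var (C ! i) div \<beta>)" if "i < length C" for i
      using a(2)[of i] that len by (simp add: f_def)
    let ?y = "constr n (?mb + j) a"
    have y: "?u + 1 < ?y" "?y < ?N"
      using constr_lt[of "?mb + j" n cs a] a(1) j(1) by (auto simp: constr_def)
    have void: "\<not> ?adj ?u ?y"
      unfolding sat_adj_clause_void[OF a(1)] j(2) using false ha by (auto simp: \<alpha>_def)
    have "S \<inter> T ?y = {}"
    proof (rule ccontr)
      assume "S \<inter> T ?y \<noteq> {}"
      then obtain x where x: "x \<in> S" "x < ?u" "?adj x ?y" by (auto simp: T_def)
      then obtain i where i: "i < length C" "var (C ! i) div \<beta> = x div (2 * H)" "x mod (2 * H) \<notin> h a i"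
        using sat_adj_clause[OF a(1) x(2)] j(2) by auto
      then show False using mod_B[OF x(1)] ha[OF i(1)] by simp
    qed
    \<comment> \<open>The constraint is neither void nor hit. This leaves an empty demand, in which
      case the constraint itself would be selected and lie in \<open>Iso\<close>.\<close>
    then have "T ?y = {}" using hits y void by blast
    then show False using dom'[OF y] void iso y by (auto simp: Iso_def)
  qed
  then show ?thesis by (auto simp: satisfiable_def)
qed

text \<open>A clause constraint sees at most \<open>k\<close> blocks and a guard sees one, so
  \<open>k + 1\<close> blocks suffice even for \<open>k = 0\<close>; the final \<open>+ 1\<close> is
  for \<open>u\<close>.\<close>

lemma sat_adj_degree:
  assumes "ksat_instance k (n, cs)" and y: "elems n + 1 \<le> y" "y < verts n cs"
  shows "card {x. x < elems n + 1 \<and> sat_adj n cs x y} \<le> (k + 1) * (2 * H) + 1"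
proof -
  let ?u = "elems n"
  define blk where "blk b = {b * (2 * H)..<b * (2 * H) + 2 * H}" for b
  have in_blk: "x \<in> blk (x div (2 * H))" for x
  proof -
    have "x mod (2 * H) < 2 * H" using H by simp
    moreover have "x = x div (2 * H) * (2 * H) + x mod (2 * H)"
      by (rule div_mult_mod_eq[symmetric])
    ultimately show ?thesis unfolding blk_def by (metis atLeastLessThan_iff le_add1 nat_add_left_cancel_less)
  qed
  have "\<exists>I. finite I \<and> card I \<le> k + 1 \<and> {x. x < ?u + 1 \<and> sat_adj n cs x y} \<subseteq> insert ?u (\<Union>b\<in>I. blk b)"
  proof (cases "y = ?u + 1")
    case True
    then show ?thesis by (intro exI[of _ "{}"]) (auto simp: sat_adj_small)
  next
    case False
    then obtain c a where ca: "c < blocks n + length cs" "a < K" "y = constr n c a"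
      using y constr_cases[of n y cs] by auto
    show ?thesis
    proof (cases "c < blocks n")
      case True
      have "{x. x < ?u + 1 \<and> sat_adj n cs x y} \<subseteq> insert ?u (\<Union>b\<in>{c}. blk b)"
        unfolding ca(3) using in_blk sat_adj_guard[OF ca(2) True, of _ cs] by (auto simp: less_Suc_eq)
      then show ?thesis by (intro exI[of _ "{c}"]) auto
    next
      case False
      then obtain j where j: "c = blocks n + j" "j < length cs"
        using ca(1) by (metis add_diff_inverse_nat nat_add_left_cancel_less)
      let ?I = "(\<lambda>i. var (cs ! j ! i) div \<beta>) ` {..<length (cs ! j)}"
      have "length (cs ! j) \<le> k" using assms(1) j(2) by auto
      then have "card ?I \<le> k + 1" using card_image_le[of "{..<length (cs ! j)}" "\<lambda>i. var (cs ! j ! i) div \<beta>"] by simp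
      moreover have "{x. x < ?u + 1 \<and> sat_adj n cs x y} \<subseteq> insert ?u (\<Union>b\<in>?I. blk b)"
      proof (rule subsetI, elim CollectE conjE)
        fix x assume x: "x < ?u + 1" "sat_adj n cs x y"
        show "x \<in> insert ?u (\<Union>b\<in>?I. blk b)"
        proof (cases "x = ?u")
          case False
          then have "x < ?u" using x(1) by simp
          from sat_adj_clause[OF ca(2) this, of cs j] x(2) obtain i where
            i: "i < length (cs ! j)" "var (cs ! j ! i) div \<beta> = x div (2 * H)" unfolding ca(3) j(1) by blast
          then show ?thesis using in_blk[of x] by (intro insertI2 UN_I[of "x div (2 * H)"]) force+
        qed simp
      qed
      ultimately show ?thesis by (intro exI[of _ ?I]) auto
    qed
  qed
  then obtain I where I: "finite I" "card I \<le> k + 1"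
    "{x. x < ?u + 1 \<and> sat_adj n cs x y} \<subseteq> insert ?u (\<Union>b\<in>I. blk b)" by blast
  have "card {x. x < ?u + 1 \<and> sat_adj n cs x y} \<le> card (insert ?u (\<Union>b\<in>I. blk b))"
    using I by (intro card_mono) (auto simp: blk_def)
  also have "\<dots> \<le> Suc (card (\<Union>b\<in>I. blk b))" using I(1) by (intro card_insert_le_m1) auto
  also have "card (\<Union>b\<in>I. blk b) \<le> (\<Sum>b\<in>I. card (blk b))" using I(1) by (rule card_UN_le)
  also have "\<dots> = card I * (2 * H)" by (simp add: blk_def)
  also have "\<dots> \<le> (k + 1) * (2 * H)" using I(2) by (rule mult_le_mono1)
  finally show ?thesis by simp
qed

end

section \<open>Computing the adjacency of the satisfiability graph\<close>

definition lit_code :: "literal \<Rightarrow> nat" where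
  "lit_code l = 2 * var l + (if is_neg l then 1 else 0)"

lemma enc_sat_items: "enc_sat (n, cs) = [n, length cs] @ items (map (map lit_code) cs)"
proof -
  have "enc_literal l = [lit_code l]" for l by (cases l) (auto simp: lit_code_def)
  then have "concat (map enc_literal C) = map lit_code C" for C by (induction C) auto
  then show ?thesis by (simp add: enc_list_def[abs_def] comp_def)
qed

lemma lit_code_div_mod [simp]:
  "lit_code l div 2 = var l" "lit_code l mod 2 = (if is_neg l then 1 else 0)"
  by (auto simp: lit_code_def)

definition Bool :: "bool \<Rightarrow> exp" where "Bool b = Const (if b then 1 else 0)"

lemma holds_Bool [simp]: "holds xs \<rho> (Bool b) \<longleftrightarrow> b"
  by (simp add: Bool_def)

context block_code
begin

definition Blocks :: exp where "Blocks = Plus (Div (Read (Const 0)) \<beta>) (Const 1)"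
definition Elems :: exp where "Elems = Scale (2 * H) Blocks"
definition Constr :: exp where "Constr = Minus (Var 1) (Plus Elems (Const 2))"
definition Clause :: exp where "Clause = Minus (Div Constr K) Blocks"
text \<open>The items start at address \<open>2\<close>, behind \<open>n\<close> and the number of
  clauses; variable \<open>2\<close> is the position of the literal in its clause.\<close>

definition Lit :: exp where "Lit = Item 2 Clause (Var 2)"

definition Sat_guard :: exp where
  "Sat_guard = And_exp (Eq_exp (Div (Var 0) (2 * H)) (Div Constr K))
     (Table K (\<lambda>a. Table (2 * H) (\<lambda>e. Bool (e \<in> G a)) (Mod (Var 0) (2 * H))) (Mod Constr K))"

definition Sat_clause :: exp where
  "Sat_clause = Sum 2 (Item_length 2 Clause) (And_exp (Eq_exp (Div (Div Lit 2) \<beta>) (Div (Var 0) (2 * H)))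
     (Table K (\<lambda>a. Table k (\<lambda>i. Table (2 * H) (\<lambda>e. Bool (e \<notin> h a i)) (Mod (Var 0) (2 * H)))
        (Var 2)) (Mod Constr K)))"

text \<open>The nested tables look up \<open>dec (h a i) r\<close> by the tuple index, the position
  in the clause and the place of the variable in its block; the innermost one compares with the
  sign, the parity of the literal code.\<close>

definition Sat_void :: exp where
  "Sat_void = Sum 2 (Item_length 2 Clause)
     (Table K (\<lambda>a. Table k (\<lambda>i. Table \<beta> (\<lambda>r. Table 2 (\<lambda>s. Bool (dec (h a i) r \<noteq> (s = 1)))
        (Mod Lit 2)) (Mod (Div Lit 2) \<beta>)) (Var 2)) (Mod Constr K))"

definition Sat_adj :: exp where
  "Sat_adj = Cond (Less_exp (Plus Elems (Const 1)) (Var 1))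
     (Cond (Less_exp (Var 0) Elems)
       (Cond (Less_exp (Div Constr K) Blocks) Sat_guard Sat_clause)
       (And_exp (Eq_exp (Var 0) Elems) (And_exp (Neg_exp (Less_exp (Div Constr K) Blocks)) Sat_void)))
     (Or_exp (And_exp (Less_exp (Var 0) Elems) (Eq_exp (Var 1) Elems))
       (And_exp (Eq_exp (Var 0) Elems) (Eq_exp (Var 1) (Plus Elems (Const 1)))))"

lemma fv_sat [simp]:
  "fv Blocks = {}" "fv Elems = {}" "fv Constr = {1}" "fv Clause = {1}" "fv Lit = {1, 2}"
  by (auto simp: Blocks_def Elems_def Constr_def Clause_def Lit_def)

lemma eval_sat:
  assumes "xs = enc_sat (n, cs)"
  shows "eval xs \<rho> Blocks = blocks n" "eval xs \<rho> Elems = elems n"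
    "eval xs \<rho> Constr = \<rho> 1 - (elems n + 2)"
    "eval xs \<rho> (Div Constr K) = (\<rho> 1 - (elems n + 2)) div K"
    "eval xs \<rho> (Mod Constr K) = (\<rho> 1 - (elems n + 2)) mod K"
    "eval xs \<rho> Clause = (\<rho> 1 - (elems n + 2)) div K - blocks n"
proof -
  show b: "eval xs \<rho> Blocks = blocks n" for \<rho>
    unfolding Blocks_def assms enc_sat_items using \<beta> by (simp add: blocks_def)
  show e: "eval xs \<rho> Elems = elems n" for \<rho> by (simp add: Elems_def elems_def b)
  show c: "eval xs \<rho> Constr = \<rho> 1 - (elems n + 2)" for \<rho> by (simp add: Constr_def e)
  show d: "eval xs \<rho> (Div Constr K) = (\<rho> 1 - (elems n + 2)) div K" for \<rho> using K by (simp add: c)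
  show "eval xs \<rho> (Mod Constr K) = (\<rho> 1 - (elems n + 2)) mod K" using K by (simp add: c)
  show "eval xs \<rho> Clause = (\<rho> 1 - (elems n + 2)) div K - blocks n" unfolding Clause_def using b d by simp
qed

lemma holds_Sat_adj:
  assumes valid: "ksat_instance k (n, cs)" and y: "y < verts n cs"
  shows "holds (enc_sat (n, cs)) ((\<lambda>_. 0)(1 := y, 0 := x)) Sat_adj \<longleftrightarrow> sat_adj n cs x y"
proof -
  obtain xs where xs: "xs = enc_sat (n, cs)" by simp
  note ev = eval_sat[OF xs]
  let ?\<rho> = "(\<lambda>_. 0)(1 := y, 0 := x) :: nat \<Rightarrow> nat"
  let ?c = "(y - (elems n + 2)) div K" and ?a = "(y - (elems n + 2)) mod K"
  let ?C = "cs ! (?c - blocks n)"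
  have pos: "0 < 2 * H" "0 < \<beta>" "0 < K" "?a < K" using H \<beta> K by auto
  have guard: "holds xs ?\<rho> Sat_guard \<longleftrightarrow> x div (2 * H) = ?c \<and> x mod (2 * H) \<in> G ?a"
    using pos by (simp add: Sat_guard_def ev)
  have clause: "holds xs ?\<rho> Sat_clause \<longleftrightarrow>
      (\<exists>i<length ?C. var (?C ! i) div \<beta> = x div (2 * H) \<and> x mod (2 * H) \<notin> h ?a i)"
    and void: "holds xs ?\<rho> Sat_void \<longleftrightarrow>
      (\<exists>i<length ?C. dec (h ?a i) (var (?C ! i) mod \<beta>) \<noteq> is_neg (?C ! i))"
    if "\<not> ?c < blocks n" "elems n + 1 < y"
  proof -
    have "y - (elems n + 2) < (blocks n + length cs) * K" using y that(2) by (simp add: verts_def)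
    then have "?c < blocks n + length cs" by (simp add: less_mult_imp_div_less)
    then have j: "?c - blocks n < length cs" using that(1) by linarith
    \<comment> \<open>Positions in the clause stay below \<open>k\<close>, so the lookups in
      \<open>Table k\<close> are within range.\<close>
    have k: "length ?C \<le> k" using valid nth_mem[OF j] by auto
    have items: "xs = [n, length cs] @ items (map (map lit_code) cs)" unfolding xs by (rule enc_sat_items)
    have len: "eval xs ?\<rho> (Item_length 2 Clause) = length ?C"
      using eval_Item(1)[OF items, of 2 ?\<rho> Clause] j by (simp add: ev)
    have lit: "eval xs (?\<rho>(2 := i)) Lit = lit_code (?C ! i)" if "i < length ?C" for i
      unfolding Lit_def
      using eval_Item(2)[OF items, of 2 "?\<rho>(2 := i)" Clause "Var 2"] j that by (simp add: ev)
    show "holds xs ?\<rho> Sat_clause \<longleftrightarrow>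
      (\<exists>i<length ?C. var (?C ! i) div \<beta> = x div (2 * H) \<and> x mod (2 * H) \<notin> h ?a i)"
      unfolding Sat_clause_def holds_derived(7) len
      by (intro ex_cong1 conj_cong refl) (use pos k in \<open>simp add: ev lit[simplified]\<close>)
    show "holds xs ?\<rho> Sat_void \<longleftrightarrow>
      (\<exists>i<length ?C. dec (h ?a i) (var (?C ! i) mod \<beta>) \<noteq> is_neg (?C ! i))"
      unfolding Sat_void_def holds_derived(7) len
      by (intro ex_cong1 conj_cong refl) (use pos k in \<open>auto simp: ev lit[simplified]\<close>)
  qed
  have "holds xs ?\<rho> Sat_adj \<longleftrightarrow> sat_adj n cs x y"
  proof (cases "elems n + 1 < y")
    case True
    then show ?thesis using guard clause void
      by (auto simp: Sat_adj_def sat_adj_def Let_def ev)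
  next
    case False
    then show ?thesis by (simp add: Sat_adj_def sat_adj_def Let_def ev)
  qed
  then show ?thesis unfolding xs .
qed

text \<open>The third condition on the bases says that a block of \<open>2 * H\<close> hub vertices
  costs the solver no more than \<open>\<beta>\<close> variables may cost. The constant factor
  \<open>b * b' ^ \<beta>\<close> pays for the hub vertex \<open>u\<close> and the additional
  block.\<close>

theorem ksat_solvable_by_dominating_set:
  assumes solver: "dominating_set_hub_solvable 1 ((k + 1) * (2 * H) + 1) b"
    and b: "1 \<le> b" "1 \<le> b'" "b ^ (2 * H) \<le> b' ^ \<beta>"
  shows "ksat_solvable k b'"
  unfolding ksat_solvable_def
proof (rule solvable_by_dominating_set[where C = "b * b' ^ \<beta>" and a = Sat_adj, OF solver b(2)])
  define q where "q n = 2 + 2 * n + k + ((k + 1) * (2 * n + 1) ^ k) * (k + 1)" for n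
  show "poly_bounded q" unfolding q_def
    by (intro poly_bounded_add poly_bounded_mult poly_bounded_power poly_bounded_const poly_bounded_id)
  show "0 \<le> b * b' ^ \<beta>" using b by simp
  define adj where "adj i x y \<longleftrightarrow> eval (enc_sat i) ((\<lambda>_. 0)(1 := y, 0 := x)) Sat_adj \<noteq> 0" for i x y
  show "adj i x y \<longleftrightarrow> eval (enc_sat i) ((\<lambda>_. 0)(1 := y, 0 := x)) Sat_adj \<noteq> 0" for i x y
    unfolding adj_def ..
  let ?N = "Plus (Plus Elems (Const 2)) (Scale K (Plus Blocks (Read (Const 1))))"
    and ?p = "Plus Elems (Const 1)" and ?k = "Plus (Scale H Blocks) (Const 1)"
  fix i assume i: "ksat_instance k i"
  obtain n cs where [simp]: "i = (n, cs)" by (cases i)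
  have valid: "ksat_instance k (n, cs)" using i by simp
  let ?A = "Pos ` {..<n} \<union> Neg ` {..<n}"
  have lit: "l \<in> ?A" if "var l < n" for l using that by (cases l) auto
  have sub: "set C \<subseteq> ?A \<and> length C \<le> k" if "C \<in> set cs" for C
    using valid that lit by (auto simp: subset_iff image_subset_iff)
  have "card ?A \<le> card (Pos ` {..<n}) + card (Neg ` {..<n})" by (rule card_Un_le)
  also have "\<dots> \<le> 2 * n" using card_image_le[of "{..<n}" Pos] card_image_le[of "{..<n}" Neg] by simp
  finally have "length cs \<le> (k + 1) * (2 * n + 1) ^ k"
    using length_distinct_sets_le[of cs ?A k "2 * n"] valid sub by auto
  then have len: "length cs * (k + 1) \<le> ((k + 1) * (2 * n + 1) ^ k) * (k + 1)" by (rule mult_le_mono1)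
  have len2: "length cs \<le> length cs * (k + 1)" by simp
  show "bounded_by (q (fst i)) (enc_sat i) (\<lambda>_. 0)"
  proof (rule bounded_by_items[where pre = "[n, length cs]" and cs = "map (map lit_code) cs" and d = k])
    show "enc_sat i = [n, length cs] @ items (map (map lit_code) cs)"
      using enc_sat_items by simp
    show "length C \<le> k \<and> (\<forall>x\<in>set C. x \<le> q (fst i))" if C: "C \<in> set (map (map lit_code) cs)" for C
    proof -
      obtain D where D: "D \<in> set cs" "C = map lit_code D" using C by auto
      have "lit_code l \<le> q (fst i)" if "l \<in> set D" for l
      proof -
        have "var l < n" using valid D(1) that by auto
        then show ?thesis by (auto simp: lit_code_def q_def intro!: trans_le_add1)
      qed
      then show ?thesis using D valid by auto
    qed
    show "x \<le> q (fst i)" if "x \<in> set [n, length cs]" for x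
      using that len len2 unfolding q_def by auto
    show "length [n, length cs] + length (map (map lit_code) cs) * (k + 1) \<le> q (fst i)"
      using len unfolding q_def by simp
    show "k \<le> q (fst i)" by (simp add: q_def)
  qed
  obtain xs where xs: "xs = enc_sat (n, cs)" by simp
  have "eval xs (\<lambda>_. 0) (Read (Const 1)) = length cs" unfolding xs enc_sat_items by simp
  then have ev: "eval (enc_sat i) (\<lambda>_. 0) ?N = verts n cs" "eval (enc_sat i) (\<lambda>_. 0) ?p = elems n + 1"
    "eval (enc_sat i) (\<lambda>_. 0) ?k = blocks n * H + 1"
    unfolding \<open>i = (n, cs)\<close> xs[symmetric] by (simp_all add: eval_sat[OF xs] verts_def del: eval.simps(5))
  have adj: "adj i x y \<longleftrightarrow> sat_adj n cs x y" if "y < verts n cs" for x y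
    using holds_Sat_adj[OF valid that, of x] by (simp add: adj_def holds_def)
  show "hub_instance 1 ((k + 1) * (2 * H) + 1)
     (ds_of (eval (enc_sat i) (\<lambda>_. 0) ?N) (eval (enc_sat i) (\<lambda>_. 0) ?p) (adj i))"
    unfolding ev
  proof (rule hub_instance_ds_of)
    show "elems n + 1 \<le> verts n cs" by (simp add: verts_def)
    show "x < elems n + 1" if "y < verts n cs" "adj i x y" for x y
      using that adj sat_adj_le by (simp add: less_Suc_eq_le)
    show "card {x. x < elems n + 1 \<and> adj i x y} \<le> (k + 1) * (2 * H) + 1"
      if "elems n + 1 \<le> y" "y < verts n cs" for y
      using sat_adj_degree[OF valid that] adj[OF that(2)] by simp
  qed
  show "b ^ eval (enc_sat i) (\<lambda>_. 0) ?p \<le> b * b' ^ \<beta> * b' ^ fst i"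
  proof -
    have "(b ^ (2 * H)) ^ blocks n = b ^ elems n"
      unfolding elems_def power_mult[symmetric] by (simp only: mult.commute)
    then have "b ^ (elems n + 1) = b * (b ^ (2 * H)) ^ blocks n" by simp
    also have "\<dots> \<le> b * (b' ^ \<beta>) ^ blocks n"
      using b by (intro mult_left_mono power_mono) auto
    also have "\<dots> = b * b' ^ (\<beta> + n div \<beta> * \<beta>)"
      by (simp add: blocks_def power_mult[symmetric] power_add algebra_simps)
    also have "\<dots> \<le> b * b' ^ (\<beta> + n)" using b by (intro mult_left_mono power_increasing) auto
    finally show ?thesis unfolding ev using b by (simp add: power_add mult.assoc)
  qed
  show "satisfiable (sat_formula i) \<longleftrightarrow>
     has_dominating_set (eval (enc_sat i) (\<lambda>_. 0) ?N) (adj i) (eval (enc_sat i) (\<lambda>_. 0) ?k)"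
  proof -
    have "edges_of (verts n cs) (adj i) = edges_of (verts n cs) (sat_adj n cs)"
      unfolding edges_of_def using adj by auto
    then show ?thesis unfolding ev has_dominating_set_def
      using sat_imp_dominating[OF valid] dominating_imp_sat[OF valid]
      by (auto simp: has_dominating_set_def)
  qed
qed

end

subsection \<open>The lower bound\<close>

text \<open>The number of codes is at least \<open>4 ^ H / (2 * H)\<close>, and rounding down to a
  power of two loses less than a factor of two. As \<open>b\<^sup>2 / 4 < 1\<close>, the exponential
  gap between \<open>b ^ (2 * H)\<close> and \<open>4 ^ H\<close> eventually beats the factor
  \<open>4 * H\<close>. The new base depends on \<open>b\<close> only.\<close>

lemma block_size_exists:
  fixes b :: real
  assumes "1 \<le> b" and "b < 2"
  obtains H \<beta> b' where "0 < H" "0 < \<beta>" "2 ^ \<beta> \<le> (2 * H) choose H" "1 \<le> b'" "b' < 2"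
    "b ^ (2 * H) \<le> b' ^ \<beta>"
proof -
  let ?x = "b\<^sup>2 / 4"
  have "b\<^sup>2 < 2\<^sup>2" using assms by (intro power_strict_mono) auto
  then have x: "norm ?x < 1" by simp
  have "(\<lambda>n. real n * ?x ^ n) \<longlonglongrightarrow> 0" using powser_times_n_limit_0[OF x] by simp
  then have "\<forall>\<^sub>F n in sequentially. real n * ?x ^ n < 1 / 4" by (rule order_tendstoD) simp
  \<comment> \<open>Of the \<open>1 / 4\<close>, one half comes from the lower bound on the binomial
    coefficient and the other from rounding \<open>\<beta>\<close>.\<close>
  then obtain H where H: "real H * ?x ^ H < 1 / 4" "0 < H"
    using eventually_happens'[OF _ eventually_conj[OF _ eventually_gt_at_top[of 0]]] by force
  have "b ^ (2 * H) * (4 * real H) < 4 ^ H"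
  proof -
    have "b ^ (2 * H) = ?x ^ H * 4 ^ H" by (simp add: power_mult power_divide)
    then have "b ^ (2 * H) * (4 * real H) = 4 * (real H * ?x ^ H) * 4 ^ H" by simp
    also have "\<dots> < 1 * 4 ^ H" using H(1) by (intro mult_strict_right_mono) auto
    finally show ?thesis by simp
  qed
  then have lt: "b ^ (2 * H) < 4 ^ H / (4 * real H)" using H(2) by (simp add: field_simps)
  have bin: "4 ^ H / (2 * real H) \<le> real ((2 * H) choose H)" by (rule central_binomial_lower_bound[OF H(2)])
  \<comment> \<open>The integer part of the binary logarithm: \<open>floorlog\<close> counts binary
    digits.\<close>
  define \<beta> where "\<beta> = floorlog 2 ((2 * H) choose H) - 1"
  have "0 < (2 * H) choose H" by simp
  then have \<beta>: "2 ^ \<beta> \<le> (2 * H) choose H" "(2 * H) choose H < 2 ^ (\<beta> + 1)"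
    using floorlog_bounds[of "(2 * H) choose H" 2] by (auto simp: \<beta>_def floorlog_def)
  have "real ((2 * H) choose H) < 2 * 2 ^ \<beta>"
    using \<beta>(2) by (metis of_nat_less_iff of_nat_mult of_nat_numeral of_nat_power power_add power_one_right mult.commute)
  with bin have "4 ^ H / (2 * real H) < 2 * 2 ^ \<beta>" by linarith
  then have "4 ^ H / (4 * real H) < 2 ^ \<beta>" by simp
  with lt have key: "b ^ (2 * H) < 2 ^ \<beta>" by linarith
  have one: "1 \<le> b ^ (2 * H)" using assms(1) by simp
  have "0 < \<beta>" using key one by (cases "\<beta> = 0") auto
  \<comment> \<open>The smallest base that satisfies the size condition, with equality; it is below
    2 because \<open>b ^ (2 * H) < 2 ^ \<beta>\<close>.\<close>
  define b' where "b' = root \<beta> (b ^ (2 * H))"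
  have "b' ^ \<beta> = b ^ (2 * H)" unfolding b'_def using \<open>0 < \<beta>\<close> one by (intro real_root_pow_pos2) auto
  moreover have "1 \<le> b'" unfolding b'_def using \<open>0 < \<beta>\<close> one by simp
  moreover have "b' < 2"
    using key \<open>1 \<le> b'\<close> \<open>b' ^ \<beta> = b ^ (2 * H)\<close> by (metis power_less_imp_less_base zero_le_numeral)
  ultimately show ?thesis using that[of H \<beta> b'] H(2) \<open>0 < \<beta>\<close> \<beta>(1) by simp
qed

text \<open>The block size and \<open>b'\<close> are fixed before \<open>k\<close>, so one base
  serves all \<open>k\<close>. The solver is required for every \<open>\<delta>\<close> because the
  degree grows with \<open>k\<close>.\<close>

lemma not_SETH_if_dominating_set:
  assumes b: "1 \<le> b" "b < 2" and solver: "\<And>\<delta>. 0 < \<delta> \<Longrightarrow> dominating_set_hub_solvable 1 \<delta> b"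
  shows "\<not> SETH"
proof -
  obtain H \<beta> b' where *: "0 < H" "0 < \<beta>" "2 ^ \<beta> \<le> (2 * H) choose H" "1 \<le> b'" "b' < 2"
    "b ^ (2 * H) \<le> b' ^ \<beta>" using block_size_exists[OF b] by blast
  have "ksat_solvable k b'" for k
  proof -
    obtain K h G dec where "block_code H \<beta> k K h G dec" using block_code_exists[OF *(1-3)] by blast
    from block_code.ksat_solvable_by_dominating_set[OF this solver b(1) *(4,6)] show ?thesis by simp
  qed
  then show ?thesis unfolding SETH_def using *(5) by (auto intro!: exI[of _ "2 - b'"])
qed

lemma not_SCC_if_dominating_set:
  assumes b: "1 \<le> b" "b < 2" and solver: "\<And>\<delta>. 0 < \<delta> \<Longrightarrow> dominating_set_hub_solvable 1 \<delta> b"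
  shows "\<not> SCC"
proof -
  have "set_cover_solvable d b" for d
    using set_cover_solvable_by_dominating_set[OF solver b(1)] by simp
  then show ?thesis unfolding SCC_def using b by (auto intro!: exI[of _ "2 - b"])
qed

lemma dominating_set_hub_solvable_mono:
  assumes "dominating_set_hub_solvable \<sigma> \<delta> b" and "0 \<le> b" "b \<le> b'"
  shows "dominating_set_hub_solvable \<sigma> \<delta> b'"
proof -
  have "b ^ k * (real n + 2) ^ c \<le> b' ^ k * (real n + 2) ^ c" for k n c
    using assms(2,3) by (intro mult_right_mono power_mono) auto
  then show ?thesis
    using assms(1) unfolding dominating_set_hub_solvable_def solvable_in_time_def solves_within_def
    by (meson order_trans)
qed

text \<open>Disposes of \<open>\<epsilon> > 2\<close>: on a single vertex that is its own hub, the
  exponent is odd and the time bound negative.\<close>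

lemma not_solvable_negative_base:
  assumes "b < 0"
  shows "\<not> dominating_set_hub_solvable 1 1 b"
proof
  assume "dominating_set_hub_solvable 1 1 b"
  then obtain P c where P: "\<And>i. hub_instance 1 1 i \<Longrightarrow> \<exists>t s. exec P (init_state (enc_ds i)) t s \<and>
      real t \<le> b ^ hub_size i * (real (num_vertices i) + 2) ^ c"
    unfolding dominating_set_hub_solvable_def solvable_in_time_def solves_within_def by blast
  have "hub_instance 1 1 (1, [], [0])"
    by (auto simp: simple_graph_def is_hub_def components_on_def)
  from P[OF this] obtain t where "real t \<le> b * 3 ^ c" by auto
  moreover have "b * 3 ^ c < 0" using assms by (simp add: mult_neg_pos)
  ultimately show False by linarith
qed

theorem theorem1p6:
  assumes "SETH \<or> SCC"
  shows "\<forall>\<epsilon>::real. \<epsilon> > 0 \<longrightarrow>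
           (\<exists>\<sigma> \<delta>. \<sigma> > 0 \<and> \<delta> > 0 \<and> \<not> dominating_set_hub_solvable \<sigma> \<delta> (2 - \<epsilon>))"
proof (intro allI impI, rule ccontr)
  fix \<epsilon> :: real
  assume "\<epsilon> > 0"
    and "\<not> (\<exists>\<sigma> \<delta>. \<sigma> > 0 \<and> \<delta> > 0 \<and> \<not> dominating_set_hub_solvable \<sigma> \<delta> (2 - \<epsilon>))"
  then have solver: "dominating_set_hub_solvable 1 \<delta> (2 - \<epsilon>)" if "\<delta> > 0" for \<delta>
    using that zero_less_one by blast
  have "0 \<le> 2 - \<epsilon>" using not_solvable_negative_base solver[of 1] by force
  \<comment> \<open>The reductions need a base of at least 1, whereas \<open>2 - \<epsilon>\<close>
    may lie below it; raising the base to 1 keeps it below 2.\<close>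
  then have "dominating_set_hub_solvable 1 \<delta> (max 1 (2 - \<epsilon>))" if "\<delta> > 0" for \<delta>
    using dominating_set_hub_solvable_mono[OF solver[OF that]] by simp
  then have "\<not> SETH" "\<not> SCC"
    using not_SETH_if_dominating_set[of "max 1 (2 - \<epsilon>)"] not_SCC_if_dominating_set[of "max 1 (2 - \<epsilon>)"]
      \<open>\<epsilon> > 0\<close> by auto
  then show False using assms by blast
qed

end
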